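(* Let $N\ge1$ and $p=p_F:=1+2/N$. Then there exist positive constants $C_1\le C_2$ independent of $\alpha$ such that, for all $\alpha\in(0,1)$ sufficiently close to $1$, $$\mathcal{B}^+\left(C_1(1-\alpha)^{\frac N2}\right)\subset\mathcal{G}_\alpha\subset\mathcal{B}^+\left(C_2(1-\alpha)^{\frac N2}\right).$$
   Context: $\mathcal{M}$ is the set of Radon measures $\nu$ on $\mathbf{R}^N$ with $\|\nu|\mathcal{M}\|:=|\nu|(\mathbf{R}^N)<\infty$, where $|\nu|$ is the total variation of $\nu$; $\nu\ge0$ means that $\nu$ is a nonnegative measure. For $r>0$, $\mathcal{B}^+(r):=\{\nu\in\mathcal{M};\ \nu\ge0,\ \|\nu|\mathcal{M}\|\le r\}$. For $\alpha\in(0,1)$, $\mathcal{G}_\alpha$ is the set of all $\nu\in\mathcal{M}$ with $\nu\ge0$ such that the problem $$(\mathrm{P})_\alpha:\qquad {}^{C}\partial_t^\alpha u-\Delta u=u^p\quad (t>0,\ x\in\mathbf{R}^N),\qquad u(0)=\mu\ \text{ in }\mathbf{R}^N,$$ with $\mu=\nu$ (and here $p=p_F$) possesses a global-in-time solution, i.e. a solution in $[0,\infty)\times\mathbf{R}^N$ in the sense below. For $t>0$, $x\in\mathbf{R}^N$, $G(t,x):=(4\pi t)^{-N/2}\exp(-|x|^2/(4t))$, and for a Radon measure $\mu$ on $\mathbf{R}^N$, $e^{t\Delta}\mu(x):=\int_{\mathbf{R}^N}G(t,x-y)\,d\mu(y)$. A locally integrable function $\phi$ is identified with the Radon measure $\phi\,dx$.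 For $\alpha\in(0,1)$, $h_\alpha>0$ denotes the probability density function on $(0,\infty)$ characterized by $$\int_0^\infty h_\alpha(\theta)e^{z\theta}\,d\theta=E_{\alpha,1}(z),\qquad z\in\mathbf{C},\qquad\text{where } E_{\alpha,\beta}(z):=\sum_{k=0}^\infty\frac{z^k}{\Gamma(\alpha k+\beta)}$$ is the Mittag--Leffler function. It also satisfies $\int_0^\infty\alpha\theta h_\alpha(\theta)e^{z\theta}\,d\theta=E_{\alpha,\alpha}(z)$ for $z\in\mathbf{C}$ and $\int_0^\infty\theta^\delta h_\alpha(\theta)\,d\theta=\Gamma(1+\delta)/\Gamma(1+\alpha\delta)<\infty$ for $\delta>-1$. Set, for $t>0$, $$P_\alpha(t)\mu:=\int_0^\infty h_\alpha(\theta)\,e^{t^\alpha\theta\Delta}\mu\,d\theta,\qquad S_\alpha(t)\mu:=\int_0^\infty\theta h_\alpha(\theta)\,e^{t^\alpha\theta\Delta}\mu\,d\theta.$$ Here ${}^{C}\partial_t^\alpha$ is the Caputo derivative of order $\alpha$, $({}^{C}\partial_t^\alpha f)(t)=\frac{1}{\Gamma(1-\alpha)}\frac{d}{dt}\int_0^t\frac{f(s)-f(0)}{(t-s)^\alpha}\,ds$, but solutions are understood in the following integral sense. Definition of solution: for $T\in(0,\infty]$ and a nonnegative Radon measure $\mu$, a nonnegative measurable function $u$ on $(0,T)\times\mathbf{R}^N$ is a solution of $(\mathrm{P})_\alpha$ in $[0,T)\times\mathbf{R}^N$ if $$\infty>u(t,x)=[P_\alpha(t)\mu](x)+\alpha\int_0^t(t-s)^{\alpha-1}[S_\alpha(t-s)u(s)^p](x)\,ds$$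 for almost all $t\in(0,T)$ and $x\in\mathbf{R}^N$. *)

theory Defs
  imports "HOL-Analysis.Analysis"
begin

definition radon_measure :: "'a::euclidean_space measure \<Rightarrow> bool" where
  "radon_measure \<nu> \<longleftrightarrow>
     sets \<nu> = sets borel \<and>
     (\<forall>K. compact K \<longrightarrow> emeasure \<nu> K < \<infinity>) \<and>
     (\<forall>B\<in>sets borel. emeasure \<nu> B = (SUP K\<in>{K. compact K \<and> K \<subseteq> B}. emeasure \<nu> K))"

text \<open>
  The nonnegative elements of the space \<open>\<M>\<close> of finite signed Radon measures; signed measures
  are not needed, since only nonnegative ones enter the ball \<open>\<B>\<^sup>+(r)\<close> and the set \<open>\<G>\<^sub>\<alpha>\<close>.
  For these the total variation measure is the measure itself, so the norm is the total mass.
\<close>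

definition finite_radon_measures :: "'a::euclidean_space measure set" where
  "finite_radon_measures = {\<nu>. radon_measure \<nu> \<and> emeasure \<nu> UNIV < \<infinity>}"

definition Bplus :: "real \<Rightarrow> 'a::euclidean_space measure set" where
  "Bplus r = {\<nu>\<in>finite_radon_measures. emeasure \<nu> UNIV \<le> ennreal r}"

definition heat_kernel :: "real \<Rightarrow> 'a::euclidean_space \<Rightarrow> real" where
  "heat_kernel t x =
     (4 * pi * t) powr (- (real DIM('a) / 2)) * exp (- ((norm x)\<^sup>2 / (4 * t)))"

text \<open>
  All integrands below are nonnegative, so the integrals are taken with values in \<open>[0, \<infinity>]\<close>.
  The argument \<open>\<mu>\<close> is a Borel measure or a measure \<open>\<phi> dx\<close> given by a Lebesgue measurable density.
\<close>

definition heat_semigroup :: "real \<Rightarrow> 'a::euclidean_space measure \<Rightarrow> 'a \<Rightarrow> ennreal" where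
  "heat_semigroup t \<mu> x = (\<integral>\<^sup>+ y. ennreal (heat_kernel t (x - y)) \<partial>\<mu>)"

definition mittag_leffler :: "real \<Rightarrow> real \<Rightarrow> complex \<Rightarrow> complex" where
  "mittag_leffler \<alpha> \<beta> z = (\<Sum>k. z ^ k / of_real (Gamma (\<alpha> * real k + \<beta>)))"

text \<open>
  \<open>h\<close> is a version of the density \<open>h\<^sub>\<alpha>\<close>. The case \<open>z = 0\<close> of the transform says that \<open>h\<close> is
  measurable and has total integral \<open>E\<^bsub>\<alpha>,1\<^esub>(0) = 1\<close>. The transform determines \<open>h\<close> almost everywhere
  on \<open>(0, \<infinity>)\<close>, so the operators below do not depend on the version.
\<close>

definition mittag_leffler_density :: "real \<Rightarrow> (real \<Rightarrow> real) \<Rightarrow> bool" where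
  "mittag_leffler_density \<alpha> h \<longleftrightarrow>
     (\<forall>\<theta>>0. h \<theta> > 0) \<and>
     (\<forall>z::complex. has_bochner_integral (restrict_space lborel {0<..})
        (\<lambda>\<theta>. of_real (h \<theta>) * exp (z * of_real \<theta>)) (mittag_leffler \<alpha> 1 z))"

definition P_op ::
  "(real \<Rightarrow> real) \<Rightarrow> real \<Rightarrow> real \<Rightarrow> 'a::euclidean_space measure \<Rightarrow> 'a \<Rightarrow> ennreal" where
  "P_op h \<alpha> t \<mu> x =
     (\<integral>\<^sup>+ \<theta>\<in>{0<..}. ennreal (h \<theta>) * heat_semigroup (t powr \<alpha> * \<theta>) \<mu> x \<partial>lborel)"

definition S_op ::
  "(real \<Rightarrow> real) \<Rightarrow> real \<Rightarrow> real \<Rightarrow> 'a::euclidean_space measure \<Rightarrow> 'a \<Rightarrow> ennreal" where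
  "S_op h \<alpha> t \<mu> x =
     (\<integral>\<^sup>+ \<theta>\<in>{0<..}. ennreal (\<theta> * h \<theta>) * heat_semigroup (t powr \<alpha> * \<theta>) \<mu> x \<partial>lborel)"

text \<open>
  Since \<open>u\<close> is real valued, the equation in \<open>[0, \<infinity>]\<close> includes the finiteness of its right-hand side.
\<close>

definition is_solution ::
  "(real \<Rightarrow> real) \<Rightarrow> real \<Rightarrow> real \<Rightarrow> ereal \<Rightarrow> 'a::euclidean_space measure
     \<Rightarrow> (real \<Rightarrow> 'a \<Rightarrow> real) \<Rightarrow> bool" where
  "is_solution h \<alpha> p T \<mu> u \<longleftrightarrow>
     (\<forall>t x. 0 < t \<and> ereal t < T \<longrightarrow> 0 \<le> u t x) \<and>
     (\<lambda>(t, x). u t x) \<in> borel_measurable (lebesgue_on ({t. 0 < t \<and> ereal t < T} \<times> UNIV)) \<and>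
     (AE (t, x) in lebesgue_on ({t. 0 < t \<and> ereal t < T} \<times> UNIV).
        ennreal (u t x) =
          P_op h \<alpha> t \<mu> x +
          ennreal \<alpha> * (\<integral>\<^sup>+ s\<in>{0<..<t}. ennreal ((t - s) powr (\<alpha> - 1)) *
            S_op h \<alpha> (t - s) (density lebesgue (\<lambda>y. ennreal (u s y powr p))) x \<partial>lborel))"

definition G_set ::
  "(real \<Rightarrow> real) \<Rightarrow> real \<Rightarrow> real \<Rightarrow> 'a::euclidean_space measure set" where
  "G_set h \<alpha> p = {\<nu>\<in>finite_radon_measures. \<exists>u. is_solution h \<alpha> p \<infinity> \<nu> u}"

end

theory Submission
  imports Defs "HOL-Probability.Distributions"
begin

text \<open>
  Existence: in the critical case the operators \<open>P\<^sub>\<alpha>(t)\<close> and \<open>S\<^sub>\<alpha>(t)\<close> map measures into \<open>L\<^sup>p\<close> with norm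
  \<open>O(t\<^sup>-\<^sup>\<alpha>\<^sup>/\<^sup>p)\<close>. If \<open>\<parallel>u(t)\<parallel>\<^sub>p \<le> M t\<^sup>-\<^sup>\<alpha>\<^sup>/\<^sup>p\<close>, then \<open>u(s)\<^sup>p\<close> has mass at most \<open>M\<^sup>p s\<^sup>-\<^sup>\<alpha>\<close>, which is integrable
  near \<open>s = 0\<close> only because \<open>\<alpha> < 1\<close> and contributes a factor \<open>1 / (1 - \<alpha>)\<close>. Monotone iteration hence
  stays bounded if \<open>M\<^sup>p\<^sup>-\<^sup>1\<close> is a small multiple of \<open>1 - \<alpha>\<close>, where \<open>p - 1 = 2 / N\<close>.

  Nonexistence: if \<open>u(s, y) \<ge> a s\<^sup>-\<^sup>\<alpha>\<^sup>N\<^sup>/\<^sup>2\<close> on the paraboloid \<open>\<bar>y\<bar> \<le> s\<^sup>\<alpha>\<^sup>/\<^sup>2\<close> for \<open>s \<ge> \<tau>\<close>, then the Duhamel term improves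
  \<open>a\<close> to a multiple of \<open>a\<^sup>p (1 - (\<tau> / \<sigma>)\<^sup>1\<^sup>-\<^sup>\<alpha>) / (1 - \<alpha>)\<close> for \<open>s \<ge> \<sigma>\<close>. If \<open>a\<^sup>p\<^sup>-\<^sup>1\<close> is a large multiple of
  \<open>1 - \<alpha>\<close>, iterating this along a bounded sequence of times makes \<open>u\<close> infinite on a set of positive measure.

  All constants are uniform in \<open>\<alpha>\<close> near \<open>1\<close> because \<open>h\<^sub>\<alpha>\<close> concentrates at \<open>\<theta> = 1\<close> and has bounded moments
  of order \<open>- 1 / p\<close>; the latter follow from the decay \<open>z E\<^bsub>\<alpha>,1\<^esub>(- z) \<le> 1\<close>.
\<close>

section \<open>The Mittag-Leffler density\<close>

text \<open>At p = 1 + 2/N the identity (N/2)(1 - 1/p) = 1/p turns heat smoothing from measures into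
  L^p into a factor \<tau>^(-1/p). Hence the supremum over t of t^(\<alpha>/p) times the L^p norm of
  u(t) is scale invariant: it is finite for the linear term, and the Duhamel term preserves it. The
  same balance, b p = b + \<alpha> with b = \<alpha> N/2, makes the weight t^(-b) on the paraboloid
  reproduce itself. In both directions s^(-\<alpha>) is left over, and its time integral supplies
  matching upper and lower bounds of order 1/(1 - \<alpha>). The obstacle is uniformity in \<alpha>,
  since \<open>h\<close> is given only through its positivity and its transform. Every estimate of
  \<open>h\<close> is therefore reduced to values of E_{\<alpha>,1} on the real line: powers of
  \<theta> and cut-offs are compared with combinations of exponentials.\<close>

definition ml_real :: "real \<Rightarrow> real \<Rightarrow> real" where
  "ml_real \<alpha> x = (\<Sum>k. x ^ k / Gamma (\<alpha> * real k + 1))"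

text \<open>Euler's integral restricted to t \<ge> A, where t^(s-1) \<ge> A^(s-1) because s \<ge> 1.
  The parameter A remains free, so the growth of Gamma beats any prescribed geometric rate.\<close>

lemma Gamma_real_lower_bound:
  fixes s A :: real
  assumes "1 \<le> s" "0 < A"
  shows "A powr (s - 1) * exp (- A) \<le> Gamma s"
proof -
  have "((\<lambda>t. exp (-1 * t)) has_integral exp (-1 * A) / 1) {A..}"
    by (rule has_integral_exp_minus_to_infinity) simp
  then have "((\<lambda>t. A powr (s - 1) * exp (- t)) has_integral A powr (s - 1) * exp (- A)) {A..}"
    by (intro has_integral_mult_right) simp
  then have 1: "((\<lambda>t. if t \<in> {A..} then A powr (s - 1) * exp (- t) else 0) has_integral
      A powr (s - 1) * exp (- A)) {0..}"
    using assms by (subst has_integral_restrict) auto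
  show ?thesis
  proof (rule has_integral_le[OF 1 Gamma_integral_real])
    show "0 < s" using assms by simp
    fix t :: real assume "t \<in> {0..}"
    show "(if t \<in> {A..} then A powr (s - 1) * exp (- t) else 0) \<le> t powr (s - 1) / exp t"
      using assms by (auto simp: exp_minus field_simps intro!: powr_mono2)
  qed
qed

text \<open>A geometric majorant that does not depend on \<alpha>. With A = 4 z^2 + 1 the Gamma
  bound yields sqrt(A)^k e^(-A) in the denominator, and 2 |z| \<le> sqrt(A) leaves the ratio
  1/2.\<close>

lemma ml_real_term_bound:
  fixes z \<alpha> :: real
  assumes "1/2 \<le> \<alpha>"
  shows "norm (z ^ k / Gamma (\<alpha> * real k + 1)) \<le> exp (4 * z\<^sup>2 + 1) * (1/2) ^ k"
proof -
  define A where "A = 4 * z\<^sup>2 + 1"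
  have A: "1 \<le> A" by (simp add: A_def)
  have "A powr (real k / 2) * exp (- A) \<le> A powr (\<alpha> * real k + 1 - 1) * exp (- A)"
  proof (intro mult_right_mono powr_mono)
    show "real k / 2 \<le> \<alpha> * real k + 1 - 1"
      using mult_right_mono[OF assms, of "real k"] by simp
  qed (use A in auto)
  also have "\<dots> \<le> Gamma (\<alpha> * real k + 1)"
    using A assms by (intro Gamma_real_lower_bound) auto
  finally have G: "A powr (real k / 2) * exp (- A) \<le> Gamma (\<alpha> * real k + 1)" .
  have pos: "0 < A powr (real k / 2) * exp (- A)" using A by simp
  have sq: "A powr (real k / 2) = sqrt A ^ k"
    using A by (simp add: powr_half_sqrt[symmetric] powr_realpow[symmetric] powr_powr)
  have "2 * \<bar>z\<bar> \<le> sqrt A"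
    by (rule real_le_rsqrt) (simp add: A_def power_mult_distrib)
  then have "(2 * \<bar>z\<bar>) ^ k \<le> sqrt A ^ k" by (intro power_mono) auto
  then have z: "\<bar>z\<bar> ^ k \<le> sqrt A ^ k * (1/2) ^ k"
    by (simp add: power_mult_distrib power_divide field_simps)
  have "norm (z ^ k / Gamma (\<alpha> * real k + 1)) = \<bar>z\<bar> ^ k / Gamma (\<alpha> * real k + 1)"
    using G pos by (simp add: power_abs)
  also have "\<dots> \<le> (sqrt A ^ k * (1/2) ^ k) / (sqrt A ^ k * exp (- A))"
    using G pos z A unfolding sq by (intro frac_le) auto
  also have "\<dots> = exp A * (1/2) ^ k"
    using A by (simp add: exp_minus field_simps)
  finally show ?thesis by (simp add: A_def)
qed

lemma summable_ml_real:
  assumes "1/2 \<le> \<alpha>"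
  shows "summable (\<lambda>k. norm (z ^ k / Gamma (\<alpha> * real k + 1) :: real))"
  by (rule summable_comparison_test[of _ "\<lambda>k. exp (4 * z\<^sup>2 + 1) * (1/2) ^ k"])
     (use ml_real_term_bound[OF assms, of z] in \<open>auto intro!: summable_mult summable_geometric\<close>)

text \<open>The majorant allows the limit inside the series, where Gamma(\<alpha> k + 1) tends to
  k!. Beyond \<open>1/2 \<le> \<alpha>\<close> and \<open>\<alpha> < 1\<close>, this limit is the
  only source of the requirement that \<alpha> be close to 1.\<close>

lemma ml_real_tendsto_exp: "((\<lambda>\<alpha>. ml_real \<alpha> z) \<longlongrightarrow> exp z) (at_left 1)"
proof -
  have ev: "\<forall>\<^sub>F \<alpha> in at_left (1::real). 1/2 \<le> \<alpha>"
    by (rule eventually_at_leftI[of "1/2"]) auto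
  have "((\<lambda>\<alpha>. \<Sum>k. z ^ k / Gamma (\<alpha> * real k + 1)) \<longlongrightarrow> (\<Sum>k. z ^ k / Gamma (1 * real k + 1)))
          (at_left 1)"
  proof (rule conjunct2[OF conjunct2[OF tannerys_theorem]])
    fix k
    have "(1 * real k + 1) \<notin> \<int>\<^sub>\<le>\<^sub>0"
      by (auto dest: nonpos_Ints_nonpos)
    then show "((\<lambda>\<alpha>. z ^ k / Gamma (\<alpha> * real k + 1)) \<longlongrightarrow> z ^ k / Gamma (1 * real k + 1)) (at_left 1)"
      by (intro tendsto_intros) (auto simp: Gamma_eq_zero_iff)
  next
    show "\<forall>\<^sub>F (k, n) in at_top \<times>\<^sub>F at_left 1. norm (z ^ k / Gamma (n * real k + 1))
        \<le> exp (4 * z\<^sup>2 + 1) * (1/2) ^ k"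
      unfolding eventually_prod_filter using ev
      by (intro exI[of _ "\<lambda>_. True"] exI[of _ "\<lambda>\<alpha>. 1/2 \<le> \<alpha>"])
         (use ml_real_term_bound in auto)
    show "summable (\<lambda>k. exp (4 * z\<^sup>2 + 1) * (1/2::real) ^ k)"
      by (auto intro!: summable_mult summable_geometric)
  qed auto
  moreover have "(\<Sum>k. z ^ k / Gamma (1 * real k + 1)) = exp z"
    unfolding exp_def by (intro suminf_cong) (simp add: Gamma_fact add.commute divide_inverse)
  ultimately show ?thesis by (simp add: ml_real_def)
qed

section \<open>The density through its Laplace transform\<close>

lemma mittag_leffler_of_real:
  assumes "1/2 \<le> \<alpha>"
  shows "mittag_leffler \<alpha> 1 (of_real x) = of_real (ml_real \<alpha> x)"
proof -
  have "summable (\<lambda>k. x ^ k / Gamma (\<alpha> * real k + 1))"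
    by (rule summable_norm_cancel[OF summable_ml_real[OF assms]])
  then show ?thesis
    unfolding mittag_leffler_def ml_real_def by (subst suminf_of_real) auto
qed

text \<open>\<open>h\<close> is constrained on the positive half-line only, so measurability is
  stated for its truncation. The point z = 0 of the transform already supplies it.\<close>

lemma mittag_leffler_density_measurable:
  assumes "mittag_leffler_density \<alpha> h"
  shows "(\<lambda>\<theta>. indicator {0<..} \<theta> * h \<theta>) \<in> borel_measurable lborel"
proof -
  have "has_bochner_integral (restrict_space lborel {0<..})
      (\<lambda>\<theta>. of_real (h \<theta>) * exp (0 * of_real \<theta>)) (mittag_leffler \<alpha> 1 0)"
    using assms unfolding mittag_leffler_density_def by blast
  then have "(\<lambda>\<theta>. complex_of_real (h \<theta>) * exp (0 * of_real \<theta>)) \<in>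
      borel_measurable (restrict_space lborel {0<..})"
    by (rule borel_measurable_has_bochner_integral)
  then have "(\<lambda>\<theta>. Re (complex_of_real (h \<theta>) * exp (0 * of_real \<theta>))) \<in>
      borel_measurable (restrict_space lborel {0<..})"
    by measurable
  then show ?thesis
    by (subst (asm) borel_measurable_restrict_space_iff) (auto simp: mult.commute)
qed

text \<open>Positivity of \<open>h\<close> turns the complex Bochner integral at real points into a
  nonnegative integral. Together with positivity and measurability, this identity carries all later
  information about \<open>h\<close>.\<close>

lemma mittag_leffler_density_laplace:
  assumes "mittag_leffler_density \<alpha> h" "1/2 \<le> \<alpha>"
  shows "(\<integral>\<^sup>+ \<theta>\<in>{0<..}. ennreal (h \<theta>) * ennreal (exp (x * \<theta>)) \<partial>lborel) = ennreal (ml_real \<alpha> x)"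
    and "0 \<le> ml_real \<alpha> x"
proof -
  have pos: "0 < h \<theta>" if "0 < \<theta>" for \<theta>
    using assms that unfolding mittag_leffler_density_def by blast
  have "has_bochner_integral (restrict_space lborel {0<..})
      (\<lambda>\<theta>. of_real (h \<theta>) * exp (complex_of_real x * of_real \<theta>)) (mittag_leffler \<alpha> 1 (of_real x))"
    using assms unfolding mittag_leffler_density_def by blast
  then have "has_bochner_integral (restrict_space lborel {0<..})
      (\<lambda>\<theta>. Re (of_real (h \<theta>) * exp (complex_of_real x * of_real \<theta>))) (Re (mittag_leffler \<alpha> 1 (of_real x)))"
    by (rule has_bochner_integral_Re)
  then have b: "has_bochner_integral (restrict_space lborel {0<..}) (\<lambda>\<theta>. h \<theta> * exp (x * \<theta>)) (ml_real \<alpha> x)"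
    by (simp add: mittag_leffler_of_real[OF assms(2)] Re_exp)
  have nn: "AE \<theta> in restrict_space lborel {0<..}. 0 \<le> h \<theta> * exp (x * \<theta>)"
    by (subst AE_restrict_space_iff) (auto intro!: AE_I2 mult_nonneg_nonneg less_imp_le[OF pos])
  have "(\<integral>\<^sup>+ \<theta>. ennreal (h \<theta> * exp (x * \<theta>)) \<partial>restrict_space lborel {0<..}) = ennreal (ml_real \<alpha> x)"
    using nn_integral_eq_integral[OF integrable.intros[OF b] nn]
    unfolding has_bochner_integral_integral_eq[OF b] .
  then show "(\<integral>\<^sup>+ \<theta>\<in>{0<..}. ennreal (h \<theta>) * ennreal (exp (x * \<theta>)) \<partial>lborel) = ennreal (ml_real \<alpha> x)"
    by (simp add: nn_integral_restrict_space ennreal_mult'')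
  show "0 \<le> ml_real \<alpha> x"
    using integral_nonneg_AE[OF nn] unfolding has_bochner_integral_integral_eq[OF b] .
qed

text \<open>ln Gamma is convex and vanishes at 1 and at 2, hence is nonpositive in between.\<close>

lemma Gamma_real_le_1:
  fixes x :: real
  assumes "1 \<le> x" "x \<le> 2"
  shows "Gamma x \<le> 1"
proof -
  have G2: "Gamma 2 = (1::real)" using Gamma_fact[of 1, where 'a=real] by simp
  have "(ln \<circ> Gamma) ((1 - (x - 1)) *\<^sub>R 1 + (x - 1) *\<^sub>R 2) \<le>
     (1 - (x - 1)) * (ln \<circ> Gamma) 1 + (x - 1) * (ln \<circ> Gamma) 2"
    by (rule convex_onD[OF log_convex_Gamma_real]) (use assms in auto)
  then have "ln (Gamma x) \<le> 0" by (simp add: algebra_simps G2)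
  then show ?thesis using assms by simp
qed

text \<open>
  \<open>f(t) = E\<^bsub>\<alpha>,1\<^esub>(- t\<^sup>\<alpha>)\<close> solves the Volterra equation \<open>f + I\<^sup>\<alpha> f = 1\<close>; since \<open>f\<close> is nonincreasing,
  \<open>I\<^sup>\<alpha> f(t) \<ge> f(t) t\<^sup>\<alpha> / \<Gamma>(1 + \<alpha>)\<close>. The point \<open>s = 0\<close> is excluded because \<open>0 powr 0 = 0\<close>.
\<close>

lemma ml_real_Volterra:
  assumes \<alpha>: "1/2 \<le> \<alpha>" "\<alpha> < 1" and x: "0 \<le> x"
  shows "has_bochner_integral lborel
           (\<lambda>s. indicator {0<..1} s * ((1 - s) powr (\<alpha> - 1) * ml_real \<alpha> (- (x * s powr \<alpha>))) * (x / Gamma \<alpha>))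
           (1 - ml_real \<alpha> (- x))"
proof -
  define c where "c k = (- x) ^ k / Gamma (\<alpha> * real k + 1)" for k
  define f where "f k s = indicator {0<..1} s * (s powr (\<alpha> * real k) * (1 - s) powr (\<alpha> - 1)) * (c k * (x / Gamma \<alpha>))" for k s
  have c: "norm (c k) = x ^ k / Gamma (\<alpha> * real k + 1)" for k
    using x \<alpha> Gamma_real_pos[of "\<alpha> * real k + 1"]
    by (simp add: c_def power_abs add_nonneg_pos)
  have B: "has_bochner_integral lborel (\<lambda>s. indicator {0<..1} s * (s powr (\<alpha> * real k) * (1 - s) powr (\<alpha> - 1)))
         (Beta (\<alpha> * real k + 1) \<alpha>)" for k
  proof -
    have ind: "(\<lambda>s. indicator {0<..1} s * (s powr (\<alpha> * real k) * (1 - s) powr (\<alpha> - 1))) =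
        (\<lambda>s. indicator {0..1} s * (s powr (\<alpha> * real k) * (1 - s) powr (\<alpha> - 1)))"
      by (auto simp: indicator_def fun_eq_iff)
    have 1: "set_integrable lborel {0..1} (\<lambda>s. s powr (\<alpha> * real k + 1 - 1) * (1 - s) powr (\<alpha> - 1))"
      using \<alpha> by (intro integrable_Beta) (auto intro: add_nonneg_pos)
    from set_borel_integral_eq_integral[OF this] has_integral_Beta_real[of "\<alpha> * real k + 1" \<alpha>] \<alpha>
    have "set_lebesgue_integral lborel {0..1} (\<lambda>s. s powr (\<alpha> * real k + 1 - 1) * (1 - s) powr (\<alpha> - 1)) = Beta (\<alpha> * real k + 1) \<alpha>"
      by (simp add: integral_unique add_nonneg_pos)
    with 1 show ?thesis
      unfolding set_integrable_def set_lebesgue_integral_def has_bochner_integral_iff ind by simp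
  qed
  have f: "has_bochner_integral lborel (f k) (Beta (\<alpha> * real k + 1) \<alpha> * (c k * (x / Gamma \<alpha>)))" for k
    unfolding f_def by (rule has_bochner_integral_mult_left[OF B])
  have Gpos: "0 < Gamma \<alpha>" using \<alpha> by simp
  \<comment> \<open>The Gamma quotient in the Beta integral raises the index of the coefficient by
    one: the Volterra operator shifts the series, up to sign.\<close>
  have val: "Beta (\<alpha> * real k + 1) \<alpha> * (c k * (x / Gamma \<alpha>)) = - c (Suc k)" for k
  proof -
    have "Gamma (\<alpha> * real k + 1) \<noteq> 0" "Gamma (\<alpha> * real k + 1 + \<alpha>) \<noteq> 0"
      using \<alpha> by (auto intro!: less_imp_neq[THEN not_sym] Gamma_real_pos add_nonneg_pos)
    moreover have "\<alpha> * real (Suc k) + 1 = \<alpha> * real k + 1 + \<alpha>" by (simp add: algebra_simps)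
    ultimately show ?thesis using Gpos unfolding Beta_def c_def \<open>\<alpha> * real (Suc k) + 1 = _\<close> by simp
  qed
  have nB: "has_bochner_integral lborel (\<lambda>s. norm (f k s)) (norm (c (Suc k)))" for k
  proof -
    have "(\<lambda>s. norm (f k s)) = (\<lambda>s. indicator {0<..1} s * (s powr (\<alpha> * real k) * (1 - s) powr (\<alpha> - 1)) * norm (c k * (x / Gamma \<alpha>)))"
      by (auto simp: f_def abs_mult indicator_def)
    moreover have "Beta (\<alpha> * real k + 1) \<alpha> * norm (c k * (x / Gamma \<alpha>)) = norm (c (Suc k))"
    proof -
      have "0 < Beta (\<alpha> * real k + 1) \<alpha>"
        using \<alpha> by (auto simp: Beta_def intro!: divide_pos_pos mult_pos_pos Gamma_real_pos add_nonneg_pos)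
      then show ?thesis using arg_cong[OF val[of k], of norm] by (simp add: abs_mult)
    qed
    moreover have "has_bochner_integral lborel
        (\<lambda>s. indicator {0<..1} s * (s powr (\<alpha> * real k) * (1 - s) powr (\<alpha> - 1)) * norm (c k * (x / Gamma \<alpha>)))
        (Beta (\<alpha> * real k + 1) \<alpha> * norm (c k * (x / Gamma \<alpha>)))"
      by (rule has_bochner_integral_mult_left[OF B])
    ultimately show ?thesis by (simp only:)
  qed
  have sumc: "summable (\<lambda>k. norm (c k))"
    unfolding c_def by (rule summable_ml_real[OF \<alpha>(1)])
  have pt: "(\<lambda>k. f k s) sums (indicator {0<..1} s * ((1 - s) powr (\<alpha> - 1) * ml_real \<alpha> (- (x * s powr \<alpha>))) * (x / Gamma \<alpha>))"
    and ps: "summable (\<lambda>k. norm (f k s))" for s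
  proof -
    define D where "D = indicator {0<..1} s * (1 - s) powr (\<alpha> - 1) * (x / Gamma \<alpha>)"
    have e: "f k s = D * ((- (x * s powr \<alpha>)) ^ k / Gamma (\<alpha> * real k + 1))" for k
    proof (cases "s \<in> {0<..1}")
      case True
      then have "s powr (\<alpha> * real k) = (s powr \<alpha>) ^ k"
        by (simp add: powr_powr[symmetric] powr_realpow)
      moreover have "(- (x * s powr \<alpha>)) ^ k = (- x) ^ k * (s powr \<alpha>) ^ k"
        by (subst power_mult_distrib[symmetric]) simp
      ultimately show ?thesis by (simp add: f_def D_def c_def mult_ac)
    qed (auto simp: f_def D_def)
    have "summable (\<lambda>k. norm ((- (x * s powr \<alpha>)) ^ k / Gamma (\<alpha> * real k + 1)))"
      by (rule summable_ml_real[OF \<alpha>(1)])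
    note * = this summable_norm_cancel[OF this]
    show "summable (\<lambda>k. norm (f k s))"
      unfolding e norm_mult by (intro summable_mult *)
    have "(\<lambda>k. f k s) sums (D * ml_real \<alpha> (- (x * s powr \<alpha>)))"
      unfolding e ml_real_def by (intro sums_mult summable_sums *)
    then show "(\<lambda>k. f k s) sums (indicator {0<..1} s * ((1 - s) powr (\<alpha> - 1) * ml_real \<alpha> (- (x * s powr \<alpha>))) * (x / Gamma \<alpha>))"
      by (simp add: D_def mult_ac)
  qed
  have F: "integrable lborel (f k)" "integral\<^sup>L lborel (f k) = - c (Suc k)"
     "integral\<^sup>L lborel (\<lambda>s. norm (f k s)) = norm (c (Suc k))" for k
    using f[of k] nB[of k] val[of k] unfolding has_bochner_integral_iff by auto
  \<comment> \<open>The L^1 norms of the terms are the absolute coefficients shifted by one, so sum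
    and integral may be exchanged.\<close>
  have S: "summable (\<lambda>k. \<integral>s. norm (f k s) \<partial>lborel)"
    unfolding F using sumc by (subst summable_Suc_iff)
  have "has_bochner_integral lborel (\<lambda>s. \<Sum>k. f k s) (\<Sum>k. - c (Suc k))"
    using integrable_suminf[OF F(1) AE_I2[OF ps] S] integral_suminf[OF F(1) AE_I2[OF ps] S] F(2)
    unfolding has_bochner_integral_iff by simp
  moreover have "(\<Sum>k. - c (Suc k)) = 1 - ml_real \<alpha> (- x)"
  proof -
    have "ml_real \<alpha> (- x) = c 0 + (\<Sum>k. c (Suc k))"
      unfolding ml_real_def c_def[symmetric]
      using suminf_split_head[OF summable_norm_cancel[OF sumc]] by simp
    moreover have "c 0 = 1" by (simp add: c_def)
    moreover have "(\<Sum>k. - c (Suc k)) = - (\<Sum>k. c (Suc k))"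
      using summable_norm_cancel[OF sumc] by (intro suminf_minus) (subst summable_Suc_iff)
    ultimately show ?thesis by simp
  qed
  moreover have "(\<lambda>s. \<Sum>k. f k s) = (\<lambda>s. indicator {0<..1} s *
      ((1 - s) powr (\<alpha> - 1) * ml_real \<alpha> (- (x * s powr \<alpha>))) * (x / Gamma \<alpha>))"
    by (intro ext) (rule sums_unique[OF pt, symmetric])
  ultimately show ?thesis by (simp only:)
qed

text \<open>The series alternates for negative arguments and hides the monotonicity; the Laplace
  integral shows it, since \<theta> > 0.\<close>

lemma ml_real_mono:
  assumes "mittag_leffler_density \<alpha> h" "1/2 \<le> \<alpha>" "x \<le> y"
  shows "ml_real \<alpha> x \<le> ml_real \<alpha> y"
proof -
  have "ennreal (ml_real \<alpha> x) \<le> ennreal (ml_real \<alpha> y)"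
    unfolding mittag_leffler_density_laplace(1)[OF assms(1,2), symmetric]
  proof (intro nn_integral_mono)
    fix \<theta> :: real
    show "ennreal (h \<theta>) * ennreal (exp (x * \<theta>)) * indicator {0<..} \<theta>
        \<le> ennreal (h \<theta>) * ennreal (exp (y * \<theta>)) * indicator {0<..} \<theta>"
      using assms(3) by (cases "0 < \<theta>") (auto intro!: mult_left_mono ennreal_leI mult_right_mono)
  qed
  then show ?thesis
    using mittag_leffler_density_laplace(2)[OF assms(1,2)] by simp
qed

text \<open>The rate 1/x is what makes moments of every order above -1 summable over dyadic
  scales.\<close>

lemma ml_real_decay:
  assumes h: "mittag_leffler_density \<alpha> h" and \<alpha>: "1/2 \<le> \<alpha>" "\<alpha> < 1" and x: "0 \<le> x"
  shows "x * ml_real \<alpha> (- x) \<le> 1"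
proof -
  let ?g = "ml_real \<alpha> (- x)"
  note g0 = mittag_leffler_density_laplace(2)[OF h \<alpha>(1)]
  have Gpos: "0 < Gamma \<alpha>" by (rule Gamma_real_pos) (use \<alpha> in linarith)
  have 1: "has_bochner_integral lborel (\<lambda>s. indicator {0..1} s * (s powr (1 - 1) * (1 - s) powr (\<alpha> - 1)) * (?g * (x / Gamma \<alpha>)))
         (Beta 1 \<alpha> * (?g * (x / Gamma \<alpha>)))"
  proof (rule has_bochner_integral_mult_left)
    have 1: "set_integrable lborel {0..1} (\<lambda>s. s powr (1 - 1) * (1 - s) powr (\<alpha> - 1))"
      using \<alpha> by (intro integrable_Beta) auto
    from set_borel_integral_eq_integral[OF this] has_integral_Beta_real[of 1 \<alpha>] \<alpha>
    have "set_lebesgue_integral lborel {0..1} (\<lambda>s. s powr (1 - 1) * (1 - s) powr (\<alpha> - 1)) = Beta 1 \<alpha>"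
      by (simp add: integral_unique)
    with 1 show "has_bochner_integral lborel (\<lambda>s. indicator {0..1} s * (s powr (1 - 1) * (1 - s) powr (\<alpha> - 1))) (Beta 1 \<alpha>)"
      unfolding set_integrable_def set_lebesgue_integral_def has_bochner_integral_iff by simp
  qed
  note 2 = ml_real_Volterra[OF \<alpha> x]
  let ?L = "\<lambda>s. indicator {0..1} s * (s powr (1 - 1) * (1 - s) powr (\<alpha> - 1)) * (?g * (x / Gamma \<alpha>))"
  let ?R = "\<lambda>s. indicator {0<..1} s * ((1 - s) powr (\<alpha> - 1) * ml_real \<alpha> (- (x * s powr \<alpha>))) * (x / Gamma \<alpha>)"
  have "Beta 1 \<alpha> * (?g * (x / Gamma \<alpha>)) \<le> 1 - ?g"
  proof -
    have "integral\<^sup>L lborel ?L \<le> integral\<^sup>L lborel ?R"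
    proof (rule integral_mono)
      show "integrable lborel ?L" "integrable lborel ?R"
        by (rule integrable.intros[OF 1], rule integrable.intros[OF 2])
      fix s :: real
      show "indicator {0..1} s * (s powr (1 - 1) * (1 - s) powr (\<alpha> - 1)) * (?g * (x / Gamma \<alpha>))
        \<le> indicator {0<..1} s * ((1 - s) powr (\<alpha> - 1) * ml_real \<alpha> (- (x * s powr \<alpha>))) * (x / Gamma \<alpha>)"
      proof (cases "s \<in> {0<..1}")
        case True
        then have "s powr \<alpha> \<le> 1 powr \<alpha>" using \<alpha> by (intro powr_mono2) auto
        then have "x * s powr \<alpha> \<le> x" using x mult_left_mono[of "s powr \<alpha>" 1 x] by simp
        then have "?g \<le> ml_real \<alpha> (- (x * s powr \<alpha>))"
          by (intro ml_real_mono[OF h \<alpha>(1)]) simp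
        moreover have "s powr 0 \<le> 1" by (simp add: powr_def)
        ultimately have "(s powr 0 * (1 - s) powr (\<alpha> - 1)) * ?g \<le> (1 * (1 - s) powr (\<alpha> - 1)) * ml_real \<alpha> (- (x * s powr \<alpha>))"
          using g0 by (intro mult_mono) auto
        from mult_right_mono[OF this, of "x / Gamma \<alpha>"] True show ?thesis
          using x Gpos by (simp add: mult_ac)
      next
        case False
        then have "s = 0 \<or> s \<notin> {0..1}" "s \<notin> {0<..1}" by auto
        then show ?thesis by (elim disjE) simp_all
      qed
    qed
    then show ?thesis
      unfolding has_bochner_integral_integral_eq[OF 1] has_bochner_integral_integral_eq[OF 2] .
  qed
  moreover have "Beta 1 \<alpha> = Gamma \<alpha> / Gamma (1 + \<alpha>)" by (simp add: Beta_def)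
  ultimately have "?g * x / Gamma (1 + \<alpha>) \<le> 1" using Gpos g0[of "-x"] by simp
  \<comment> \<open>The inequality so far reads x E(-x) \<le> Gamma(1 + \<alpha>); the bound Gamma
    \<le> 1 on [1, 2] removes the dependence on \<alpha>.\<close>
  moreover have "0 < Gamma (1 + \<alpha>)" "Gamma (1 + \<alpha>) \<le> 1"
    using \<alpha> by (auto intro!: Gamma_real_le_1)
  ultimately show ?thesis by (simp add: field_simps)
qed

section \<open>Moments and concentration of the density, uniformly in the order\<close>

text \<open>The negative power is dominated by exponentials, whose integrals against
  \<open>h\<close> are values of E_{\<alpha>,1}. If 2^k \<le> 1/\<theta> < 2^(k+1), then exp(- 2^k
  \<theta>) \<ge> 1/e, so the k-th summand alone suffices; the summand 1 takes care of \<theta>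
  \<ge> 1.\<close>

lemma powr_minus_le_exp_series:
  fixes \<delta> \<theta> :: real
  assumes \<delta>: "0 < \<delta>" "\<delta> < 1" and \<theta>: "0 < \<theta>"
  shows "ennreal (\<theta> powr - \<delta>) \<le> 1 + (\<Sum>k. ennreal (exp 1 * 2 powr \<delta> * (2 powr \<delta>) ^ k) * ennreal (exp (- (2 ^ k) * \<theta>)))"
proof (cases "1 \<le> \<theta>")
  case True
  then have "\<theta> powr - \<delta> \<le> 1 powr - \<delta>" using \<delta> by (intro powr_mono2') auto
  then show ?thesis by (simp add: ennreal_le_1 le_supI1 add_increasing2 )
next
  case False
  define x where "x = 1 / \<theta>"
  have x: "1 \<le> x" using False \<theta> by (simp add: x_def)
  obtain k where k: "2 ^ k \<le> x" "x < 2 ^ Suc k"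
  proof -
    obtain n where n: "x < 2 ^ n" using real_arch_pow[of 2 x] by auto
    define m where "m = (LEAST n. x < 2 ^ n)"
    have m: "x < 2 ^ m" unfolding m_def by (rule LeastI[of _ n]) (rule n)
    then obtain k where "m = Suc k" using x by (cases m) auto
    moreover have "\<not> x < 2 ^ k" using not_less_Least[of k "\<lambda>n. x < 2 ^ n"] \<open>m = Suc k\<close> unfolding m_def by simp
    ultimately show ?thesis using m that[of k] by auto
  qed
  have "\<theta> powr - \<delta> = x powr \<delta>" using \<theta> by (simp add: x_def powr_divide powr_minus_divide)
  also have "\<dots> \<le> (2 ^ Suc k) powr \<delta>" using k x \<delta> by (intro powr_mono2) auto
  also have "\<dots> = 2 powr \<delta> * (2 powr \<delta>) ^ k"
    by (simp add: powr_mult powr_realpow[symmetric] powr_powr mult.commute)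
  also have "\<dots> \<le> exp 1 * 2 powr \<delta> * (2 powr \<delta>) ^ k * exp (- (2 ^ k) * \<theta>)"
  proof -
    have "2 ^ k * \<theta> \<le> 1" using k(1) \<theta> by (simp add: x_def field_simps)
    then have "1 \<le> exp 1 * exp (- (2 ^ k) * \<theta>)" by (simp flip: exp_add)
    from mult_left_mono[OF this, of "2 powr \<delta> * (2 powr \<delta>) ^ k"] show ?thesis by (simp add: mult_ac)
  qed
  finally have "ennreal (\<theta> powr - \<delta>) \<le> ennreal (exp 1 * 2 powr \<delta> * (2 powr \<delta>) ^ k * exp (- (2 ^ k) * \<theta>))"
    by (rule ennreal_leI)
  also have "\<dots> = ennreal (exp 1 * 2 powr \<delta> * (2 powr \<delta>) ^ k) * ennreal (exp (- (2 ^ k) * \<theta>))"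
    by (simp add: ennreal_mult'')
  also have "\<dots> \<le> (\<Sum>k. ennreal (exp 1 * 2 powr \<delta> * (2 powr \<delta>) ^ k) * ennreal (exp (- (2 ^ k) * \<theta>)))"
  proof -
    have "sum f {k} \<le> suminf f" for f :: "nat \<Rightarrow> ennreal" by (rule sum_le_suminf) auto
    then show ?thesis by (metis (mono_tags, lifting) sum.empty sum.insert empty_iff finite.emptyI add_0_right)
  qed
  also have "\<dots> \<le> 1 + \<dots>" by (simp add: add_increasing)
  finally show ?thesis .
qed

text \<open>Integrating the dyadic majorant gives terms 2^(\<delta> k) E(- 2^k), and the decay 1/x
  turns them into 2^((\<delta> - 1) k), which is summable because \<delta> < 1. The bound
  \<open>K\<close> depends on \<delta> alone and is fixed before \<alpha> and
  \<open>h\<close>.\<close>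

lemma mittag_leffler_density_negative_moment:
  fixes \<delta> :: real
  assumes \<delta>: "0 < \<delta>" "\<delta> < 1"
  obtains K where "0 < K"
    "\<And>\<alpha> h. mittag_leffler_density \<alpha> h \<Longrightarrow> 1/2 \<le> \<alpha> \<Longrightarrow> \<alpha> < 1 \<Longrightarrow>
       (\<integral>\<^sup>+ \<theta>\<in>{0<..}. ennreal (h \<theta>) * ennreal (\<theta> powr - \<delta>) \<partial>lborel) \<le> ennreal K"
proof
  define b where "b k = exp 1 * 2 powr \<delta> * (2 powr (\<delta> - 1)) ^ k" for k :: nat
  have q: "norm (2 powr (\<delta> - 1)) < 1" using \<delta> powr_less_mono[of "\<delta> - 1" 0 2] by simp
  have sb: "summable b" unfolding b_def using q by (intro summable_mult summable_geometric)
  have b0: "0 \<le> b k" for k by (simp add: b_def)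
  show "0 < 1 + suminf b" using suminf_nonneg[OF sb b0] by simp
  fix \<alpha> h assume h: "mittag_leffler_density \<alpha> h" and \<alpha>: "1/2 \<le> \<alpha>" "\<alpha> < 1"
  note hm[measurable] = mittag_leffler_density_measurable[OF h]
  let ?H = "\<lambda>\<theta>. ennreal (h \<theta>) * indicator {0<..} \<theta>"
  have H: "?H = (\<lambda>\<theta>. ennreal (indicator {0<..} \<theta> * h \<theta>))" by (auto simp: indicator_def)
  have Hm[measurable]: "?H \<in> borel_measurable lborel" unfolding H by measurable
  let ?c = "\<lambda>k::nat. exp 1 * 2 powr \<delta> * (2 powr \<delta>) ^ k"
  have "(\<integral>\<^sup>+ \<theta>\<in>{0<..}. ennreal (h \<theta>) * ennreal (\<theta> powr - \<delta>) \<partial>lborel)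
      \<le> (\<integral>\<^sup>+ \<theta>. ?H \<theta> * (1 + (\<Sum>k. ennreal (?c k) * ennreal (exp (- (2 ^ k) * \<theta>)))) \<partial>lborel)"
  proof (intro nn_integral_mono)
    fix \<theta>
    show "ennreal (h \<theta>) * ennreal (\<theta> powr - \<delta>) * indicator {0<..} \<theta> \<le>
         ?H \<theta> * (1 + (\<Sum>k. ennreal (?c k) * ennreal (exp (- (2 ^ k) * \<theta>))))"
      using powr_minus_le_exp_series[OF \<delta>, of \<theta>]
      by (cases "0 < \<theta>") (auto intro!: mult_left_mono)
  qed
  also have "\<dots> = (\<integral>\<^sup>+ \<theta>. ?H \<theta> + (\<Sum>k. ennreal (?c k) * (?H \<theta> * ennreal (exp (- (2 ^ k) * \<theta>)))) \<partial>lborel)"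
    by (simp add: distrib_left mult_ac flip: ennreal_suminf_cmult)
  also have "\<dots> = (\<integral>\<^sup>+ \<theta>. ?H \<theta> \<partial>lborel) + (\<Sum>k. ennreal (?c k) * (\<integral>\<^sup>+ \<theta>. (?H \<theta> * ennreal (exp (- (2 ^ k) * \<theta>))) \<partial>lborel))"
    by (simp add: nn_integral_add nn_integral_suminf nn_integral_cmult)
  also have "(\<integral>\<^sup>+ \<theta>. ?H \<theta> \<partial>lborel) = 1"
    using mittag_leffler_density_laplace(1)[OF h \<alpha>(1), of 0] by (simp add: ml_real_def powser_zero[of "\<lambda>k. 1 / Gamma (\<alpha> * real k + 1)", simplified])
  also have "(\<lambda>k. \<integral>\<^sup>+ \<theta>. (?H \<theta> * ennreal (exp (- (2 ^ k) * \<theta>))) \<partial>lborel) = (\<lambda>k. ennreal (ml_real \<alpha> (- (2 ^ k))))"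
    using mittag_leffler_density_laplace(1)[OF h \<alpha>(1), of "- (2 ^ _)"] by (simp add: mult_ac)
  also have "(\<Sum>k. ennreal (?c k) * ennreal (ml_real \<alpha> (- (2 ^ k)))) \<le> (\<Sum>k. ennreal (b k))"
  proof (intro suminf_le summableI)
    fix k
    have "ml_real \<alpha> (- (2 ^ k)) \<le> 1 / 2 ^ k"
      using ml_real_decay[OF h \<alpha>, of "2 ^ k"] by (simp add: field_simps)
    then have "?c k * ml_real \<alpha> (- (2 ^ k)) \<le> ?c k * (1 / 2 ^ k)" by (intro mult_left_mono) auto
    also have "\<dots> = b k" by (simp add: b_def powr_diff power_divide)
    finally show "ennreal (?c k) * ennreal (ml_real \<alpha> (- (2 ^ k))) \<le> ennreal (b k)"
      by (simp add: ennreal_mult''[symmetric] mittag_leffler_density_laplace(2)[OF h \<alpha>(1)] ennreal_leI)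
  qed
  also have "\<dots> = ennreal (suminf b)" by (rule suminf_ennreal2[OF b0 sb])
  finally show "(\<integral>\<^sup>+ \<theta>\<in>{0<..}. ennreal (h \<theta>) * ennreal (\<theta> powr - \<delta>) \<partial>lborel) \<le> ennreal (1 + suminf b)"
    by (simp add: suminf_nonneg[OF sb b0] add_left_mono)
qed

text \<open>The second moment of \<open>e\<^sup>-\<^sup>\<theta> - e\<^sup>-\<^sup>1\<close> tends to \<open>0\<close> as \<open>\<alpha> \<rightarrow> 1\<close>, so \<open>h\<^sub>\<alpha>\<close> concentrates at \<open>\<theta> = 1\<close>.\<close>

lemma mittag_leffler_density_concentration:
  "\<forall>\<^sub>F \<alpha> in at_left 1. \<forall>h. mittag_leffler_density \<alpha> h \<longrightarrow>
     ennreal (1/2) \<le> (\<integral>\<^sup>+ \<theta>\<in>{1/2..2}. ennreal (h \<theta>) \<partial>lborel)"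
proof -
  \<comment> \<open>A lower bound for (e^(-\<theta>) - e^(-1))^2 outside [1/2, 2], attained in the
    limit at one of the two endpoints.\<close>
  define c :: real where "c = (min (exp (-1/2) - exp (-1)) (exp (-1) - exp (-2)))\<^sup>2"
  have "exp (-1) < exp (-1/2 :: real)" "exp (-2) < exp (-1 :: real)" by (simp_all only: exp_less_cancel_iff)
  then have c: "0 < c" unfolding c_def by (intro zero_less_power) simp
  \<comment> \<open>The second moment of e^(-\<theta>) - e^(-1) under \<open>h\<close>, expanded and
    expressed by Laplace transforms.\<close>
  have "((\<lambda>\<alpha>. ml_real \<alpha> (-2) + exp (-2) - 2 * exp (-1) * ml_real \<alpha> (-1)) \<longlongrightarrow>
      exp (-2) + exp (-2) - 2 * exp (-1) * exp (-1)) (at_left 1)"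
    by (intro tendsto_intros ml_real_tendsto_exp)
  also have "exp (-2) + exp (-2) - 2 * exp (-1) * exp (-1) = (0::real)" by (simp flip: exp_add)
  finally have "\<forall>\<^sub>F \<alpha> in at_left 1. ml_real \<alpha> (-2) + exp (-2) - 2 * exp (-1) * ml_real \<alpha> (-1) < c / 2"
    using c by (intro order_tendstoD) auto
  moreover have "\<forall>\<^sub>F \<alpha> in at_left (1::real). 1/2 \<le> \<alpha>"
    by (rule eventually_at_leftI[of "1/2"]) auto
  ultimately show ?thesis
  proof eventually_elim
    case (elim \<alpha>)
    show ?case
    proof (intro allI impI)
      fix h assume h: "mittag_leffler_density \<alpha> h"
      note hm[measurable] = mittag_leffler_density_measurable[OF h]
      let ?H = "\<lambda>\<theta>. ennreal (h \<theta>) * indicator {0<..} \<theta>"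
      have H: "?H = (\<lambda>\<theta>. ennreal (indicator {0<..} \<theta> * h \<theta>))" by (auto simp: indicator_def)
      have Hm[measurable]: "?H \<in> borel_measurable lborel" unfolding H by measurable
      note L = mittag_leffler_density_laplace[OF h elim(2)]
      have one: "(\<integral>\<^sup>+ \<theta>. ?H \<theta> \<partial>lborel) = 1"
        using L(1)[of 0] by (simp add: ml_real_def powser_zero[of "\<lambda>k. 1 / Gamma (\<alpha> * real k + 1)", simplified])
      define J where "J = (\<integral>\<^sup>+ \<theta>. ?H \<theta> * ennreal ((exp (- \<theta>) - exp (-1))\<^sup>2) \<partial>lborel)"
      \<comment> \<open>The cross term of the square is added to \<open>J\<close> rather than
        subtracted: subtraction on \<open>ennreal\<close> truncates, and \<open>J\<close> is not yet
        known to be finite.\<close>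
      have "J + ennreal (2 * exp (-1) * ml_real \<alpha> (-1)) =
        J + ennreal (2 * exp (-1)) * (\<integral>\<^sup>+ \<theta>. ?H \<theta> * ennreal (exp (- \<theta>)) \<partial>lborel)"
        using L(1)[of "-1"] L(2)[of "-1"] by (simp add: ennreal_mult mult_ac)
      also have "\<dots> = (\<integral>\<^sup>+ \<theta>. ?H \<theta> * ennreal ((exp (- \<theta>) - exp (-1))\<^sup>2) + ennreal (2 * exp (-1)) * (?H \<theta> * ennreal (exp (- \<theta>))) \<partial>lborel)"
        unfolding J_def by (simp add: nn_integral_add nn_integral_cmult)
      also have "\<dots> = (\<integral>\<^sup>+ \<theta>. ?H \<theta> * ennreal (exp (- 2 * \<theta>)) + ennreal (exp (-2)) * ?H \<theta> \<partial>lborel)"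
      proof (intro nn_integral_cong)
        fix \<theta> :: real
        have e2: "exp (-2 :: real) = (exp (-1))\<^sup>2" "exp (-2 * \<theta>) = (exp (- \<theta>))\<^sup>2"
          by (simp_all add: power2_eq_square flip: exp_add)
        have "ennreal ((exp (- \<theta>) - exp (-1))\<^sup>2) + ennreal (2 * exp (-1)) * ennreal (exp (- \<theta>)) =
            ennreal (exp (- 2 * \<theta>)) + ennreal (exp (-2))"
          proof -
          have "(exp (- \<theta>) - exp (-1))\<^sup>2 + 2 * exp (-1) * exp (- \<theta>) = (exp (- \<theta>))\<^sup>2 + (exp (-1))\<^sup>2"
            by (simp add: power2_eq_square algebra_simps)
          then show ?thesis
            unfolding e2 by (simp only: ennreal_mult[symmetric] ennreal_plus[symmetric]
                zero_le_power2 exp_ge_zero mult_nonneg_nonneg zero_le_numeral)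
        qed
        then have "?H \<theta> * (ennreal ((exp (- \<theta>) - exp (-1))\<^sup>2) + ennreal (2 * exp (-1)) * ennreal (exp (- \<theta>))) =
            ?H \<theta> * (ennreal (exp (- 2 * \<theta>)) + ennreal (exp (-2)))" by simp
        then show "?H \<theta> * ennreal ((exp (- \<theta>) - exp (-1))\<^sup>2) + ennreal (2 * exp (-1)) * (?H \<theta> * ennreal (exp (- \<theta>)))
            = ?H \<theta> * ennreal (exp (- 2 * \<theta>)) + ennreal (exp (-2)) * ?H \<theta>"
          by (simp only: distrib_left mult_ac)
      qed
      also have "\<dots> = (\<integral>\<^sup>+ \<theta>. ?H \<theta> * ennreal (exp (- 2 * \<theta>)) \<partial>lborel) + ennreal (exp (-2))"
        by (simp add: nn_integral_add nn_integral_cmult one)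
      also have "(\<integral>\<^sup>+ \<theta>. ?H \<theta> * ennreal (exp (- 2 * \<theta>)) \<partial>lborel) = ennreal (ml_real \<alpha> (-2))"
        using L(1)[of "-2"] by (simp add: mult_ac)
      finally have J: "J + ennreal (2 * exp (-1) * ml_real \<alpha> (-1)) = ennreal (ml_real \<alpha> (-2) + exp (-2))"
        using L(2) by simp
      then have "J \<noteq> top" by (metis ennreal_neq_top ennreal_add_eq_top)
      then obtain j where j: "J = ennreal j" "0 \<le> j" by (cases J) auto
      have "j < c / 2"
        using J elim(1) L(2)[of "-1"] L(2)[of "-2"] by (simp add: j flip: ennreal_plus)
      define Q where "Q = (\<integral>\<^sup>+ \<theta>. ?H \<theta> * indicator (- {1/2..2}) \<theta> \<partial>lborel)"
      \<comment> \<open>Chebyshev's inequality: \<open>c\<close> times the mass outside [1/2, 2] is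
        at most the second moment \<open>J\<close>.\<close>
      have "ennreal c * Q = (\<integral>\<^sup>+ \<theta>. ennreal c * (?H \<theta> * indicator (- {1/2..2}) \<theta>) \<partial>lborel)"
        unfolding Q_def by (simp add: nn_integral_cmult)
      also have "\<dots> \<le> J" unfolding J_def
      proof (intro nn_integral_mono)
        fix \<theta> :: real
        have "c \<le> (exp (- \<theta>) - exp (-1))\<^sup>2" if "\<theta> \<notin> {1/2..2}"
        proof -
          have "min (exp (-1/2) - exp (-1)) (exp (-1) - exp (-2)) \<le> \<bar>exp (- \<theta>) - exp (-1)\<bar>"
          proof (cases "\<theta> < 1/2")
            case True
            then have "exp (-1/2) \<le> exp (- \<theta>)" by simp
            then show ?thesis by linarith
          next
            case False
            then have "exp (- \<theta>) \<le> exp (-2)" using that by simp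
            then show ?thesis by linarith
          qed
          moreover have "0 \<le> min (exp (-1/2) - exp (-1)) (exp (-1) - exp (-2) :: real)"
            by simp
          ultimately show ?thesis
            unfolding c_def using power_mono[of _ "\<bar>exp (- \<theta>) - exp (-1)\<bar>" 2] by simp
        qed
        then show "ennreal c * (?H \<theta> * indicator (- {1/2..2}) \<theta>) \<le> ?H \<theta> * ennreal ((exp (- \<theta>) - exp (-1))\<^sup>2)"
          by (auto simp: indicator_def mult.commute[of "ennreal c"] intro!: mult_left_mono ennreal_leI)
      qed
      also have "\<dots> \<le> ennreal (c / 2)" using \<open>j < c / 2\<close> j by (simp add: ennreal_leI)
      also have "\<dots> = ennreal c * ennreal (1/2)" using c by (subst ennreal_mult[symmetric]) auto
      finally have "Q \<le> ennreal (1/2)" using c by (simp add: ennreal_mult_le_mult_iff)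
      moreover have "(\<integral>\<^sup>+ \<theta>\<in>{1/2..2}. ennreal (h \<theta>) \<partial>lborel) + Q = 1"
      proof -
        have "(\<integral>\<^sup>+ \<theta>\<in>{1/2..2}. ennreal (h \<theta>) \<partial>lborel) = (\<integral>\<^sup>+ \<theta>. ?H \<theta> * indicator {1/2..2} \<theta> \<partial>lborel)"
          by (intro nn_integral_cong) (auto simp: indicator_def)
        then have "(\<integral>\<^sup>+ \<theta>\<in>{1/2..2}. ennreal (h \<theta>) \<partial>lborel) + Q =
            (\<integral>\<^sup>+ \<theta>. ?H \<theta> * indicator {1/2..2} \<theta> + ?H \<theta> * indicator (- {1/2..2}) \<theta> \<partial>lborel)"
          unfolding Q_def by (simp add: nn_integral_add)
        also have "\<dots> = (\<integral>\<^sup>+ \<theta>. ?H \<theta> \<partial>lborel)"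
          by (intro nn_integral_cong) (auto simp: indicator_def)
        finally show ?thesis using one by simp
      qed
      ultimately have le: "1 \<le> (\<integral>\<^sup>+ \<theta>\<in>{1/2..2}. ennreal (h \<theta>) \<partial>lborel) + ennreal (1/2)"
        by (metis add_left_mono)
      show "ennreal (1/2) \<le> (\<integral>\<^sup>+ \<theta>\<in>{1/2..2}. ennreal (h \<theta>) \<partial>lborel)"
      proof (cases "\<integral>\<^sup>+ \<theta>\<in>{1/2..2}. ennreal (h \<theta>) \<partial>lborel")
        case (real r)
        have "ennreal r + ennreal (1/2) = ennreal (r + 1/2)"
          using real by (intro ennreal_plus[symmetric]) auto
        then have "ennreal 1 \<le> ennreal (r + 1/2)"
          using le real by (simp only: ennreal_1)
        then have "1/2 \<le> r" using real by (subst (asm) ennreal_le_iff) auto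
        then show ?thesis unfolding real by (rule ennreal_leI)
      qed simp
    qed
  qed
qed

text \<open>\<theta>^(1-\<delta>) \<le> 1 + \<theta> \<le> e^\<theta>, so the moment is at most
  E_{\<alpha>,1}(1). The extra factor \<theta> of S_\<alpha> cancels the singularity at 0, and only
  the tail has to be controlled.\<close>

lemma mittag_leffler_density_first_moment:
  assumes h: "mittag_leffler_density \<alpha> h" and \<alpha>: "1/2 \<le> \<alpha>" "ml_real \<alpha> 1 \<le> 4"
    and \<delta>: "0 < \<delta>" "\<delta> < 1"
  shows "(\<integral>\<^sup>+ \<theta>\<in>{0<..}. ennreal (\<theta> * h \<theta>) * ennreal (\<theta> powr - \<delta>) \<partial>lborel) \<le> ennreal 4"
proof -
  have "(\<integral>\<^sup>+ \<theta>\<in>{0<..}. ennreal (\<theta> * h \<theta>) * ennreal (\<theta> powr - \<delta>) \<partial>lborel) \<le>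
     (\<integral>\<^sup>+ \<theta>\<in>{0<..}. ennreal (h \<theta>) * ennreal (exp (1 * \<theta>)) \<partial>lborel)"
  proof (intro nn_integral_mono)
    fix \<theta> :: real
    show "ennreal (\<theta> * h \<theta>) * ennreal (\<theta> powr - \<delta>) * indicator {0<..} \<theta>
       \<le> ennreal (h \<theta>) * ennreal (exp (1 * \<theta>)) * indicator {0<..} \<theta>"
    proof (cases "0 < \<theta>")
      case True
      then have hp: "0 < h \<theta>" using h unfolding mittag_leffler_density_def by blast
      have "\<theta> * \<theta> powr - \<delta> = \<theta> powr (1 - \<delta>)" using True by (simp add: powr_diff powr_minus divide_inverse)
      also have "\<dots> \<le> (1 + \<theta>) powr (1 - \<delta>)" using True \<delta> by (intro powr_mono2) auto
      also have "\<dots> \<le> (1 + \<theta>) powr 1" using True \<delta> by (intro powr_mono) auto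
      also have "\<dots> \<le> exp \<theta>" using True by (simp add: exp_ge_add_one_self)
      finally have "h \<theta> * (\<theta> * \<theta> powr - \<delta>) \<le> h \<theta> * exp \<theta>" using hp by (intro mult_left_mono) auto
      then show ?thesis using True hp by (simp add: ennreal_mult''[symmetric] mult_ac ennreal_leI)
    qed simp
  qed
  also have "\<dots> \<le> ennreal 4"
    unfolding mittag_leffler_density_laplace(1)[OF h \<alpha>(1)] using \<alpha>(2) by (rule ennreal_leI)
  finally show ?thesis .
qed

text \<open>The limit is e, and 4 is a convenient number above it.\<close>

lemma eventually_ml_real_1: "\<forall>\<^sub>F \<alpha> in at_left 1. ml_real \<alpha> 1 \<le> 4"
proof -
  have "exp (1::real) < 4" using exp_le by linarith
  then show ?thesis
    using order_tendstoD(2)[OF ml_real_tendsto_exp, of 1 4] by (auto elim: eventually_mono)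
qed

section \<open>The heat kernel\<close>

lemma heat_kernel_nonneg [simp]: "0 \<le> heat_kernel t x"
  by (simp add: heat_kernel_def)

lemma borel_measurable_heat_kernel [measurable (raw)]:
  fixes g :: "'b \<Rightarrow> 'a::euclidean_space"
  assumes [measurable]: "f \<in> borel_measurable M" "g \<in> borel_measurable M"
  shows "(\<lambda>x. heat_kernel (f x) (g x)) \<in> borel_measurable M"
  unfolding heat_kernel_def by measurable

text \<open>Each coordinate carries a centred Gaussian of variance 2t, which reduces the total mass
  to dimension one.\<close>

lemma heat_kernel_eq_prod_normal_density:
  fixes x :: "'a::euclidean_space"
  assumes "0 < t"
  shows "heat_kernel t x = (\<Prod>b\<in>Basis. normal_density 0 (sqrt (2 * t)) (x \<bullet> b))"
proof -
  have "(\<Prod>b\<in>Basis. normal_density 0 (sqrt (2 * t)) (x \<bullet> b)) =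
      (1 / sqrt (4 * pi * t)) ^ DIM('a) * exp (\<Sum>b\<in>Basis. - ((x \<bullet> b)\<^sup>2 / (4 * t)))"
    using assms by (simp add: normal_density_def prod_dividef power_divide exp_sum mult_ac)
  also have "(\<Sum>b\<in>Basis. - ((x \<bullet> b)\<^sup>2 / (4 * t))) = - ((norm x)\<^sup>2 / (4 * t))"
  proof -
    have "(norm x)\<^sup>2 = (\<Sum>b\<in>Basis. (x \<bullet> b)\<^sup>2)"
      unfolding power2_norm_eq_inner euclidean_inner[of x x] by (simp only: power2_eq_square)
    then show ?thesis by (simp add: sum_negf sum_divide_distrib[symmetric])
  qed
  also have "(1 / sqrt (4 * pi * t)) ^ DIM('a) = (4 * pi * t) powr (- (real DIM('a) / 2))"
  proof -
    have "1 / sqrt (4 * pi * t) = (4 * pi * t) powr (- (1 / 2))"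
      using assms by (simp add: powr_half_sqrt powr_minus_divide)
    then show ?thesis
      using assms by (simp add: powr_powr powr_realpow[symmetric])
  qed
  finally show ?thesis by (simp add: heat_kernel_def)
qed

lemma nn_integral_heat_kernel:
  fixes y :: "'a::euclidean_space"
  assumes t: "0 < t"
  shows "(\<integral>\<^sup>+ x. ennreal (heat_kernel t (x - y)) \<partial>lborel) = 1"
proof -
  have "(\<integral>\<^sup>+ x. ennreal (heat_kernel t (x - y)) \<partial>lborel) =
        (\<integral>\<^sup>+ x. ennreal (heat_kernel t (x - y)) \<partial>distr lborel borel (\<lambda>x. y + x))"
    by (simp add: lborel_distr_plus)
  also have "\<dots> = (\<integral>\<^sup>+ x. ennreal (heat_kernel t (x :: 'a)) \<partial>lborel)"
    by (subst nn_integral_distr) auto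
  also have "\<dots> = (\<integral>\<^sup>+ x. (\<Prod>b\<in>Basis. ennreal (normal_density 0 (sqrt (2 * t)) ((x :: 'a) \<bullet> b))) \<partial>lborel)"
    using t by (simp add: heat_kernel_eq_prod_normal_density prod_ennreal)
  also have "\<dots> = (\<Prod>b\<in>(Basis :: 'a set). (\<integral>\<^sup>+ x. ennreal (normal_density 0 (sqrt (2 * t)) x) \<partial>lborel))"
    by (rule nn_integral_lborel_prod) auto
  also have "(\<integral>\<^sup>+ x. ennreal (normal_density 0 (sqrt (2 * t)) x) \<partial>lborel) = 1"
    using t by (subst nn_integral_eq_integral) (auto intro!: integrable_normal_density integral_normal_density)
  finally show ?thesis by simp
qed

text \<open>Criticality enters here: the kernel is at most (4 pi t)^(-N/2), whose power p - 1 = 2/N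
  is exactly 1/(4 pi t). The remaining factor integrates to 1.\<close>

lemma nn_integral_heat_kernel_powr:
  fixes y :: "'a::euclidean_space"
  defines "p \<equiv> 1 + 2 / real DIM('a)"
  assumes t: "0 < t"
  shows "(\<integral>\<^sup>+ x. ennreal (heat_kernel t (x - y) powr p) \<partial>lborel) \<le> ennreal (1 / t)"
proof -
  have bound: "heat_kernel t z powr p \<le> heat_kernel t z * (1 / t)" for z :: 'a
  proof -
    have pos: "0 < heat_kernel t z" using t by (simp add: heat_kernel_def)
    have "heat_kernel t z \<le> (4 * pi * t) powr (- (real DIM('a) / 2)) * 1"
      unfolding heat_kernel_def using t by (intro mult_left_mono) auto
    then have "heat_kernel t z powr (2 / real DIM('a)) \<le> ((4 * pi * t) powr (- (real DIM('a) / 2))) powr (2 / real DIM('a))"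
      by (intro powr_mono2) auto
    also have "\<dots> = 1 / (4 * pi * t)"
    proof -
      have "((4 * pi * t) powr (- (real DIM('a) / 2))) powr (2 / real DIM('a)) = (4 * pi * t) powr - 1"
        unfolding powr_powr by simp
      then show ?thesis using t by (simp only: powr_minus_divide) simp
    qed
    also have "\<dots> \<le> 1 / t"
    proof -
      have "1 * t \<le> (4 * pi) * t" using t pi_gt3 by (intro mult_right_mono) auto
      then show ?thesis using t by (intro divide_left_mono) auto
    qed
    finally have "heat_kernel t z * heat_kernel t z powr (2 / real DIM('a)) \<le> heat_kernel t z * (1 / t)"
      using pos by (intro mult_left_mono) auto
    then show ?thesis using pos by (simp add: p_def powr_add)
  qed
  have "(\<integral>\<^sup>+ x. ennreal (heat_kernel t (x - y) powr p) \<partial>lborel) \<le>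
      (\<integral>\<^sup>+ x. ennreal (heat_kernel t (x - y)) * ennreal (1 / t) \<partial>lborel)"
  proof (intro nn_integral_mono)
    fix x
    have "ennreal (heat_kernel t (x - y) powr p) \<le> ennreal (heat_kernel t (x - y) * (1 / t))"
      by (intro ennreal_leI bound)
    also have "\<dots> = ennreal (heat_kernel t (x - y)) * ennreal (1 / t)"
      using t by (intro ennreal_mult'') simp
    finally show "ennreal (heat_kernel t (x - y) powr p) \<le> ennreal (heat_kernel t (x - y)) * ennreal (1 / t)" .
  qed
  also have "\<dots> = ennreal (1 / t)"
    by (simp add: nn_integral_multc nn_integral_heat_kernel t)
  finally show ?thesis .
qed

section \<open>Powers of extended nonnegative reals and the Minkowski inequality\<close>

text \<open>The iterates and their supremum may be infinite, and \<open>enn2real\<close> sends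
  \<open>top\<close> to 0; the value \<open>top\<close> is therefore kept separately so that the
  power stays monotone.\<close>

definition epowr :: "ennreal \<Rightarrow> real \<Rightarrow> ennreal" where
  "epowr x p = (if x = top then top else ennreal (enn2real x powr p))"

lemma epowr_ennreal [simp]: "0 \<le> r \<Longrightarrow> epowr (ennreal r) p = ennreal (r powr p)"
  by (simp add: epowr_def)

lemma epowr_top [simp]: "epowr top p = top"
  by (simp add: epowr_def)

lemma epowr_0 [simp]: "epowr 0 p = 0"
  by (simp add: epowr_def)

lemma epowr_eq_top_iff [simp]: "epowr x p = top \<longleftrightarrow> x = top"
  by (simp add: epowr_def)

lemma borel_measurable_epowr [measurable (raw)]:
  assumes [measurable]: "f \<in> borel_measurable M"
  shows "(\<lambda>x. epowr (f x) p) \<in> borel_measurable M"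
  unfolding epowr_def by measurable

lemma epowr_mono: "0 \<le> p \<Longrightarrow> x \<le> y \<Longrightarrow> epowr x p \<le> epowr y p"
  by (cases x; cases y) (auto simp: top_unique intro!: ennreal_leI powr_mono2)

lemma epowr_epowr_inverse: "0 < p \<Longrightarrow> epowr (epowr x p) (1 / p) = x"
  by (cases x) (auto simp: powr_powr)

lemma epowr_epowr_inverse': "0 < p \<Longrightarrow> epowr (epowr x (1 / p)) p = x"
  by (cases x) (auto simp: powr_powr)

lemma epowr_mult_ennreal:
  assumes "0 < c"
  shows "epowr (x * ennreal c) p = epowr x p * ennreal (c powr p)"
  using assms by (cases x) (auto simp: powr_mult ennreal_mult''[symmetric] ennreal_top_mult simp del: ennreal_mult'')

text \<open>For p > 0 the power is an order isomorphism of [0, \<infinity>] with inverse the power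
  1/p, so it commutes with arbitrary suprema.\<close>

lemma epowr_SUP:
  assumes p: "0 < p"
  shows "epowr (SUP i\<in>I. f i) p = (SUP i\<in>I. epowr (f i) p)"
proof (rule antisym)
  have "f i \<le> epowr (SUP i\<in>I. epowr (f i) p) (1 / p)" if "i \<in> I" for i
  proof -
    have "f i = epowr (epowr (f i) p) (1 / p)" using p by (simp add: epowr_epowr_inverse)
    also have "\<dots> \<le> epowr (SUP i\<in>I. epowr (f i) p) (1 / p)"
      using p that by (intro epowr_mono SUP_upper) auto
    finally show ?thesis .
  qed
  then have "epowr (SUP i\<in>I. f i) p \<le> epowr (epowr (SUP i\<in>I. epowr (f i) p) (1 / p)) p"
    using p by (intro epowr_mono SUP_least) auto
  then show "epowr (SUP i\<in>I. f i) p \<le> (SUP i\<in>I. epowr (f i) p)"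
    using p by (simp only: epowr_epowr_inverse')
  show "(SUP i\<in>I. epowr (f i) p) \<le> epowr (SUP i\<in>I. f i) p"
    using p by (intro SUP_least epowr_mono SUP_upper) auto
qed

text \<open>A crude substitute for the triangle inequality in L^p, from x + y \<le> 2 max(x, y); the
  smallness conditions of the existence proof absorb the factor 2^p.\<close>

lemma epowr_add_le:
  assumes p: "0 < p"
  shows "epowr (x + y) p \<le> ennreal (2 powr p) * (epowr x p + epowr y p)"
proof -
  have "x + y \<le> max x y * ennreal 2"
    by (metis add_mono ennreal_numeral max.cobounded1 max.cobounded2 mult_2_right zero_le_numeral)
  then have "epowr (x + y) p \<le> epowr (max x y * ennreal 2) p"
    using p by (intro epowr_mono) auto
  also have "\<dots> = epowr (max x y) p * ennreal (2 powr p)"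
    by (rule epowr_mult_ennreal) simp
  also have "epowr (max x y) p \<le> epowr x p + epowr y p"
    by (simp add: max_def add_increasing add_increasing2)
  finally show ?thesis by (simp add: mult.commute mult_right_mono)
qed

text \<open>The tangent to r^p at r = l lies below the graph; the constant term is moved to the
  right so that no subtraction occurs.\<close>

lemma epowr_Young:
  assumes p: "1 < p" and l: "0 < l"
  shows "ennreal (p * l powr (p - 1)) * x \<le> epowr x p + ennreal ((p - 1) * l powr p)"
proof (cases x)
  case (real r)
  define q where "q = p / (p - 1)"
  have q: "1 < q" "1 / p + 1 / q = 1" using p by (auto simp: q_def field_simps)
  have "r * l powr (p - 1) \<le> r powr p / p + (l powr (p - 1)) powr q / q"
    using p q real by (intro Youngs_inequality) auto
  also have "(l powr (p - 1)) powr q = l powr p" using p by (simp add: powr_powr q_def)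
  finally have "p * (r * l powr (p - 1)) \<le> p * (r powr p / p + l powr p / q)"
    using p by (intro mult_left_mono) auto
  also have "\<dots> = r powr p + (p - 1) * l powr p"
    using p by (simp add: q_def field_simps)
  finally show ?thesis
    using real p by (simp add: ennreal_mult''[symmetric] ennreal_leI mult_ac del: ennreal_mult'' flip: ennreal_plus)
qed simp

text \<open>The tangent inequality is integrated against \<open>w\<close> and applied with the mean
  itself as point of tangency. A total weight below 1 is harmless since the constant term stands on
  the larger side.\<close>

lemma nn_integral_Jensen_epowr:
  assumes p: "1 < p" and [measurable]: "g \<in> borel_measurable M" "w \<in> borel_measurable M"
    and w: "(\<integral>\<^sup>+ x. w x \<partial>M) \<le> 1"
  shows "epowr (\<integral>\<^sup>+ x. g x * w x \<partial>M) p \<le> (\<integral>\<^sup>+ x. epowr (g x) p * w x \<partial>M)" (is "epowr ?I p \<le> ?R")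
proof (cases ?R)
  case (real r)
  have Y: "ennreal (p * l powr (p - 1)) * ?I \<le> ?R + ennreal ((p - 1) * l powr p)" if l: "0 < l" for l
  proof -
    have "ennreal (p * l powr (p - 1)) * ?I = (\<integral>\<^sup>+ x. (ennreal (p * l powr (p - 1)) * g x) * w x \<partial>M)"
      by (simp add: nn_integral_cmult mult.assoc)
    also have "\<dots> \<le> (\<integral>\<^sup>+ x. (epowr (g x) p + ennreal ((p - 1) * l powr p)) * w x \<partial>M)"
      by (intro nn_integral_mono mult_right_mono epowr_Young p l) auto
    also have "\<dots> = ?R + ennreal ((p - 1) * l powr p) * (\<integral>\<^sup>+ x. w x \<partial>M)"
      by (simp add: distrib_right nn_integral_add nn_integral_cmult)
    also have "\<dots> \<le> ?R + ennreal ((p - 1) * l powr p) * 1"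
      by (intro add_left_mono mult_left_mono w) auto
    finally show ?thesis by simp
  qed
  \<comment> \<open>The mean must be finite before it can serve as point of tangency; l = 1 already
    shows this.\<close>
  have "?I \<noteq> top"
  proof
    assume "?I = top"
    with Y[of 1] p real show False by (simp add: ennreal_mult_top top_unique flip: ennreal_plus)
  qed
  then obtain i where i: "?I = ennreal i" "0 \<le> i" by (cases ?I) auto
  show ?thesis
  proof (cases "i = 0")
    case False
    then have "0 < i" using i by simp
    have "i powr (p - 1) * i = i powr p" using \<open>0 < i\<close> by (simp add: powr_diff)
    then have "ennreal (p * i powr p) \<le> ennreal (r + (p - 1) * i powr p)"
      using Y[OF \<open>0 < i\<close>] p i real by (simp add: ennreal_mult''[symmetric] mult.assoc del: ennreal_mult'' flip: ennreal_plus)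
    then have "p * i powr p \<le> r + (p - 1) * i powr p"
      using p real by (subst (asm) ennreal_le_iff) auto
    then have "i powr p \<le> r" by (simp add: algebra_simps)
    then show ?thesis using i real by (simp add: ennreal_leI)
  qed (simp add: i)
qed simp

text \<open>Jensen's inequality for the probability density \<open>k / A\<close>, applied to \<open>f / k\<close>.\<close>

lemma nn_integral_Minkowski_epowr:
  fixes k :: "'a \<Rightarrow> real"
  assumes p: "1 < p" and A: "0 < A" and "sigma_finite_measure M1" "sigma_finite_measure M2"
    and f: "(\<lambda>(w, x). f w x) \<in> borel_measurable (M1 \<Otimes>\<^sub>M M2)"
    and k: "k \<in> borel_measurable M1" "\<And>w. 0 \<le> k w"
    and f0: "\<And>w x. k w = 0 \<Longrightarrow> f w x = 0"
    and fk: "\<And>w. 0 < k w \<Longrightarrow> (\<integral>\<^sup>+ x. epowr (f w x) p \<partial>M2) \<le> ennreal (k w powr p)"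
    and kA: "(\<integral>\<^sup>+ w. ennreal (k w) \<partial>M1) \<le> ennreal A"
  shows "(\<integral>\<^sup>+ x. epowr (\<integral>\<^sup>+ w. f w x \<partial>M1) p \<partial>M2) \<le> ennreal (A powr p)"
proof -
  interpret M1: sigma_finite_measure M1 by fact
  interpret M2: sigma_finite_measure M2 by fact
  interpret pair_sigma_finite M1 M2 by unfold_locales
  note [measurable] = k(1)
  have f'[measurable]: "case_prod f \<in> borel_measurable (M1 \<Otimes>\<^sub>M M2)" using f by simp
  \<comment> \<open>Where \<open>k w = 0\<close> the quotient \<open>1 / k w\<close> is 0 by
    convention, and \<open>f w\<close> vanishes there too, so the factorisation \<open>fg\<close>
    holds everywhere.\<close>
  define g where "g w x = f w x * ennreal (1 / k w)" for w x
  have gm[measurable]: "case_prod g \<in> borel_measurable (M1 \<Otimes>\<^sub>M M2)"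
    unfolding g_def by measurable
  define v where "v w = ennreal (k w / A)" for w
  have [measurable]: "v \<in> borel_measurable M1" unfolding v_def by measurable
  have v: "(\<integral>\<^sup>+ w. v w \<partial>M1) \<le> 1"
  proof -
    have "(\<integral>\<^sup>+ w. v w \<partial>M1) = (\<integral>\<^sup>+ w. ennreal (1 / A) * ennreal (k w) \<partial>M1)"
      using A k by (intro nn_integral_cong) (simp add: v_def flip: ennreal_mult)
    also have "\<dots> = ennreal (1 / A) * (\<integral>\<^sup>+ w. ennreal (k w) \<partial>M1)"
      by (simp add: nn_integral_cmult)
    also have "\<dots> \<le> ennreal (1 / A) * ennreal A" by (intro mult_left_mono kA) auto
    also have "\<dots> = 1" using A by (simp flip: ennreal_mult)
    finally show ?thesis .
  qed
  have fg: "f w x = g w x * v w * ennreal A" for w x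
  proof (cases "k w = 0")
    case False
    then have "0 < k w" using k(2)[of w] by simp
    then have "ennreal (1 / k w) * v w * ennreal A = 1"
      using A by (simp add: v_def flip: ennreal_mult)
    then show ?thesis by (simp add: g_def mult.assoc)
  qed (simp add: f0 g_def)
  have "(\<integral>\<^sup>+ x. epowr (\<integral>\<^sup>+ w. f w x \<partial>M1) p \<partial>M2) =
      (\<integral>\<^sup>+ x. epowr (\<integral>\<^sup>+ w. g w x * v w \<partial>M1) p * ennreal (A powr p) \<partial>M2)"
  proof (intro nn_integral_cong)
    fix x assume [measurable]: "x \<in> space M2"
    have "(\<integral>\<^sup>+ w. f w x \<partial>M1) = (\<integral>\<^sup>+ w. g w x * v w \<partial>M1) * ennreal A"
      unfolding fg by (rule nn_integral_multc) measurable
    then show "epowr (\<integral>\<^sup>+ w. f w x \<partial>M1) p = epowr (\<integral>\<^sup>+ w. g w x * v w \<partial>M1) p * ennreal (A powr p)"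
      using epowr_mult_ennreal[OF A] by simp
  qed
  also have "\<dots> = (\<integral>\<^sup>+ x. epowr (\<integral>\<^sup>+ w. g w x * v w \<partial>M1) p \<partial>M2) * ennreal (A powr p)"
    by (rule nn_integral_multc) measurable
  also have "(\<integral>\<^sup>+ x. epowr (\<integral>\<^sup>+ w. g w x * v w \<partial>M1) p \<partial>M2) \<le>
      (\<integral>\<^sup>+ x. (\<integral>\<^sup>+ w. epowr (g w x) p * v w \<partial>M1) \<partial>M2)"
  proof (intro nn_integral_mono)
    fix x assume [measurable]: "x \<in> space M2"
    show "epowr (\<integral>\<^sup>+ w. g w x * v w \<partial>M1) p \<le> (\<integral>\<^sup>+ w. epowr (g w x) p * v w \<partial>M1)"
      by (rule nn_integral_Jensen_epowr[OF p _ _ v]) measurable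
  qed
  also have "(\<integral>\<^sup>+ x. (\<integral>\<^sup>+ w. epowr (g w x) p * v w \<partial>M1) \<partial>M2) =
     (\<integral>\<^sup>+ w. (\<integral>\<^sup>+ x. epowr (g w x) p * v w \<partial>M2) \<partial>M1)"
    by (rule Fubini') measurable
  \<comment> \<open>\<open>k w\<close> bounds the L^p norm of \<open>f w\<close>, so each normalised
    slice \<open>g w\<close> has L^p norm at most 1.\<close>
  also have "\<dots> \<le> (\<integral>\<^sup>+ w. v w \<partial>M1)"
  proof (intro nn_integral_mono)
    fix w assume [measurable]: "w \<in> space M1"
    show "(\<integral>\<^sup>+ x. epowr (g w x) p * v w \<partial>M2) \<le> v w"
    proof (cases "k w = 0")
      case False
      then have kw: "0 < k w" using k(2)[of w] by simp
      have "(\<integral>\<^sup>+ x. epowr (g w x) p * v w \<partial>M2) =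
          (\<integral>\<^sup>+ x. epowr (f w x) p * (ennreal ((1 / k w) powr p) * v w) \<partial>M2)"
        unfolding g_def using kw by (subst epowr_mult_ennreal) (auto simp: mult.assoc)
      also have "\<dots> = (\<integral>\<^sup>+ x. epowr (f w x) p \<partial>M2) * (ennreal ((1 / k w) powr p) * v w)"
        by (rule nn_integral_multc) measurable
      also have "\<dots> \<le> ennreal (k w powr p) * (ennreal ((1 / k w) powr p) * v w)"
        by (intro mult_right_mono fk kw) auto
      also have "\<dots> = v w"
        using kw by (simp add: mult.assoc[symmetric] powr_divide flip: ennreal_mult)
      finally show ?thesis .
    qed (simp add: g_def f0)
  qed
  also have "\<dots> \<le> 1" by (rule v)
  finally show ?thesis by (simp add: mult_right_mono)
qed

section \<open>Critical smoothing estimates\<close>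

text \<open>Common form of P_\<alpha>, with weight \<open>h \<theta>\<close>, and S_\<alpha>, with
  weight \<open>\<theta> * h \<theta>\<close>; the smoothing estimate below depends on the weight
  only through one moment.\<close>

definition subordination :: "(real \<Rightarrow> real) \<Rightarrow> real \<Rightarrow> real \<Rightarrow> 'a::euclidean_space measure \<Rightarrow> 'a \<Rightarrow> ennreal" where
  "subordination w \<alpha> t \<mu> x =
     (\<integral>\<^sup>+ \<theta>\<in>{0<..}. ennreal (w \<theta>) * heat_semigroup (t powr \<alpha> * \<theta>) \<mu> x \<partial>lborel)"

lemma P_op_eq_subordination: "P_op h \<alpha> t \<mu> x = subordination h \<alpha> t \<mu> x"
  by (simp add: P_op_def subordination_def)

lemma S_op_eq_subordination: "S_op h \<alpha> t \<mu> x = subordination (\<lambda>\<theta>. \<theta> * h \<theta>) \<alpha> t \<mu> x"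
  by (simp add: S_op_def subordination_def)

lemma borel_measurable_heat_semigroup [measurable (raw)]:
  fixes g :: "'b \<Rightarrow> 'a::euclidean_space"
  assumes "sigma_finite_measure \<mu>" and [measurable_cong]: "sets \<mu> = sets borel"
    and [measurable]: "f \<in> borel_measurable M" "g \<in> borel_measurable M"
  shows "(\<lambda>x. heat_semigroup (f x) \<mu> (g x)) \<in> borel_measurable M"
proof -
  interpret sigma_finite_measure \<mu> by fact
  show ?thesis
    unfolding heat_semigroup_def by measurable
qed

lemma borel_measurable_subordination [measurable (raw)]:
  fixes g :: "'b \<Rightarrow> 'a::euclidean_space"
  assumes "sigma_finite_measure \<mu>" "sets \<mu> = sets borel"
    and w[measurable]: "(\<lambda>\<theta>. indicator {0<..} \<theta> * w \<theta>) \<in> borel_measurable lborel"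
    and [measurable]: "f \<in> borel_measurable M" "g \<in> borel_measurable M"
  shows "(\<lambda>x. subordination w \<alpha> (f x) \<mu> (g x)) \<in> borel_measurable M"
proof -
  note [measurable] = borel_measurable_heat_semigroup[OF assms(1,2)]
  \<comment> \<open>Only the truncated weight is measurable, so the indicator is moved onto
    \<open>w\<close>.\<close>
  have *: "ennreal (w \<theta>) * a * indicator {0<..} \<theta> = ennreal (indicator {0<..} \<theta> * w \<theta>) * a" for \<theta> a
    by (simp add: indicator_def)
  show ?thesis
    unfolding subordination_def * by measurable
qed

text \<open>For Borel densities the completed measure is replaced by \<open>lborel\<close>, where
  product measurability and Tonelli are at hand.\<close>

lemma heat_semigroup_density_lebesgue:
  fixes g :: "'a::euclidean_space \<Rightarrow> ennreal"
  assumes [measurable]: "g \<in> borel_measurable borel"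
  shows "heat_semigroup t (density lebesgue g) x = (\<integral>\<^sup>+ y. g y * ennreal (heat_kernel t (x - y)) \<partial>lborel)"
proof -
  have "g \<in> borel_measurable lebesgue" by (simp add: measurable_completion)
  moreover have "(\<lambda>y. ennreal (heat_kernel t (x - y))) \<in> borel_measurable lebesgue"
    by (rule measurable_completion) simp
  ultimately show ?thesis
    unfolding heat_semigroup_def by (subst nn_integral_density) (auto simp: nn_integral_completion)
qed

lemma subordination_density_lebesgue:
  fixes g :: "'a::euclidean_space \<Rightarrow> ennreal"
  assumes [measurable]: "g \<in> borel_measurable borel"
  shows "subordination w \<alpha> t (density lebesgue g) x =
    (\<integral>\<^sup>+ \<theta>. ennreal (indicator {0<..} \<theta> * w \<theta>) *
       (\<integral>\<^sup>+ y. ennreal (heat_kernel (t powr \<alpha> * \<theta>) (x - y)) * g y \<partial>lborel) \<partial>lborel)"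
  unfolding subordination_def heat_semigroup_density_lebesgue[OF assms]
  by (intro nn_integral_cong) (auto simp: indicator_def mult_ac)

text \<open>Minkowski's inequality for a superposition of translated kernels, each of L^p norm at
  most \<tau>^(-1/p), with total weight m.\<close>

lemma heat_semigroup_Lp_bound:
  fixes \<mu> :: "'a::euclidean_space measure"
  defines "p \<equiv> 1 + 2 / real DIM('a)"
  assumes \<mu>: "sets \<mu> = sets borel" "emeasure \<mu> UNIV \<le> ennreal m" and m: "0 < m" and \<tau>: "0 < \<tau>"
  shows "(\<integral>\<^sup>+ x. epowr (heat_semigroup \<tau> \<mu> x) p \<partial>lborel) \<le> ennreal ((m * \<tau> powr - (1 / p)) powr p)"
  unfolding heat_semigroup_def
proof (rule nn_integral_Minkowski_epowr[where k = "\<lambda>_. \<tau> powr - (1 / p)"])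
  have space: "space \<mu> = UNIV" using sets_eq_imp_space_eq[OF \<mu>(1)] by simp
  have "emeasure \<mu> UNIV \<noteq> top" using \<mu>(2) by (auto simp: top_unique)
  then have "finite_measure \<mu>" by (intro finite_measureI) (simp add: space)
  then interpret finite_measure \<mu> .
  show p: "1 < p" by (simp add: p_def)
  show "0 < m * \<tau> powr - (1 / p)" using m \<tau> by simp
  show "sigma_finite_measure \<mu>" "sigma_finite_measure lborel" by unfold_locales
  note [measurable_cong] = \<mu>(1)
  show "(\<lambda>(w, x). ennreal (heat_kernel \<tau> (x - w))) \<in> borel_measurable (\<mu> \<Otimes>\<^sub>M lborel)"
    by measurable
  fix w :: 'a
  have "(\<tau> powr - (1 / p)) powr p = \<tau> powr - 1"
    using p unfolding powr_powr by simp
  then have "(\<tau> powr - (1 / p)) powr p = 1 / \<tau>"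
    using \<tau> by (simp only: powr_minus_divide powr_one)
  then show "(\<integral>\<^sup>+ x. epowr (ennreal (heat_kernel \<tau> (x - w))) p \<partial>lborel) \<le> ennreal ((\<tau> powr - (1 / p)) powr p)"
    using nn_integral_heat_kernel_powr[OF \<tau>, of w] by (simp add: p_def)
  show "(\<integral>\<^sup>+ w. ennreal (\<tau> powr - (1 / p)) \<partial>\<mu>) \<le> ennreal (m * \<tau> powr - (1 / p))"
    using mult_left_mono[OF \<mu>(2), of "ennreal (\<tau> powr - (1 / p))"] m
    by (simp add: space ennreal_mult mult_ac)
qed (use \<tau> in auto)

text \<open>A second use of Minkowski, now over \<theta>: the slice has norm at most w(\<theta>) m
  (t^\<alpha> \<theta>)^(-1/p), and integration in \<theta> leaves the moment of order -1/p.\<close>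

lemma subordination_Lp_bound:
  fixes \<mu> :: "'a::euclidean_space measure"
  defines "p \<equiv> 1 + 2 / real DIM('a)"
  assumes \<mu>: "sets \<mu> = sets borel" "emeasure \<mu> UNIV \<le> ennreal m" and m: "0 < m" and t: "0 < t"
    and w: "(\<lambda>\<theta>. indicator {0<..} \<theta> * w \<theta>) \<in> borel_measurable lborel" "\<And>\<theta>. 0 < \<theta> \<Longrightarrow> 0 \<le> w \<theta>"
    and K: "0 < K" "(\<integral>\<^sup>+ \<theta>\<in>{0<..}. ennreal (w \<theta>) * ennreal (\<theta> powr - (1 / p)) \<partial>lborel) \<le> ennreal K"
  shows "(\<integral>\<^sup>+ x. epowr (subordination w \<alpha> t \<mu> x) p \<partial>lborel) \<le> ennreal ((m * K * t powr - (\<alpha> / p)) powr p)"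
proof -
  have space: "space \<mu> = UNIV" using sets_eq_imp_space_eq[OF \<mu>(1)] by simp
  have "emeasure \<mu> UNIV \<noteq> top" using \<mu>(2) by (auto simp: top_unique)
  then have "finite_measure \<mu>" by (intro finite_measureI) (simp add: space)
  then interpret finite_measure \<mu> .
  have sf: "sigma_finite_measure \<mu>" by unfold_locales
  note [measurable] = borel_measurable_heat_semigroup[OF sf \<mu>(1)] w(1)
  define v where "v \<theta> = indicator {0<..} \<theta> * w \<theta>" for \<theta>
  have v: "0 \<le> v \<theta>" for \<theta> using w(2)[of \<theta>] by (simp add: v_def indicator_def)
  have [measurable]: "v \<in> borel_measurable lborel" using w(1) by (simp add: v_def[abs_def])
  have p: "1 < p" by (simp add: p_def)
  let ?k = "\<lambda>\<theta>. v \<theta> * (m * (t powr \<alpha> * \<theta>) powr - (1 / p))"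
  have "(\<integral>\<^sup>+ x. epowr (\<integral>\<^sup>+ \<theta>. ennreal (v \<theta>) * heat_semigroup (t powr \<alpha> * \<theta>) \<mu> x \<partial>lborel) p \<partial>lborel)
     \<le> ennreal ((m * K * t powr - (\<alpha> / p)) powr p)"
  proof (rule nn_integral_Minkowski_epowr[where k = ?k])
    show "1 < p" by fact
    show "0 < m * K * t powr - (\<alpha> / p)" using m K t by simp
    show "sigma_finite_measure (lborel :: real measure)" "sigma_finite_measure (lborel :: 'a measure)" by unfold_locales
    show "(\<lambda>(\<theta>, x). ennreal (v \<theta>) * heat_semigroup (t powr \<alpha> * \<theta>) \<mu> x) \<in> borel_measurable (lborel \<Otimes>\<^sub>M lborel)"
      by measurable
    show "?k \<in> borel_measurable lborel" by measurable
    show "0 \<le> ?k \<theta>" for \<theta> using v[of \<theta>] m by simp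
    show "ennreal (v \<theta>) * heat_semigroup (t powr \<alpha> * \<theta>) \<mu> x = 0" if "?k \<theta> = 0" for \<theta> and x :: 'a
    proof -
      have "v \<theta> = 0"
      proof (rule ccontr)
        assume *: "v \<theta> \<noteq> 0"
        then have "0 < \<theta>" by (simp add: v_def indicator_def split: if_splits)
        then show False using that * m t by simp
      qed
      then show ?thesis by simp
    qed
    show "(\<integral>\<^sup>+ x. epowr (ennreal (v \<theta>) * heat_semigroup (t powr \<alpha> * \<theta>) \<mu> x) p \<partial>lborel) \<le> ennreal (?k \<theta> powr p)"
      if "0 < ?k \<theta>" for \<theta>
    proof -
      have v0: "0 < v \<theta>" using that v[of \<theta>] by (cases "v \<theta> = 0") auto
      then have \<theta>: "0 < \<theta>" by (cases "0 < \<theta>") (auto simp: v_def)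
      have "(\<integral>\<^sup>+ x. epowr (ennreal (v \<theta>) * heat_semigroup (t powr \<alpha> * \<theta>) \<mu> x) p \<partial>lborel) =
          (\<integral>\<^sup>+ x. epowr (heat_semigroup (t powr \<alpha> * \<theta>) \<mu> x) p * ennreal (v \<theta> powr p) \<partial>lborel)"
        by (simp add: epowr_mult_ennreal[OF v0] mult.commute[of "ennreal (v \<theta>)"])
      also have "\<dots> = (\<integral>\<^sup>+ x. epowr (heat_semigroup (t powr \<alpha> * \<theta>) \<mu> x) p \<partial>lborel) * ennreal (v \<theta> powr p)"
        by (rule nn_integral_multc) measurable
      also have "\<dots> \<le> ennreal ((m * (t powr \<alpha> * \<theta>) powr - (1 / p)) powr p) * ennreal (v \<theta> powr p)"
        unfolding p_def by (intro mult_right_mono heat_semigroup_Lp_bound \<mu> m) (use t \<theta> in auto)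
      also have "\<dots> = ennreal (?k \<theta> powr p)"
        using v0 m by (simp add: powr_mult mult_ac flip: ennreal_mult)
      finally show ?thesis .
    qed
    have "(\<integral>\<^sup>+ \<theta>. ennreal (?k \<theta>) \<partial>lborel) =
       (\<integral>\<^sup>+ \<theta>. ennreal (m * t powr - (\<alpha> / p)) * (ennreal (w \<theta>) * ennreal (\<theta> powr - (1 / p)) * indicator {0<..} \<theta>) \<partial>lborel)"
    proof (intro nn_integral_cong)
      fix \<theta> :: real
      show "ennreal (?k \<theta>) = ennreal (m * t powr - (\<alpha> / p)) * (ennreal (w \<theta>) * ennreal (\<theta> powr - (1 / p)) * indicator {0<..} \<theta>)"
      proof (cases "0 < \<theta>")
        case True
        then have k: "?k \<theta> = (m * t powr - (\<alpha> / p)) * (w \<theta> * \<theta> powr - (1 / p))"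
          using t by (simp add: v_def powr_mult powr_powr mult_ac)
        have "ennreal (?k \<theta>) = ennreal (m * t powr - (\<alpha> / p)) * ennreal (w \<theta> * \<theta> powr - (1 / p))"
          using True m w(2)[of \<theta>] by (subst k, intro ennreal_mult) auto
        also have "ennreal (w \<theta> * \<theta> powr - (1 / p)) = ennreal (w \<theta>) * ennreal (\<theta> powr - (1 / p))"
          using True w(2)[of \<theta>] by (intro ennreal_mult) auto
        finally show ?thesis using True by simp
      qed (simp add: v_def)
    qed
    also have "\<dots> = ennreal (m * t powr - (\<alpha> / p)) * (\<integral>\<^sup>+ \<theta>. (ennreal (w \<theta>) * ennreal (\<theta> powr - (1 / p)) * indicator {0<..} \<theta>) \<partial>lborel)"
    proof (rule nn_integral_cmult)
      have "(\<lambda>\<theta>. ennreal (w \<theta>) * ennreal (\<theta> powr - (1 / p)) * indicator {0<..} \<theta>) = (\<lambda>\<theta>. ennreal (v \<theta>) * ennreal (\<theta> powr - (1 / p)))"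
        by (auto simp: v_def indicator_def)
      then show "(\<lambda>\<theta>. ennreal (w \<theta>) * ennreal (\<theta> powr - (1 / p)) * indicator {0<..} \<theta>) \<in> borel_measurable lborel"
        by simp
    qed
    also have "\<dots> \<le> ennreal (m * t powr - (\<alpha> / p)) * ennreal K"
      by (intro mult_left_mono K) auto
    also have "\<dots> = ennreal (m * K * t powr - (\<alpha> / p))"
      using m K by (simp add: mult_ac flip: ennreal_mult)
    finally show "(\<integral>\<^sup>+ \<theta>. ennreal (?k \<theta>) \<partial>lborel) \<le> ennreal (m * K * t powr - (\<alpha> / p))" .
  qed
  moreover have "subordination w \<alpha> t \<mu> x = (\<integral>\<^sup>+ \<theta>. ennreal (v \<theta>) * heat_semigroup (t powr \<alpha> * \<theta>) \<mu> x \<partial>lborel)" for x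
    unfolding subordination_def v_def by (intro nn_integral_cong) (simp add: indicator_def)
  ultimately show ?thesis by simp
qed

section \<open>Time integrals of Beta type\<close>

lemma nn_integral_powr_0:
  fixes a t :: real
  assumes "- 1 < a" "0 < t"
  shows "(\<integral>\<^sup>+ s\<in>{0<..<t}. ennreal (s powr a) \<partial>lborel) = ennreal (t powr (a + 1) / (a + 1))"
proof -
  have "((\<lambda>s. s powr a) has_integral (t powr (a + 1) / (a + 1))) {0..t}"
    using has_integral_powr_from_0[of a t] assms by simp
  then have "((\<lambda>s. s powr a) has_integral (t powr (a + 1) / (a + 1))) {0<..<t}"
    by (simp add: has_integral_Icc_iff_Ioo)
  then have "(\<integral>\<^sup>+ s. ennreal (indicator {0<..<t} s * s powr a) \<partial>lborel) = ennreal (t powr (a + 1) / (a + 1))"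
    by (intro nn_integral_has_integral_lebesgue) auto
  moreover have "(\<integral>\<^sup>+ s\<in>{0<..<t}. ennreal (s powr a) \<partial>lborel) = (\<integral>\<^sup>+ s. ennreal (indicator {0<..<t} s * s powr a) \<partial>lborel)"
    by (intro nn_integral_cong) (simp add: indicator_def)
  ultimately show ?thesis by simp
qed

lemma nn_integral_powr_reflected:
  fixes a t :: real
  assumes "- 1 < a" "0 < t"
  shows "(\<integral>\<^sup>+ s\<in>{0<..<t}. ennreal ((t - s) powr a) \<partial>lborel) = ennreal (t powr (a + 1) / (a + 1))"
proof -
  have "(\<integral>\<^sup>+ s\<in>{0<..<t}. ennreal (s powr a) \<partial>lborel) =
     ennreal \<bar>-1\<bar> * (\<integral>\<^sup>+ s. ennreal ((t + (-1) * s) powr a) * indicator {0<..<t} (t + (-1) * s) \<partial>lborel)"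
    by (rule nn_integral_real_affine) auto
  also have "\<dots> = (\<integral>\<^sup>+ s\<in>{0<..<t}. ennreal ((t - s) powr a) \<partial>lborel)"
    by (simp, intro nn_integral_cong) (auto simp: indicator_def)
  finally show ?thesis using nn_integral_powr_0[OF assms] by simp
qed

text \<open>An elementary bound for the Beta function: on either half of (0, t) one factor is
  replaced by its value at t/2. The two singularities then contribute separately, and the pole 1/(1
  - \<alpha>) at s = 0 stays explicit.\<close>

lemma nn_integral_Beta_kernel_le:
  fixes \<alpha> \<kappa> t :: real
  assumes \<alpha>: "0 < \<alpha>" "\<alpha> < 1" and \<kappa>: "0 < \<kappa>" "\<kappa> \<le> 1" and t: "0 < t"
  shows "(\<integral>\<^sup>+ s\<in>{0<..<t}. ennreal ((t - s) powr (\<kappa> - 1) * s powr - \<alpha>) \<partial>lborel)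
    \<le> ennreal (2 * (1 / (1 - \<alpha>) + 1 / \<kappa>) * t powr (\<kappa> - \<alpha>))"
proof -
  let ?A = "(t / 2) powr (\<kappa> - 1)" and ?B = "(t / 2) powr - \<alpha>"
  have le: "(t - s) powr (\<kappa> - 1) * s powr - \<alpha> \<le> ?A * s powr - \<alpha> + ?B * (t - s) powr (\<kappa> - 1)"
    if s: "0 < s" "s < t" for s
  proof (cases "s \<le> t / 2")
    case True
    then have "(t - s) powr (\<kappa> - 1) \<le> ?A" using s \<kappa> t by (intro powr_mono2') auto
    then have "(t - s) powr (\<kappa> - 1) * s powr - \<alpha> \<le> ?A * s powr - \<alpha>" by (intro mult_right_mono) auto
    then show ?thesis by (simp add: add_increasing2)
  next
    case False
    then have "s powr - \<alpha> \<le> ?B" using s \<alpha> t by (intro powr_mono2') auto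
    then have "(t - s) powr (\<kappa> - 1) * s powr - \<alpha> \<le> (t - s) powr (\<kappa> - 1) * ?B" by (intro mult_left_mono) auto
    then show ?thesis by (simp add: add_increasing mult.commute)
  qed
  have "(\<integral>\<^sup>+ s\<in>{0<..<t}. ennreal ((t - s) powr (\<kappa> - 1) * s powr - \<alpha>) \<partial>lborel)
    \<le> (\<integral>\<^sup>+ s. ennreal ?A * (ennreal (s powr - \<alpha>) * indicator {0<..<t} s) + ennreal ?B * (ennreal ((t - s) powr (\<kappa> - 1)) * indicator {0<..<t} s) \<partial>lborel)"
  proof (intro nn_integral_mono)
    fix s :: real
    show "ennreal ((t - s) powr (\<kappa> - 1) * s powr - \<alpha>) * indicator {0<..<t} s
      \<le> ennreal ?A * (ennreal (s powr - \<alpha>) * indicator {0<..<t} s) + ennreal ?B * (ennreal ((t - s) powr (\<kappa> - 1)) * indicator {0<..<t} s)"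
      using le[of s] by (auto simp: indicator_def ennreal_leI simp flip: ennreal_mult ennreal_plus)
  qed
  also have "\<dots> = ennreal ?A * (\<integral>\<^sup>+ s\<in>{0<..<t}. ennreal (s powr - \<alpha>) \<partial>lborel) +
      ennreal ?B * (\<integral>\<^sup>+ s\<in>{0<..<t}. ennreal ((t - s) powr (\<kappa> - 1)) \<partial>lborel)"
    by (simp add: nn_integral_add nn_integral_cmult)
  also have "\<dots> = ennreal ?A * ennreal (t powr (- \<alpha> + 1) / (- \<alpha> + 1)) + ennreal ?B * ennreal (t powr (\<kappa> - 1 + 1) / (\<kappa> - 1 + 1))"
    using \<alpha> \<kappa> t by (subst nn_integral_powr_0, simp, simp, subst nn_integral_powr_reflected) auto
  also have "\<dots> = ennreal (?A * (t powr (1 - \<alpha>) / (1 - \<alpha>)) + ?B * (t powr \<kappa> / \<kappa>))"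
    using \<alpha> \<kappa> t by (simp add: ennreal_mult[symmetric] ennreal_plus[symmetric] add.commute del: ennreal_plus)
  also have "\<dots> \<le> ennreal (2 * (1 / (1 - \<alpha>) + 1 / \<kappa>) * t powr (\<kappa> - \<alpha>))"
  proof (rule ennreal_leI)
    have half: "(1/2) powr (b - 1) \<le> (2::real)" if "0 < b" for b
    proof -
      have "(1/2) powr (b - 1) \<le> (1/2::real) powr (- 1)" using that by (intro powr_mono') auto
      then show ?thesis by (simp add: powr_minus_divide)
    qed
    have A: "?A * (t powr (1 - \<alpha>) / (1 - \<alpha>)) = (1/2) powr (\<kappa> - 1) * (t powr (\<kappa> - \<alpha>) / (1 - \<alpha>))"
    proof -
      have "?A = (1/2) powr (\<kappa> - 1) * t powr (\<kappa> - 1)" using t powr_mult[of "1/2" t "\<kappa> - 1"] by simp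
      moreover have "t powr (\<kappa> - 1) * t powr (1 - \<alpha>) = t powr (\<kappa> - \<alpha>)" by (simp flip: powr_add)
      ultimately show ?thesis by (metis mult.assoc times_divide_eq_right)
    qed
    have B: "?B * (t powr \<kappa> / \<kappa>) = (1/2) powr (- \<alpha>) * (t powr (\<kappa> - \<alpha>) / \<kappa>)"
    proof -
      have "?B = (1/2) powr (- \<alpha>) * t powr (- \<alpha>)" using t powr_mult[of "1/2" t "- \<alpha>"] by simp
      moreover have "t powr (- \<alpha>) * t powr \<kappa> = t powr (\<kappa> - \<alpha>)" by (simp flip: powr_add)
      ultimately show ?thesis by (metis mult.assoc times_divide_eq_right)
    qed
    have "?A * (t powr (1 - \<alpha>) / (1 - \<alpha>)) + ?B * (t powr \<kappa> / \<kappa>)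
      \<le> 2 * (t powr (\<kappa> - \<alpha>) / (1 - \<alpha>)) + 2 * (t powr (\<kappa> - \<alpha>) / \<kappa>)"
      unfolding A B using half[of \<kappa>] half[of "1 - \<alpha>"] \<alpha> \<kappa> by (intro add_mono mult_right_mono) auto
    also have "\<dots> = 2 * (1 / (1 - \<alpha>) + 1 / \<kappa>) * t powr (\<kappa> - \<alpha>)" by (simp add: algebra_simps)
    finally show "?A * (t powr (1 - \<alpha>) / (1 - \<alpha>)) + ?B * (t powr \<kappa> / \<kappa>) \<le> 2 * (1 / (1 - \<alpha>) + 1 / \<kappa>) * t powr (\<kappa> - \<alpha>)" .
  qed
  finally show ?thesis .
qed

section \<open>The Duhamel operator on extended nonnegative functions\<close>

definition duhamel ::
  "(real \<Rightarrow> real) \<Rightarrow> real \<Rightarrow> real \<Rightarrow> (real \<Rightarrow> 'a::euclidean_space \<Rightarrow> ennreal) \<Rightarrow> real \<Rightarrow> 'a \<Rightarrow> ennreal" where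
  "duhamel w \<alpha> p U t x = ennreal \<alpha> * (\<integral>\<^sup>+ s\<in>{0<..<t}. ennreal ((t - s) powr (\<alpha> - 1)) *
     subordination w \<alpha> (t - s) (density lebesgue (\<lambda>y. epowr (U s y) p)) x \<partial>lborel)"

text \<open>The parameter-dependent measure in \<open>duhamel\<close> written out as a double
  integral, so that joint measurability is visible. The elapsed time \<open>\<tau>\<close> is kept
  apart from the source time \<open>s\<close>.\<close>

definition duhamel_inner ::
  "(real \<Rightarrow> real) \<Rightarrow> real \<Rightarrow> real \<Rightarrow> (real \<Rightarrow> 'a::euclidean_space \<Rightarrow> ennreal) \<Rightarrow> real \<Rightarrow> real \<Rightarrow> 'a \<Rightarrow> ennreal" where
  "duhamel_inner w \<alpha> p U \<tau> s x = (\<integral>\<^sup>+ \<theta>. ennreal (indicator {0<..} \<theta> * w \<theta>) *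
       (\<integral>\<^sup>+ y. ennreal (heat_kernel (\<tau> powr \<alpha> * \<theta>) (x - y)) * epowr (U s y) p \<partial>lborel) \<partial>lborel)"

lemma measurable_section:
  assumes "(\<lambda>(t, x). U t x) \<in> borel_measurable (borel \<Otimes>\<^sub>M borel)"
  shows "U s \<in> borel_measurable borel"
proof -
  have "(\<lambda>y. (s, y)) \<in> borel \<rightarrow>\<^sub>M borel \<Otimes>\<^sub>M borel" by measurable
  from measurable_compose[OF this assms] show ?thesis by simp
qed

lemma subordination_density_eq_duhamel_inner:
  fixes U :: "real \<Rightarrow> 'a::euclidean_space \<Rightarrow> ennreal"
  assumes "(\<lambda>(t, x). U t x) \<in> borel_measurable (borel \<Otimes>\<^sub>M borel)"
  shows "subordination w \<alpha> \<tau> (density lebesgue (\<lambda>y. epowr (U s y) p)) x = duhamel_inner w \<alpha> p U \<tau> s x"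
proof -
  have [measurable]: "U s \<in> borel_measurable borel" by (rule measurable_section[OF assms])
  show ?thesis
    unfolding duhamel_inner_def by (rule subordination_density_lebesgue) measurable
qed

lemma borel_measurable_duhamel_inner:
  fixes U :: "real \<Rightarrow> 'a::euclidean_space \<Rightarrow> ennreal"
  assumes U[measurable]: "(\<lambda>(t, x). U t x) \<in> borel_measurable (borel \<Otimes>\<^sub>M borel)"
    and w[measurable]: "(\<lambda>\<theta>. indicator {0<..} \<theta> * w \<theta>) \<in> borel_measurable lborel"
    and [measurable]: "f \<in> borel_measurable M" "g \<in> borel_measurable M" "k \<in> borel_measurable M"
  shows "(\<lambda>z. duhamel_inner w \<alpha> p U (f z) (g z) (k z)) \<in> borel_measurable M"
proof -
  have U'[measurable]: "case_prod U \<in> borel_measurable (borel \<Otimes>\<^sub>M borel)" using U by simp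
  show ?thesis unfolding duhamel_inner_def by measurable
qed

lemma borel_measurable_duhamel:
  fixes U :: "real \<Rightarrow> 'a::euclidean_space \<Rightarrow> ennreal"
  assumes U: "(\<lambda>(t, x). U t x) \<in> borel_measurable (borel \<Otimes>\<^sub>M borel)"
    and w: "(\<lambda>\<theta>. indicator {0<..} \<theta> * w \<theta>) \<in> borel_measurable lborel"
  shows "(\<lambda>(t, x). duhamel w \<alpha> p U t x) \<in> borel_measurable (borel \<Otimes>\<^sub>M borel)"
proof -
  note [measurable] = borel_measurable_duhamel_inner[OF U w]
  show ?thesis
    unfolding duhamel_def subordination_density_eq_duhamel_inner[OF U] indicator_def greaterThanLessThan_iff
    by measurable
qed

lemma duhamel_inner_mono:
  assumes "0 \<le> p" "\<And>s y. U s y \<le> V s y"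
  shows "duhamel_inner w \<alpha> p U \<tau> s x \<le> duhamel_inner w \<alpha> p V \<tau> s x"
  unfolding duhamel_inner_def
  by (intro nn_integral_mono mult_left_mono epowr_mono assms) auto

lemma duhamel_mono:
  fixes U V :: "real \<Rightarrow> 'a::euclidean_space \<Rightarrow> ennreal"
  assumes "0 \<le> p" "\<And>s y. U s y \<le> V s y"
    and U: "(\<lambda>(t, x). U t x) \<in> borel_measurable (borel \<Otimes>\<^sub>M borel)"
    and V: "(\<lambda>(t, x). V t x) \<in> borel_measurable (borel \<Otimes>\<^sub>M borel)"
  shows "duhamel w \<alpha> p U t x \<le> duhamel w \<alpha> p V t x"
  unfolding duhamel_def subordination_density_eq_duhamel_inner[OF U] subordination_density_eq_duhamel_inner[OF V]
  by (intro nn_integral_mono mult_left_mono mult_right_mono duhamel_inner_mono assms) auto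

lemma nn_integral_mult_SUP:
  fixes F :: "nat \<Rightarrow> 'b \<Rightarrow> ennreal"
  assumes [measurable]: "c \<in> borel_measurable M" "\<And>n. F n \<in> borel_measurable M"
    and "\<And>x. incseq (\<lambda>n. F n x)"
  shows "(\<integral>\<^sup>+ x. c x * (SUP n. F n x) \<partial>M) = (SUP n. (\<integral>\<^sup>+ x. c x * F n x \<partial>M))"
proof -
  have "(\<integral>\<^sup>+ x. c x * (SUP n. F n x) \<partial>M) = (\<integral>\<^sup>+ x. (SUP n. c x * F n x) \<partial>M)"
    by (simp add: SUP_mult_left_ennreal)
  also have "\<dots> = (SUP n. (\<integral>\<^sup>+ x. c x * F n x \<partial>M))"
    using assms(3) by (intro nn_integral_monotone_convergence_SUP) (auto simp: incseq_def le_fun_def intro!: mult_left_mono)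
  finally show ?thesis .
qed

text \<open>Monotone convergence in y, in \<theta> and in s, after the power has been interchanged
  with the supremum.\<close>

lemma duhamel_SUP:
  fixes U :: "nat \<Rightarrow> real \<Rightarrow> 'a::euclidean_space \<Rightarrow> ennreal"
  assumes p: "0 < p"
    and U: "\<And>n. (\<lambda>(t, x). U n t x) \<in> borel_measurable (borel \<Otimes>\<^sub>M borel)"
    and w: "(\<lambda>\<theta>. indicator {0<..} \<theta> * w \<theta>) \<in> borel_measurable lborel"
    and inc: "\<And>s y. incseq (\<lambda>n. U n s y)"
  shows "duhamel w \<alpha> p (\<lambda>s y. SUP n. U n s y) t x = (SUP n. duhamel w \<alpha> p (U n) t x)"
proof -
  note [measurable] = w borel_measurable_duhamel_inner[OF U w]
  have [measurable]: "case_prod (U n) \<in> borel_measurable (borel \<Otimes>\<^sub>M borel)" for n using U[of n] by simp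
  have SU: "(\<lambda>(t, x). SUP n. U n t x) \<in> borel_measurable (borel \<Otimes>\<^sub>M borel)"
    by measurable
  have mono: "U m s y \<le> U n s y" if "m \<le> n" for m n s y
    using inc[of s y] that by (simp add: incseq_def)
  have inner: "duhamel_inner w \<alpha> p (\<lambda>s y. SUP n. U n s y) \<tau> s x = (SUP n. duhamel_inner w \<alpha> p (U n) \<tau> s x)" for \<tau> s
  proof -
    have [measurable]: "U n s \<in> borel_measurable borel" for n by (rule measurable_section[OF U])
    have "(\<integral>\<^sup>+ y. ennreal (heat_kernel r (x - y)) * (SUP n. epowr (U n s y) p) \<partial>lborel) =
        (SUP n. \<integral>\<^sup>+ y. ennreal (heat_kernel r (x - y)) * epowr (U n s y) p \<partial>lborel)" for r
      using p by (intro nn_integral_mult_SUP) (auto simp: incseq_def intro!: epowr_mono mono)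
    then show ?thesis
      unfolding duhamel_inner_def epowr_SUP[OF p]
      using p by (simp, intro nn_integral_mult_SUP)
        (auto simp: incseq_def intro!: nn_integral_mono mult_left_mono epowr_mono mono)
  qed
  have "duhamel w \<alpha> p (\<lambda>s y. SUP n. U n s y) t x =
     ennreal \<alpha> * (\<integral>\<^sup>+ s. (ennreal ((t - s) powr (\<alpha> - 1)) * indicator {0<..<t} s) * (SUP n. duhamel_inner w \<alpha> p (U n) (t - s) s x) \<partial>lborel)"
    unfolding duhamel_def subordination_density_eq_duhamel_inner[OF SU] inner by (simp add: mult_ac)
  also have "\<dots> = ennreal \<alpha> * (SUP n. \<integral>\<^sup>+ s. (ennreal ((t - s) powr (\<alpha> - 1)) * indicator {0<..<t} s) * duhamel_inner w \<alpha> p (U n) (t - s) s x \<partial>lborel)"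
    using p by (subst nn_integral_mult_SUP) (auto simp: incseq_def intro!: duhamel_inner_mono mono)
  also have "\<dots> = (SUP n. duhamel w \<alpha> p (U n) t x)"
    unfolding duhamel_def subordination_density_eq_duhamel_inner[OF U]
    by (simp add: SUP_mult_left_ennreal mult_ac)
  finally show ?thesis .
qed

text \<open>The slice U(s)^p is a measure of mass at most Y s^(-\<alpha>), to which the smoothing
  estimate over the time t - s applies. A third use of Minkowski, in s, leaves the kernel (t -
  s)^(\<kappa> - 1) s^(-\<alpha>) with \<kappa> = \<alpha> (1 - 1/p); its integral scales like
  t^(\<kappa> - \<alpha>) = t^(-\<alpha>/p), the same power as for the linear term.\<close>

lemma duhamel_Lp_bound:
  fixes U :: "real \<Rightarrow> 'a::euclidean_space \<Rightarrow> ennreal"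
  defines "p \<equiv> 1 + 2 / real DIM('a)"
  assumes U: "(\<lambda>(t, x). U t x) \<in> borel_measurable (borel \<Otimes>\<^sub>M borel)"
    and Y: "0 < Y" "\<And>s. 0 < s \<Longrightarrow> (\<integral>\<^sup>+ x. epowr (U s x) p \<partial>lborel) \<le> ennreal (Y * s powr - \<alpha>)"
    and \<alpha>: "1/2 \<le> \<alpha>" "\<alpha> < 1" and t: "0 < t"
    and w: "(\<lambda>\<theta>. indicator {0<..} \<theta> * w \<theta>) \<in> borel_measurable lborel" "\<And>\<theta>. 0 < \<theta> \<Longrightarrow> 0 \<le> w \<theta>"
    and K: "0 < K" "(\<integral>\<^sup>+ \<theta>\<in>{0<..}. ennreal (w \<theta>) * ennreal (\<theta> powr - (1 / p)) \<partial>lborel) \<le> ennreal K"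
  shows "(\<integral>\<^sup>+ x. epowr (duhamel w \<alpha> p U t x) p \<partial>lborel) \<le>
    ennreal ((Y * K * (2 * (1 + 2 * p / (p - 1)) / (1 - \<alpha>)) * t powr - (\<alpha> / p)) powr p)"
proof -
  note [measurable] = borel_measurable_duhamel_inner[OF U w(1)]
  have p: "1 < p" by (simp add: p_def)
  define \<kappa> where "\<kappa> = \<alpha> * (1 - 1 / p)"
  have \<kappa>: "0 < \<kappa>" "\<kappa> \<le> 1" using \<alpha> p by (auto simp: \<kappa>_def mult_le_one)
  let ?T = "2 * (1 + 2 * p / (p - 1)) / (1 - \<alpha>)"
  let ?k = "\<lambda>s. indicator {0<..<t} s * (\<alpha> * (t - s) powr (\<alpha> - 1) * (Y * s powr - \<alpha> * K * (t - s) powr - (\<alpha> / p)))"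
  let ?f = "\<lambda>s x. ennreal (indicator {0<..<t} s * (\<alpha> * (t - s) powr (\<alpha> - 1))) * duhamel_inner w \<alpha> p U (t - s) s x"
  have "(\<integral>\<^sup>+ x. epowr (\<integral>\<^sup>+ s. ?f s x \<partial>lborel) p \<partial>lborel) \<le> ennreal ((Y * K * ?T * t powr - (\<alpha> / p)) powr p)"
  proof (rule nn_integral_Minkowski_epowr[where k = ?k])
    show "1 < p" by fact
    show "0 < Y * K * ?T * t powr - (\<alpha> / p)" using Y K \<alpha> p t by (simp add: add_pos_pos)
    show "sigma_finite_measure (lborel :: real measure)" "sigma_finite_measure (lborel :: 'a measure)" by unfold_locales
    show "(\<lambda>(s, x). ?f s x) \<in> borel_measurable (lborel \<Otimes>\<^sub>M lborel)" by measurable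
    show "?k \<in> borel_measurable lborel" by measurable
    show "0 \<le> ?k s" for s using \<alpha> Y K by (simp add: indicator_def)
    have kpos: "0 < ?k s \<longleftrightarrow> s \<in> {0<..<t}" and k0: "?k s = 0 \<longleftrightarrow> s \<notin> {0<..<t}" for s
      using \<alpha> Y K by (auto simp: indicator_def)
    show "?f s x = 0" if "?k s = 0" for s and x :: 'a
      using that unfolding k0 by simp
    show "(\<integral>\<^sup>+ x. epowr (?f s x) p \<partial>lborel) \<le> ennreal (?k s powr p)" if "0 < ?k s" for s
    proof -
      have s: "0 < s" "s < t" using that unfolding kpos by auto
      let ?c = "\<alpha> * (t - s) powr (\<alpha> - 1)"
      have c: "0 < ?c" using \<alpha> s by simp
      \<comment> \<open>The density is taken over \<open>lborel\<close> here because the smoothing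
        estimate asks for the Borel sigma-algebra.\<close>
      let ?\<mu> = "density lborel (\<lambda>y. epowr (U s y) p)"
      have [measurable]: "U s \<in> borel_measurable borel" by (rule measurable_section[OF U])
      have m: "emeasure ?\<mu> UNIV \<le> ennreal (Y * s powr - \<alpha>)"
        using Y(2)[OF s(1)] by (simp add: emeasure_density)
      have eq: "duhamel_inner w \<alpha> p U (t - s) s x = subordination w \<alpha> (t - s) ?\<mu> x" for x
        unfolding duhamel_inner_def subordination_def heat_semigroup_def
        by (intro nn_integral_cong, subst nn_integral_density) (auto simp: indicator_def mult_ac)
      have "(\<integral>\<^sup>+ x. epowr (?f s x) p \<partial>lborel) = (\<integral>\<^sup>+ x. epowr (duhamel_inner w \<alpha> p U (t - s) s x) p * ennreal (?c powr p) \<partial>lborel)"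
        using s epowr_mult_ennreal[OF c] by (simp add: mult.commute[of "ennreal ?c"])
      also have "\<dots> = (\<integral>\<^sup>+ x. epowr (duhamel_inner w \<alpha> p U (t - s) s x) p \<partial>lborel) * ennreal (?c powr p)"
        by (rule nn_integral_multc) measurable
      also have "(\<integral>\<^sup>+ x. epowr (duhamel_inner w \<alpha> p U (t - s) s x) p \<partial>lborel) \<le>
          ennreal ((Y * s powr - \<alpha> * K * (t - s) powr - (\<alpha> / p)) powr p)"
        unfolding eq unfolding p_def using Y K s w m unfolding p_def
        by (intro subordination_Lp_bound) auto
      also have "\<dots> * ennreal (?c powr p) = ennreal (?k s powr p)"
        using s c Y K by (simp add: powr_mult mult_ac flip: ennreal_mult)
      finally show ?thesis by (simp add: mult_right_mono)
    qed
    have "(\<integral>\<^sup>+ s. ennreal (?k s) \<partial>lborel) =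
       (\<integral>\<^sup>+ s. ennreal (\<alpha> * Y * K) * (ennreal ((t - s) powr (\<kappa> - 1) * s powr - \<alpha>) * indicator {0<..<t} s) \<partial>lborel)"
    proof (intro nn_integral_cong)
      fix s :: real
      show "ennreal (?k s) = ennreal (\<alpha> * Y * K) * (ennreal ((t - s) powr (\<kappa> - 1) * s powr - \<alpha>) * indicator {0<..<t} s)"
      proof (cases "s \<in> {0<..<t}")
        case True
        have "(t - s) powr (\<alpha> - 1) * (t - s) powr - (\<alpha> / p) = (t - s) powr (\<kappa> - 1)"
        proof -
          have "(\<alpha> - 1) + - (\<alpha> / p) = \<kappa> - 1" by (simp add: \<kappa>_def algebra_simps)
          then show ?thesis by (simp only: powr_add[symmetric])
        qed
        then have "?k s = (\<alpha> * Y * K) * ((t - s) powr (\<kappa> - 1) * s powr - \<alpha>)"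
          using True by simp
        then show ?thesis using True \<alpha> Y K by (simp only: ennreal_mult[symmetric] indicator_simps mult_1_right
              mult_nonneg_nonneg powr_ge_zero less_imp_le)
      qed simp
    qed
    also have "\<dots> = ennreal (\<alpha> * Y * K) * (\<integral>\<^sup>+ s. ennreal ((t - s) powr (\<kappa> - 1) * s powr - \<alpha>) * indicator {0<..<t} s \<partial>lborel)"
      by (rule nn_integral_cmult) measurable
    also have "\<dots> \<le> ennreal (\<alpha> * Y * K) * ennreal (2 * (1 / (1 - \<alpha>) + 1 / \<kappa>) * t powr (\<kappa> - \<alpha>))"
      using \<alpha> \<kappa> t by (intro mult_left_mono nn_integral_Beta_kernel_le) auto
    also have "\<dots> = ennreal (\<alpha> * Y * K * (2 * (1 / (1 - \<alpha>) + 1 / \<kappa>) * t powr (\<kappa> - \<alpha>)))"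
      using \<alpha> Y K \<kappa> by (intro ennreal_mult[symmetric]) auto
    also have "\<dots> \<le> ennreal (Y * K * ?T * t powr - (\<alpha> / p))"
    proof (rule ennreal_leI)
      have e: "\<kappa> - \<alpha> = - (\<alpha> / p)" by (simp add: \<kappa>_def algebra_simps)
      \<comment> \<open>Since \<alpha> \<ge> 1/2 the pole 1/\<kappa> stays bounded; it is absorbed
        into the other one through 1 \<le> 1/(1 - \<alpha>).\<close>
      have "1 / \<kappa> \<le> 1 / ((1/2) * (1 - 1 / p))"
        unfolding \<kappa>_def using \<alpha> p by (intro divide_left_mono mult_right_mono mult_pos_pos) auto
      also have "\<dots> = 2 * p / (p - 1)" using p by (simp add: field_simps)
      also have "\<dots> \<le> (2 * p / (p - 1)) / (1 - \<alpha>)"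
        using \<alpha> p by (simp add: le_divide_eq mult_left_le)
      finally have "2 * (1 / (1 - \<alpha>) + 1 / \<kappa>) \<le> ?T" by (simp add: add_divide_distrib)
      then have T: "2 * (1 / (1 - \<alpha>) + 1 / \<kappa>) * t powr (\<kappa> - \<alpha>) \<le> ?T * t powr - (\<alpha> / p)"
        unfolding e by (intro mult_right_mono) auto
      have YK: "\<alpha> * Y * K \<le> Y * K" using \<alpha> Y K by (simp add: mult.assoc mult_left_le_one_le)
      have "(\<alpha> * Y * K) * (2 * (1 / (1 - \<alpha>) + 1 / \<kappa>) * t powr (\<kappa> - \<alpha>)) \<le> (Y * K) * (?T * t powr - (\<alpha> / p))"
        by (rule mult_mono[OF YK T]) (use \<alpha> \<kappa> Y K in auto)
      then show "\<alpha> * Y * K * (2 * (1 / (1 - \<alpha>) + 1 / \<kappa>) * t powr (\<kappa> - \<alpha>)) \<le> Y * K * ?T * t powr - (\<alpha> / p)"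
        by (simp only: mult.assoc)
    qed
    finally show "(\<integral>\<^sup>+ s. ennreal (?k s) \<partial>lborel) \<le> ennreal (Y * K * ?T * t powr - (\<alpha> / p))" .
  qed
  moreover have "duhamel w \<alpha> p U t x = (\<integral>\<^sup>+ s. ?f s x \<partial>lborel)" for x
  proof -
    have "(\<integral>\<^sup>+ s. ?f s x \<partial>lborel) = (\<integral>\<^sup>+ s. ennreal \<alpha> * (ennreal ((t - s) powr (\<alpha> - 1)) * duhamel_inner w \<alpha> p U (t - s) s x * indicator {0<..<t} s) \<partial>lborel)"
      using \<alpha> by (intro nn_integral_cong) (simp add: indicator_def ennreal_mult mult_ac)
    also have "\<dots> = duhamel w \<alpha> p U t x"
      unfolding duhamel_def subordination_density_eq_duhamel_inner[OF U] by (rule nn_integral_cmult) measurable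
    finally show ?thesis by simp
  qed
  ultimately show ?thesis by simp
qed

section \<open>Global existence for small mass\<close>

text \<open>\<open>M\<close> bounds t^(\<alpha>/p) times the L^p norm of every iterate. The two
  smallness conditions make the linear and the Duhamel part at most M/4 each, and 2^p * 2 (M/4)^p =
  2 (M/2)^p \<le> M^p closes the induction.\<close>

lemma global_solution_exists:
  fixes \<mu> :: "'a::euclidean_space measure"
  defines "p \<equiv> 1 + 2 / real DIM('a)"
  assumes h: "mittag_leffler_density \<alpha> h" and \<alpha>: "1/2 \<le> \<alpha>" "\<alpha> < 1"
    and K1: "0 < K1" "(\<integral>\<^sup>+ \<theta>\<in>{0<..}. ennreal (h \<theta>) * ennreal (\<theta> powr - (1 / p)) \<partial>lborel) \<le> ennreal K1"
    and K2: "0 < K2" "(\<integral>\<^sup>+ \<theta>\<in>{0<..}. ennreal (\<theta> * h \<theta>) * ennreal (\<theta> powr - (1 / p)) \<partial>lborel) \<le> ennreal K2"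
    and \<mu>: "sets \<mu> = sets borel" "emeasure \<mu> UNIV \<le> ennreal m" and m: "0 < m"
    and M: "0 < M" "4 * (m * K1) \<le> M" "4 * (M powr p * K2 * (2 * (1 + 2 * p / (p - 1)) / (1 - \<alpha>))) \<le> M"
  shows "\<exists>u. is_solution h \<alpha> p \<infinity> \<mu> u"
proof -
  let ?w = "\<lambda>\<theta>. \<theta> * h \<theta>"
  let ?T = "2 * (1 + 2 * p / (p - 1)) / (1 - \<alpha>)"
  have p: "1 < p" by (simp add: p_def)
  have hpos: "0 < h \<theta>" if "0 < \<theta>" for \<theta>
    using h that unfolding mittag_leffler_density_def by blast
  note hm[measurable] = mittag_leffler_density_measurable[OF h]
  have wm[measurable]: "(\<lambda>\<theta>. indicator {0<..} \<theta> * ?w \<theta>) \<in> borel_measurable lborel"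
  proof -
    have "(\<lambda>\<theta>. \<theta> * (indicator {0<..} \<theta> * h \<theta>)) \<in> borel_measurable lborel" by measurable
    then show ?thesis by (simp add: mult_ac)
  qed
  have space: "space \<mu> = UNIV" using sets_eq_imp_space_eq[OF \<mu>(1)] by simp
  have "emeasure \<mu> UNIV \<noteq> top" using \<mu>(2) by (auto simp: top_unique)
  then have "finite_measure \<mu>" by (intro finite_measureI) (simp add: space)
  then interpret finite_measure \<mu> .
  have sf: "sigma_finite_measure \<mu>" by unfold_locales
  note [measurable] = borel_measurable_subordination[OF sf \<mu>(1) hm]
  define F where "F V t x = subordination h \<alpha> t \<mu> x + duhamel ?w \<alpha> p V t x"
    for V :: "real \<Rightarrow> 'a \<Rightarrow> ennreal" and t x
  define U where "U n = (F ^^ n) (\<lambda>_ _. 0)" for n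
  have U0: "U 0 t x = 0" and USuc: "U (Suc n) t x = F (U n) t x" for n t x
    by (simp_all add: U_def)
  have Fm: "(\<lambda>(t, x). F V t x) \<in> borel_measurable (borel \<Otimes>\<^sub>M borel)"
    if V: "(\<lambda>(t, x). V t x) \<in> borel_measurable (borel \<Otimes>\<^sub>M borel)" for V
  proof -
    have [measurable]: "(\<lambda>z. duhamel ?w \<alpha> p V (fst z) (snd z)) \<in> borel_measurable (borel \<Otimes>\<^sub>M borel)"
      using borel_measurable_duhamel[OF V wm] by (simp add: case_prod_unfold)
    show ?thesis unfolding F_def case_prod_unfold by measurable
  qed
  have Um: "(\<lambda>(t, x). U n t x) \<in> borel_measurable (borel \<Otimes>\<^sub>M borel)" for n
  proof (induction n)
    case (Suc n)
    show ?case unfolding USuc by (rule Fm[OF Suc])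
  qed (simp add: U0)
  have step: "U n t x \<le> U (Suc n) t x" for n t x
  proof (induction n arbitrary: t x)
    case (Suc n)
    have "F (U n) t x \<le> F (U (Suc n)) t x"
      unfolding F_def using p by (intro add_left_mono duhamel_mono Um Suc) auto
    then show ?case by (simp only: USuc)
  qed (simp add: U0)
  have inc: "incseq (\<lambda>n. U n t x)" for t x by (rule incseq_SucI) (rule step)
  have bound: "(\<integral>\<^sup>+ x. epowr (U n t x) p \<partial>lborel) \<le> ennreal (M powr p * t powr - \<alpha>)" if t: "0 < t" for n t
    using t
  proof (induction n arbitrary: t)
    case 0
    then show ?case by (simp add: U0)
  next
    case (Suc n)
    let ?f = "\<lambda>x. subordination h \<alpha> t \<mu> x" and ?g = "\<lambda>x. duhamel ?w \<alpha> p (U n) t x"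
    have [measurable]: "?g \<in> borel_measurable borel"
      by (rule measurable_section[OF borel_measurable_duhamel[OF Um wm]])
    have small: "(c * t powr - (\<alpha> / p)) powr p \<le> (M / 4) powr p * t powr - \<alpha>" if "0 \<le> c" "4 * c \<le> M" for c
    proof -
      have "(t powr - (\<alpha> / p)) powr p = t powr - \<alpha>" using p unfolding powr_powr by simp
      then have "(c * t powr - (\<alpha> / p)) powr p = c powr p * t powr - \<alpha>" using that by (simp add: powr_mult)
      moreover have "c powr p \<le> (M / 4) powr p" using that p by (intro powr_mono2) auto
      ultimately show ?thesis by (simp add: mult_right_mono)
    qed
    have f: "(\<integral>\<^sup>+ x. epowr (?f x) p \<partial>lborel) \<le> ennreal ((M / 4) powr p * t powr - \<alpha>)"
    proof -
      have "(\<integral>\<^sup>+ x. epowr (?f x) p \<partial>lborel) \<le> ennreal ((m * K1 * t powr - (\<alpha> / p)) powr p)"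
        unfolding p_def using hpos Suc.prems K1 unfolding p_def
        by (intro subordination_Lp_bound \<mu> m hm) (auto simp: less_imp_le)
      also have "\<dots> \<le> ennreal ((M / 4) powr p * t powr - \<alpha>)"
        using M m K1 by (intro ennreal_leI small) auto
      finally show ?thesis .
    qed
    have g: "(\<integral>\<^sup>+ x. epowr (?g x) p \<partial>lborel) \<le> ennreal ((M / 4) powr p * t powr - \<alpha>)"
    proof -
      have "(\<integral>\<^sup>+ x. epowr (?g x) p \<partial>lborel) \<le> ennreal ((M powr p * K2 * ?T * t powr - (\<alpha> / p)) powr p)"
        unfolding p_def using hpos Suc.prems K2 M(1) Suc.IH unfolding p_def
        by (intro duhamel_Lp_bound Um wm \<alpha>) (auto simp: less_imp_le)
      also have "\<dots> \<le> ennreal ((M / 4) powr p * t powr - \<alpha>)"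
        using M K2 p \<alpha> by (intro ennreal_leI small) auto
      finally show ?thesis .
    qed
    have "(\<integral>\<^sup>+ x. epowr (U (Suc n) t x) p \<partial>lborel) \<le>
       (\<integral>\<^sup>+ x. ennreal (2 powr p) * (epowr (?f x) p + epowr (?g x) p) \<partial>lborel)"
      unfolding USuc F_def using p by (intro nn_integral_mono epowr_add_le) auto
    also have "\<dots> = ennreal (2 powr p) * ((\<integral>\<^sup>+ x. epowr (?f x) p \<partial>lborel) + (\<integral>\<^sup>+ x. epowr (?g x) p \<partial>lborel))"
      by (simp add: nn_integral_cmult nn_integral_add)
    also have "\<dots> \<le> ennreal (2 powr p) * (ennreal ((M / 4) powr p * t powr - \<alpha>) + ennreal ((M / 4) powr p * t powr - \<alpha>))"
      by (intro mult_left_mono add_mono f g) auto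
    also have "\<dots> = ennreal (2 powr p * (2 * ((M / 4) powr p * t powr - \<alpha>)))"
      by (simp add: ennreal_mult[symmetric] ennreal_plus[symmetric] del: ennreal_plus)
    also have "\<dots> \<le> ennreal (M powr p * t powr - \<alpha>)"
    proof (rule ennreal_leI)
      have "2 powr p * (2 * (M / 4) powr p) = 2 * ((2 * (M / 4)) powr p)"
        using M by (subst powr_mult) auto
      also have "2 * (M / 4) = M * (1 / 2)" by simp
      also have "(M * (1 / 2)) powr p = M powr p * (1 / 2) powr p" using M by (subst powr_mult) auto
      also have "(1 / 2) powr p \<le> (1 / 2 :: real) powr 1" using p by (intro powr_mono') auto
      finally have "2 powr p * (2 * (M / 4) powr p) \<le> M powr p" using M by simp
      then have "2 powr p * (2 * (M / 4) powr p) * t powr - \<alpha> \<le> M powr p * t powr - \<alpha>" by (intro mult_right_mono) auto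
      then show "2 powr p * (2 * ((M / 4) powr p * t powr - \<alpha>)) \<le> M powr p * t powr - \<alpha>" by (simp only: mult.assoc)
    qed
    finally show ?case .
  qed
  define V where "V t x = (SUP n. U n t x)" for t x
  have Vm: "(\<lambda>(t, x). V t x) \<in> borel_measurable (borel \<Otimes>\<^sub>M borel)"
  proof -
    have [measurable]: "case_prod (U n) \<in> borel_measurable (borel \<Otimes>\<^sub>M borel)" for n using Um[of n] by simp
    show ?thesis unfolding V_def by measurable
  qed
  have [measurable]: "(\<lambda>z. V (fst z) (snd z)) \<in> borel_measurable (borel \<Otimes>\<^sub>M borel)"
    using Vm by (simp add: case_prod_unfold)
  have Vs[measurable]: "V s \<in> borel_measurable borel" for s by (rule measurable_section[OF Vm])
  have V: "V t x = subordination h \<alpha> t \<mu> x + duhamel ?w \<alpha> p V t x" for t x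
  proof -
    have "V t x = (SUP n. U (Suc n) t x)"
    proof (rule antisym)
      show "V t x \<le> (SUP n. U (Suc n) t x)" unfolding V_def by (intro SUP_mono) (use step in auto)
      show "(SUP n. U (Suc n) t x) \<le> V t x" unfolding V_def by (intro SUP_mono) auto
    qed
    also have "\<dots> = subordination h \<alpha> t \<mu> x + (SUP n. duhamel ?w \<alpha> p (U n) t x)"
      unfolding USuc F_def by (rule ennreal_SUP_add_right[symmetric]) simp
    also have "(SUP n. duhamel ?w \<alpha> p (U n) t x) = duhamel ?w \<alpha> p V t x"
      unfolding V_def[abs_def] using p by (intro duhamel_SUP[symmetric] Um wm inc) auto
    finally show ?thesis .
  qed
  \<comment> \<open>The L^p bound passes to the supremum at every t > 0, so finiteness holds on each
    slice and not merely on almost every one; \<open>dens\<close> relies on this.\<close>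
  have fin: "AE x in lborel. V t x \<noteq> top" if t: "0 < t" for t
  proof -
    have Us[measurable]: "U n t \<in> borel_measurable borel" for n by (rule measurable_section[OF Um])
    have "(\<integral>\<^sup>+ x. epowr (V t x) p \<partial>lborel) = (\<integral>\<^sup>+ x. (SUP n. epowr (U n t x) p) \<partial>lborel)"
      unfolding V_def using p by (subst epowr_SUP) auto
    also have "\<dots> = (SUP n. (\<integral>\<^sup>+ x. epowr (U n t x) p \<partial>lborel))"
      using inc p by (intro nn_integral_monotone_convergence_SUP)
        (auto simp: incseq_def le_fun_def intro!: epowr_mono)
    also have "\<dots> \<le> ennreal (M powr p * t powr - \<alpha>)" by (intro SUP_least bound t)
    finally have "(\<integral>\<^sup>+ x. epowr (V t x) p \<partial>lborel) \<noteq> top" by (auto simp: top_unique)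
    then have "AE x in lborel. epowr (V t x) p \<noteq> top"
      using nn_integral_PInf_AE[of "\<lambda>x. epowr (V t x) p" lborel] by (simp add: infinity_ennreal_def)
    then show ?thesis by simp
  qed
  define u where "u t x = enn2real (V t x)" for t x
  \<comment> \<open>Replacing \<open>V\<close> by its real part alters each slice on a null set
    only, so the measures agree, and the equation holds at every point where \<open>V\<close> is
    finite.\<close>
  have dens: "density lebesgue (\<lambda>y. ennreal (u s y powr p)) = density lebesgue (\<lambda>y. epowr (V s y) p)" if s: "0 < s" for s
  proof (rule density_cong)
    show "(\<lambda>y. ennreal (u s y powr p)) \<in> borel_measurable lebesgue"
      unfolding u_def by (rule measurable_completion) measurable
    show "(\<lambda>y. epowr (V s y) p) \<in> borel_measurable lebesgue"
      by (rule measurable_completion) measurable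
    show "AE y in lebesgue. ennreal (u s y powr p) = epowr (V s y) p"
      by (rule AE_completion) (use fin[OF s] in \<open>auto elim!: eventually_mono simp: u_def epowr_def\<close>)
  qed
  have eq: "ennreal (u t x) = P_op h \<alpha> t \<mu> x +
          ennreal \<alpha> * (\<integral>\<^sup>+ s\<in>{0<..<t}. ennreal ((t - s) powr (\<alpha> - 1)) *
            S_op h \<alpha> (t - s) (density lebesgue (\<lambda>y. ennreal (u s y powr p))) x \<partial>lborel)"
    if "V t x \<noteq> top" for t x
  proof -
    have "(\<integral>\<^sup>+ s\<in>{0<..<t}. ennreal ((t - s) powr (\<alpha> - 1)) *
            S_op h \<alpha> (t - s) (density lebesgue (\<lambda>y. ennreal (u s y powr p))) x \<partial>lborel) =
       (\<integral>\<^sup>+ s\<in>{0<..<t}. ennreal ((t - s) powr (\<alpha> - 1)) *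
            subordination ?w \<alpha> (t - s) (density lebesgue (\<lambda>y. epowr (V s y) p)) x \<partial>lborel)"
      by (intro nn_integral_cong) (simp add: indicator_def S_op_eq_subordination dens)
    then have "P_op h \<alpha> t \<mu> x + ennreal \<alpha> * (\<integral>\<^sup>+ s\<in>{0<..<t}. ennreal ((t - s) powr (\<alpha> - 1)) *
            S_op h \<alpha> (t - s) (density lebesgue (\<lambda>y. ennreal (u s y powr p))) x \<partial>lborel) = V t x"
      unfolding V[of t x] P_op_eq_subordination duhamel_def by simp
    then show ?thesis using that by (simp add: u_def less_top)
  qed
  have "is_solution h \<alpha> p \<infinity> \<mu> u"
    unfolding is_solution_def
  proof (intro conjI)
    show "\<forall>t x. 0 < t \<and> ereal t < \<infinity> \<longrightarrow> 0 \<le> u t x" by (simp add: u_def)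
    have S: "{t. 0 < t \<and> ereal t < \<infinity>} = {0<..}" by auto
    have um: "(\<lambda>(t, x). u t x) \<in> borel_measurable (lborel :: (real \<times> 'a) measure)"
      unfolding u_def case_prod_unfold by (simp add: borel_prod[symmetric])
    have set: "{0<..} \<times> UNIV \<in> sets (lebesgue :: (real \<times> 'a) measure)"
    proof -
      have "{0<..} \<times> UNIV \<in> sets (borel :: (real \<times> 'a) measure)"
        by (intro borel_open open_Times) auto
      then show ?thesis by (simp add: sets_completionI_sets)
    qed
    show "(\<lambda>(t, x). u t x) \<in> borel_measurable (lebesgue_on ({t. 0 < t \<and> ereal t < \<infinity>} \<times> UNIV))"
      by (intro measurable_restrict_space1 measurable_completion um)
    have "AE z in (lborel \<Otimes>\<^sub>M lborel). 0 < fst z \<longrightarrow> V (fst z) (snd z) \<noteq> top"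
    proof (rule lborel_pair.AE_pair_measure)
      show "{z \<in> space (lborel \<Otimes>\<^sub>M lborel). 0 < fst z \<longrightarrow> V (fst z) (snd z) \<noteq> top} \<in> sets (lborel \<Otimes>\<^sub>M lborel)"
        by measurable
      show "AE t in lborel. AE x in lborel. 0 < fst (t, x) \<longrightarrow> V (fst (t, x)) (snd (t, x)) \<noteq> top"
        proof (rule AE_I2)
        fix t :: real
        show "AE x in lborel. 0 < fst (t, x) \<longrightarrow> V (fst (t, x)) (snd (t, x)) \<noteq> top"
          using fin[of t] by (cases "0 < t") (auto elim: eventually_mono)
      qed
    qed
    then have "AE z in (lebesgue :: (real \<times> 'a) measure). 0 < fst z \<longrightarrow> V (fst z) (snd z) \<noteq> top"
      unfolding lborel_prod by (rule AE_completion)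
    then show "AE (t, x) in lebesgue_on ({t. 0 < t \<and> ereal t < \<infinity>} \<times> UNIV).
        ennreal (u t x) = P_op h \<alpha> t \<mu> x +
          ennreal \<alpha> * (\<integral>\<^sup>+ s\<in>{0<..<t}. ennreal ((t - s) powr (\<alpha> - 1)) *
            S_op h \<alpha> (t - s) (density lebesgue (\<lambda>y. ennreal (u s y powr p))) x \<partial>lborel)"
      unfolding S using set
      by (subst AE_restrict_space_iff) (auto elim!: eventually_mono intro!: eq)
  qed
  then show ?thesis by blast
qed

section \<open>Parabolic lower bounds\<close>

text \<open>In the stated range |z|^2 / (4 D \<theta>) \<le> 4D / (2D) = 2, and the prefactor is
  smallest at \<theta> = 2.\<close>

lemma heat_kernel_lower_bound:
  fixes z :: "'a::euclidean_space"
  assumes D: "0 < D" and \<theta>: "1/2 \<le> \<theta>" "\<theta> \<le> 2" and z: "norm z \<le> 2 * sqrt D"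
  shows "(8 * pi * D) powr - (real DIM('a) / 2) * exp (-2) \<le> heat_kernel (D * \<theta>) z"
  unfolding heat_kernel_def
proof (rule mult_mono)
  have "4 * pi * (D * \<theta>) \<le> 8 * pi * D" using D \<theta> by simp
  then show "(8 * pi * D) powr - (real DIM('a) / 2) \<le> (4 * pi * (D * \<theta>)) powr - (real DIM('a) / 2)"
    using D \<theta> by (intro powr_mono2') auto
  have "(norm z)\<^sup>2 \<le> (2 * sqrt D)\<^sup>2" using z by (intro power_mono) auto
  also have "\<dots> = 4 * D" using D by (simp add: power_mult_distrib)
  also have "\<dots> \<le> 4 * D * (2 * \<theta>)" using D \<theta> by simp
  finally have "(norm z)\<^sup>2 / (4 * (D * \<theta>)) \<le> 2" using D \<theta> by (simp add: divide_le_eq mult_ac)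
  then show "exp (-2) \<le> exp (- ((norm z)\<^sup>2 / (4 * (D * \<theta>))))" by simp
qed auto

text \<open>The lower bound of the kernel times the volume of a ball of half radius, with all powers
  of D removed by scaling; it depends on the dimension alone.\<close>

definition ball_constant :: "'a::euclidean_space itself \<Rightarrow> real" where
  "ball_constant _ = (8 * pi) powr - (real DIM('a) / 2) * exp (-2) * unit_ball_vol (real DIM('a)) * (1/2) ^ DIM('a)"

lemma ball_constant_pos: "0 < ball_constant TYPE('a::euclidean_space)"
  by (simp add: ball_constant_def)

text \<open>A point \<open>x\<close> within \<open>\<surd>D\<close> of the ball of radius \<open>\<rho>\<close> lies within \<open>2\<surd>D\<close> of every point of a ball of
  radius \<open>min \<rho> (\<surd>D) / 2\<close> contained in it.\<close>

lemma heat_ball_lower_bound: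
  fixes x :: "'a::euclidean_space"
  assumes D: "0 < D" and \<rho>: "0 < \<rho>" "\<rho> \<le> R" and DR: "sqrt D \<le> R"
    and \<theta>: "1/2 \<le> \<theta>" "\<theta> \<le> 2" and x: "norm x \<le> \<rho> + sqrt D"
  shows "ennreal (ball_constant TYPE('a) * (\<rho> / R) ^ DIM('a)) \<le>
    (\<integral>\<^sup>+ y\<in>cball 0 \<rho>. ennreal (heat_kernel (D * \<theta>) (x - y)) \<partial>lborel)"
proof -
  define r where "r = min \<rho> (sqrt D)"
  have r: "0 < r" "r \<le> \<rho>" "r \<le> sqrt D" using D \<rho> by (auto simp: r_def)
  obtain z where z: "norm z \<le> \<rho> - r / 2" "norm (x - z) \<le> sqrt D + r / 2"
  proof (cases "norm x \<le> \<rho> - r / 2")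
    case True
    then show ?thesis using that[of x] r D by auto
  next
    case False
    \<comment> \<open>When \<open>x\<close> is too far out, the centre is its radial projection to
      the sphere of radius \<open>\<rho> - r / 2\<close>.\<close>
    define c where "c = (\<rho> - r / 2) / norm x"
    have nx: "0 < norm x" using False r by linarith
    have c: "0 \<le> c" "c \<le> 1" using False r nx by (auto simp: c_def)
    have cn: "c * norm x = \<rho> - r / 2" using nx by (simp add: c_def)
    show ?thesis
    proof (rule that)
      show "norm (c *\<^sub>R x) \<le> \<rho> - r / 2" using c cn by simp
      have "x - c *\<^sub>R x = (1 - c) *\<^sub>R x" by (simp add: algebra_simps)
      then have "norm (x - c *\<^sub>R x) = (1 - c) * norm x" using c by simp
      also have "\<dots> = norm x - (\<rho> - r / 2)" using cn by (simp add: algebra_simps)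
      finally show "norm (x - c *\<^sub>R x) \<le> sqrt D + r / 2" using x by linarith
    qed
  qed
  let ?g = "(8 * pi * D) powr - (real DIM('a) / 2) * exp (-2)"
  have "ennreal (ball_constant TYPE('a) * (\<rho> / R) ^ DIM('a)) \<le>
     ennreal (?g * (unit_ball_vol (real DIM('a)) * (r / 2) ^ DIM('a)))"
  proof (rule ennreal_leI)
    \<comment> \<open>The quotient on the right is min(\<rho> / sqrt D, 1), and R exceeds both
      \<rho> and sqrt D.\<close>
    have "\<rho> / R \<le> r / sqrt D"
    proof (cases "\<rho> \<le> sqrt D")
      case True
      then have "r = \<rho>" by (simp add: r_def)
      then show ?thesis using D DR \<rho> by (auto intro!: divide_left_mono)
    next
      case False
      then have "r / sqrt D = 1" using D by (simp add: r_def)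
      moreover have "\<rho> / R \<le> 1" using \<rho> by simp
      ultimately show ?thesis by linarith
    qed
    then have 1: "(\<rho> / R) ^ DIM('a) \<le> (r / sqrt D) ^ DIM('a)"
      using \<rho> by (intro power_mono) auto
    have "D powr - (real DIM('a) / 2) = 1 / sqrt D ^ DIM('a)"
      using D by (simp add: powr_minus_divide powr_half_sqrt[symmetric] powr_realpow[symmetric] powr_powr)
    then have 2: "?g * (unit_ball_vol (real DIM('a)) * (r / 2) ^ DIM('a)) =
        ball_constant TYPE('a) * (r / sqrt D) ^ DIM('a)"
      using D by (simp add: ball_constant_def powr_mult power_divide mult_ac)
    show "ball_constant TYPE('a) * (\<rho> / R) ^ DIM('a) \<le> ?g * (unit_ball_vol (real DIM('a)) * (r / 2) ^ DIM('a))"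
      unfolding 2 using 1 ball_constant_pos[where 'a='a] by (intro mult_left_mono) auto
  qed
  also have "\<dots> = ennreal ?g * emeasure lborel (cball z (r / 2))"
    using r by (simp add: emeasure_cball ennreal_mult)
  also have "\<dots> = (\<integral>\<^sup>+ y. ennreal ?g * indicator (cball z (r / 2)) y \<partial>lborel)"
    by (rule nn_integral_cmult_indicator[symmetric]) simp
  also have "\<dots> \<le> (\<integral>\<^sup>+ y\<in>cball 0 \<rho>. ennreal (heat_kernel (D * \<theta>) (x - y)) \<partial>lborel)"
  proof (intro nn_integral_mono)
    fix y :: 'a
    show "ennreal ?g * indicator (cball z (r / 2)) y \<le> ennreal (heat_kernel (D * \<theta>) (x - y)) * indicator (cball 0 \<rho>) y"
    proof (cases "y \<in> cball z (r / 2)")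
      case True
      then have zy: "norm (z - y) \<le> r / 2" by (simp add: dist_norm)
      have "norm y \<le> norm z + norm (z - y)" by (metis norm_triangle_sub norm_minus_commute)
      then have "y \<in> cball 0 \<rho>" using z zy by simp
      moreover have "norm (x - y) \<le> 2 * sqrt D"
      proof -
        have "norm (x - y) \<le> norm (x - z) + norm (z - y)"
          using norm_triangle_ineq[of "x - z" "z - y"] by simp
        then show ?thesis using z zy r by linarith
      qed
      ultimately show ?thesis
        using True heat_kernel_lower_bound[OF D \<theta>] by (simp add: ennreal_leI)
    qed simp
  qed
  finally show ?thesis .
qed

text \<open>After division by x + y the two parts lie in (0, 1] and sum to 1, and u \<le> u^a
  there.\<close>

lemma powr_subadditive:
  fixes a x y :: real
  assumes a: "0 < a" "a \<le> 1" and x: "0 < x" and y: "0 < y"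
  shows "(x + y) powr a \<le> x powr a + y powr a"
proof -
  have le: "u \<le> u powr a" if "0 < u" "u \<le> 1" for u :: real
    using powr_mono'[OF a(2), of u] that by simp
  define u where "u = x / (x + y)"
  define v where "v = y / (x + y)"
  have "1 = u + v" using x y by (simp add: u_def v_def flip: add_divide_distrib)
  also have "\<dots> \<le> u powr a + v powr a" using x y by (intro add_mono le) (auto simp: u_def v_def)
  finally have "(x + y) powr a * 1 \<le> (x + y) powr a * (u powr a + v powr a)"
    by (intro mult_left_mono) auto
  also have "\<dots> = ((x + y) * u) powr a + ((x + y) * v) powr a"
  proof -
    have "0 \<le> u" "0 \<le> v" using x y by (simp_all add: u_def v_def)
    then show ?thesis using x y by (simp add: powr_mult distrib_left)
  qed
  also have "(x + y) * u = x" using x y by (simp add: u_def)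
  also have "(x + y) * v = y" using x y by (simp add: v_def)
  finally show ?thesis by simp
qed

text \<open>Subadditivity of r^(\<alpha>/2) places a point of the paraboloid at time t within the
  diffusion length (t - s)^(\<alpha>/2) of the slice at time s, as the estimate for balls requires.
  The radius R is t^(\<alpha>/2).\<close>

lemma parabolic_ball_lower_bound:
  fixes x :: "'a::euclidean_space"
  assumes \<alpha>: "0 < \<alpha>" "\<alpha> < 1" and s: "0 < s" "s < t" and x: "norm x \<le> t powr (\<alpha> / 2)"
    and \<theta>: "1/2 \<le> \<theta>" "\<theta> \<le> 2"
  shows "ennreal (ball_constant TYPE('a) * (s / t) powr (\<alpha> * real DIM('a) / 2)) \<le>
    (\<integral>\<^sup>+ y\<in>cball 0 (s powr (\<alpha> / 2)). ennreal (heat_kernel ((t - s) powr \<alpha> * \<theta>) (x - y)) \<partial>lborel)"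
proof -
  have sq: "sqrt ((t - s) powr \<alpha>) = (t - s) powr (\<alpha> / 2)"
    using s by (simp add: powr_half_sqrt[symmetric] powr_powr)
  have "(s / t) powr (\<alpha> * real DIM('a) / 2) = (s powr (\<alpha> / 2) / t powr (\<alpha> / 2)) ^ DIM('a)"
    using s by (simp add: powr_divide powr_realpow[symmetric] powr_powr)
  moreover have "t powr (\<alpha> / 2) \<le> s powr (\<alpha> / 2) + (t - s) powr (\<alpha> / 2)"
    using powr_subadditive[of "\<alpha> / 2" s "t - s"] \<alpha> s by simp
  moreover have "s powr (\<alpha> / 2) \<le> t powr (\<alpha> / 2)" "(t - s) powr (\<alpha> / 2) \<le> t powr (\<alpha> / 2)"
    using \<alpha> s by (auto intro!: powr_mono2)
  ultimately show ?thesis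
    using heat_ball_lower_bound[of "(t - s) powr \<alpha>" "s powr (\<alpha> / 2)" "t powr (\<alpha> / 2)" \<theta> x] s \<theta> x
    by (simp add: sq)
qed

text \<open>Since \<alpha> < 1, (t - s)^(\<alpha>-1) \<ge> t^(\<alpha>-1); what remains is
  integrated exactly and keeps the full factor 1/(1 - \<alpha>).\<close>

lemma nn_integral_powr_mult_powr_ge:
  fixes \<alpha> \<tau> t :: real
  assumes \<alpha>: "0 < \<alpha>" "\<alpha> < 1" and \<tau>: "0 < \<tau>" "\<tau> < t"
  shows "ennreal ((1 - (\<tau> / t) powr (1 - \<alpha>)) / (1 - \<alpha>)) \<le>
    (\<integral>\<^sup>+ s\<in>{\<tau><..<t}. ennreal ((t - s) powr (\<alpha> - 1) * s powr - \<alpha>) \<partial>lborel)"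
proof -
  have "(\<integral>\<^sup>+ s. ennreal (t powr (\<alpha> - 1) * s powr - \<alpha>) * indicator {\<tau>..t} s \<partial>lborel) =
     ennreal (t powr (\<alpha> - 1) * (t powr (1 - \<alpha>) / (1 - \<alpha>)) - t powr (\<alpha> - 1) * (\<tau> powr (1 - \<alpha>) / (1 - \<alpha>)))"
  proof (rule nn_integral_FTC_Icc)
    fix s assume s: "s \<in> {\<tau>..t}"
    then have "((\<lambda>s. t powr (\<alpha> - 1) * (s powr (1 - \<alpha>) / (1 - \<alpha>))) has_field_derivative
        t powr (\<alpha> - 1) * (((1 - \<alpha>) * s powr (1 - \<alpha> - 1)) / (1 - \<alpha>))) (at s)"
      using \<tau> by (intro DERIV_cmult DERIV_cdivide has_real_derivative_powr) auto
    then show "((\<lambda>s. t powr (\<alpha> - 1) * (s powr (1 - \<alpha>) / (1 - \<alpha>))) has_field_derivative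
        t powr (\<alpha> - 1) * s powr - \<alpha>) (at s)"
      using \<alpha> by simp
  qed (use \<tau> in auto)
  moreover have "t powr (\<alpha> - 1) * (t powr (1 - \<alpha>) / (1 - \<alpha>)) - t powr (\<alpha> - 1) * (\<tau> powr (1 - \<alpha>) / (1 - \<alpha>)) =
      (1 - (\<tau> / t) powr (1 - \<alpha>)) / (1 - \<alpha>)"
  proof -
    have "t powr (\<alpha> - 1) * t powr (1 - \<alpha>) = 1" using \<tau> by (simp flip: powr_add)
    moreover have "t powr (\<alpha> - 1) * \<tau> powr (1 - \<alpha>) = (\<tau> / t) powr (1 - \<alpha>)"
      using \<tau> powr_minus_divide[of t "1 - \<alpha>"] by (simp add: powr_divide)
    ultimately show ?thesis by (simp add: diff_divide_distrib)
  qed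
  moreover have "(\<integral>\<^sup>+ s. ennreal (t powr (\<alpha> - 1) * s powr - \<alpha>) * indicator {\<tau>..t} s \<partial>lborel) \<le>
    (\<integral>\<^sup>+ s\<in>{\<tau><..<t}. ennreal ((t - s) powr (\<alpha> - 1) * s powr - \<alpha>) \<partial>lborel)"
  proof (rule nn_integral_mono_AE)
    have "AE s in lborel. s \<noteq> \<tau>" "AE s in lborel. s \<noteq> t" by (rule AE_lborel_singleton)+
    then show "AE s in lborel. ennreal (t powr (\<alpha> - 1) * s powr - \<alpha>) * indicator {\<tau>..t} s
      \<le> ennreal ((t - s) powr (\<alpha> - 1) * s powr - \<alpha>) * indicator {\<tau><..<t} s"
    proof eventually_elim
      case (elim s)
      show ?case
      proof (cases "s \<in> {\<tau><..<t}")
        case True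
        then have "t powr (\<alpha> - 1) \<le> (t - s) powr (\<alpha> - 1)" using \<alpha> \<tau> by (intro powr_mono2') auto
        then show ?thesis using True by (auto intro!: ennreal_leI mult_right_mono)
      next
        case False
        then have "s \<notin> {\<tau>..t}" using elim by auto
        then show ?thesis by simp
      qed
    qed
  qed
  ultimately show ?thesis by simp
qed

section \<open>From solutions to almost everywhere lower bounds\<close>

text \<open>A solution is Lebesgue measurable and satisfies its equation almost everywhere, whereas
  Tonelli on the product calls for a Borel function. By Tonelli a modification on a space-time null
  set changes the slice measure only for s in a null set, which the time integral does not
  see.\<close>

lemma is_solution_borel_version:
  fixes u :: "real \<Rightarrow> 'a::euclidean_space \<Rightarrow> real"
  assumes "is_solution h \<alpha> p \<infinity> \<mu> u"
  obtains v where "(\<lambda>(t, x). v t x) \<in> borel_measurable (borel \<Otimes>\<^sub>M borel)" "\<And>t x. 0 \<le> v t x"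
    "AE z in lborel \<Otimes>\<^sub>M lborel. 0 < fst z \<longrightarrow> ennreal (v (fst z) (snd z)) =
       subordination h \<alpha> (fst z) \<mu> (snd z) +
       duhamel (\<lambda>\<theta>. \<theta> * h \<theta>) \<alpha> p (\<lambda>s y. ennreal (v s y)) (fst z) (snd z)"
proof -
  let ?S = "{0<..} \<times> UNIV :: (real \<times> 'a) set"
  have S: "{t. 0 < t \<and> ereal t < \<infinity>} \<times> UNIV = ?S" by auto
  have "?S \<in> sets borel" by (intro borel_open open_Times) auto
  then have Sm: "?S \<inter> space lebesgue \<in> sets lebesgue" by (simp add: sets_completionI_sets)
  have u0: "0 \<le> u t x" if "0 < t" for t x
    using assms that unfolding is_solution_def by simp
  have "(\<lambda>(t, x). u t x) \<in> borel_measurable (lebesgue_on ?S)"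
    using assms unfolding is_solution_def S by blast
  then have "(\<lambda>z. indicator ?S z *\<^sub>R (case z of (t, x) \<Rightarrow> u t x)) \<in> borel_measurable lebesgue"
    using Sm by (subst (asm) borel_measurable_restrict_space_iff) auto
  then obtain g where g: "g \<in> borel_measurable lborel"
    "AE z in lborel. indicator ?S z *\<^sub>R (case z of (t, x) \<Rightarrow> u t x) = g z"
    by (blast dest: completion_ex_borel_measurable_real)
  \<comment> \<open>The maximum makes \<open>v\<close> nonnegative everywhere, also off the set
    where it agrees with \<open>u\<close>.\<close>
  define v where "v t x = max 0 (g (t, x))" for t x
  have gm[measurable]: "g \<in> borel_measurable (borel \<Otimes>\<^sub>M borel)"
    using g(1) by (simp add: borel_prod)
  have vm: "(\<lambda>(t, x). v t x) \<in> borel_measurable (borel \<Otimes>\<^sub>M borel)"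
    unfolding v_def by measurable
  have v0: "0 \<le> v t x" for t x by (simp add: v_def)
  have uv: "AE z in lborel \<Otimes>\<^sub>M lborel. 0 < fst z \<longrightarrow> u (fst z) (snd z) = v (fst z) (snd z)"
    using g(2) unfolding lborel_prod
  proof eventually_elim
    case (elim z)
    show ?case
    proof
      assume z: "0 < fst z"
      show "u (fst z) (snd z) = v (fst z) (snd z)"
        using u0[OF z, of "snd z"] z elim by (cases z) (simp add: v_def)
    qed
  qed
  have uv2: "AE s in lborel. AE y in lborel. 0 < s \<longrightarrow> u s y = v s y"
    using lborel_pair.AE_pair[OF uv] by simp
  have dens: "density lebesgue (\<lambda>y. ennreal (u s y powr p)) = density lebesgue (\<lambda>y. epowr (ennreal (v s y)) p)"
    if "AE y in lborel. 0 < s \<longrightarrow> u s y = v s y" "0 < s" for s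
  proof -
    have "AE y in lebesgue. u s y = v s y"
      by (rule AE_completion) (use that in auto)
    then have "(\<integral>\<^sup>+ y. ennreal (u s y powr p) * indicator A y \<partial>lebesgue) =
       (\<integral>\<^sup>+ y. epowr (ennreal (v s y)) p * indicator A y \<partial>lebesgue)" for A
      by (intro nn_integral_cong_AE) (auto elim!: eventually_mono simp: v0)
    then show ?thesis unfolding density_def by simp
  qed
  have "AE z in lebesgue. z \<in> ?S \<longrightarrow> ennreal (u (fst z) (snd z)) = P_op h \<alpha> (fst z) \<mu> (snd z) +
          ennreal \<alpha> * (\<integral>\<^sup>+ s\<in>{0<..<fst z}. ennreal ((fst z - s) powr (\<alpha> - 1)) *
            S_op h \<alpha> (fst z - s) (density lebesgue (\<lambda>y. ennreal (u s y powr p))) (snd z) \<partial>lborel)"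
    using assms unfolding is_solution_def S case_prod_unfold AE_restrict_space_iff[OF Sm] by blast
  then have eq: "AE z in lborel \<Otimes>\<^sub>M lborel. z \<in> ?S \<longrightarrow> ennreal (u (fst z) (snd z)) = P_op h \<alpha> (fst z) \<mu> (snd z) +
          ennreal \<alpha> * (\<integral>\<^sup>+ s\<in>{0<..<fst z}. ennreal ((fst z - s) powr (\<alpha> - 1)) *
            S_op h \<alpha> (fst z - s) (density lebesgue (\<lambda>y. ennreal (u s y powr p))) (snd z) \<partial>lborel)"
    unfolding lborel_prod AE_completion_iff .
  have int: "(\<integral>\<^sup>+ s\<in>{0<..<t}. ennreal ((t - s) powr (\<alpha> - 1)) *
            S_op h \<alpha> (t - s) (density lebesgue (\<lambda>y. ennreal (u s y powr p))) x \<partial>lborel) =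
        (\<integral>\<^sup>+ s\<in>{0<..<t}. ennreal ((t - s) powr (\<alpha> - 1)) *
            subordination (\<lambda>\<theta>. \<theta> * h \<theta>) \<alpha> (t - s) (density lebesgue (\<lambda>y. epowr (ennreal (v s y)) p)) x \<partial>lborel)" for t x
    using uv2
    by (intro nn_integral_cong_AE)
       (auto elim!: eventually_mono simp: S_op_eq_subordination indicator_def dens)
  show ?thesis
  proof (rule that[OF vm v0])
    show "AE z in lborel \<Otimes>\<^sub>M lborel. 0 < fst z \<longrightarrow> ennreal (v (fst z) (snd z)) =
       subordination h \<alpha> (fst z) \<mu> (snd z) +
       duhamel (\<lambda>\<theta>. \<theta> * h \<theta>) \<alpha> p (\<lambda>s y. ennreal (v s y)) (fst z) (snd z)"
      using eq uv
    proof eventually_elim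
      case (elim z)
      then show ?case
        unfolding int P_op_eq_subordination duhamel_def by (cases z) auto
    qed
  qed
qed

text \<open>The weight t^(-\<alpha> N/2) is the size of the heat kernel at heat time t^\<alpha>
  within its diffusion length. The bound is required almost everywhere because only a representative
  of the solution is available.\<close>

definition parabolic_lower_bound :: "real \<Rightarrow> (real \<Rightarrow> 'a::euclidean_space \<Rightarrow> real) \<Rightarrow> real \<Rightarrow> real \<Rightarrow> bool" where
  "parabolic_lower_bound \<alpha> v a \<tau> \<longleftrightarrow> (AE z in lborel \<Otimes>\<^sub>M lborel.
     \<tau> \<le> fst z \<and> norm (snd z) \<le> fst z powr (\<alpha> / 2) \<longrightarrow>
     a * fst z powr - (\<alpha> * real DIM('a) / 2) \<le> v (fst z) (snd z))"

lemma parabolic_lower_bound_mono: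
  assumes "parabolic_lower_bound \<alpha> v a \<tau>" "a' \<le> a" "\<tau> \<le> \<tau>'"
  shows "parabolic_lower_bound \<alpha> v a' \<tau>'"
  using assms(1) unfolding parabolic_lower_bound_def
proof eventually_elim
  case (elim z)
  have "a' * fst z powr - (\<alpha> * real DIM('a) / 2) \<le> a * fst z powr - (\<alpha> * real DIM('a) / 2)"
    using assms(2) by (intro mult_right_mono) auto
  then show ?case using elim assms(3) by auto
qed

text \<open>Once t \<ge> R^(2/\<alpha>), the diffusion length t^(\<alpha>/2) exceeds R, so every
  point of the ball carrying the mass m lies within 2 t^(\<alpha>/2) of x. The factor 1/2 is the
  mass of \<open>h\<close> on [1/2, 2].\<close>

lemma parabolic_lower_bound_initial:
  fixes v :: "real \<Rightarrow> 'a::euclidean_space \<Rightarrow> real" and \<mu> :: "'a measure"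
  assumes \<alpha>: "0 < \<alpha>"
    and v: "\<And>t x. 0 \<le> v t x"
    and hm: "(\<lambda>\<theta>. indicator {0<..} \<theta> * h \<theta>) \<in> borel_measurable lborel"
    and hc: "ennreal (1/2) \<le> (\<integral>\<^sup>+ \<theta>\<in>{1/2..2}. ennreal (h \<theta>) \<partial>lborel)"
    and \<mu>: "sets \<mu> = sets borel" and R: "0 < R" and m: "0 \<le> m" "ennreal m \<le> emeasure \<mu> (cball 0 R)"
    and E: "AE z in lborel \<Otimes>\<^sub>M lborel. 0 < fst z \<longrightarrow>
      subordination h \<alpha> (fst z) \<mu> (snd z) \<le> ennreal (v (fst z) (snd z))"
  shows "parabolic_lower_bound \<alpha> v ((8 * pi) powr - (real DIM('a) / 2) * exp (-2) / 2 * m) (R powr (2 / \<alpha>))"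
  using E unfolding parabolic_lower_bound_def
proof (eventually_elim, intro impI)
  fix z :: "real \<times> 'a"
  assume E: "0 < fst z \<longrightarrow> subordination h \<alpha> (fst z) \<mu> (snd z) \<le> ennreal (v (fst z) (snd z))"
    and z: "R powr (2 / \<alpha>) \<le> fst z \<and> norm (snd z) \<le> fst z powr (\<alpha> / 2)"
  define t where "t = fst z"
  define x where "x = snd z"
  have tx: "R powr (2 / \<alpha>) \<le> t" "norm x \<le> t powr (\<alpha> / 2)" using z by (auto simp: t_def x_def)
  have t: "0 < t" using tx(1) R by (smt (verit) powr_gt_zero)
  have sq: "sqrt (t powr \<alpha>) = t powr (\<alpha> / 2)" using t by (simp add: powr_half_sqrt[symmetric] powr_powr)
  have Rt: "R \<le> t powr (\<alpha> / 2)"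
  proof -
    have "R = (R powr (2 / \<alpha>)) powr (\<alpha> / 2)" using R \<alpha> by (simp add: powr_powr)
    also have "\<dots> \<le> t powr (\<alpha> / 2)" using tx(1) \<alpha> by (intro powr_mono2) auto
    finally show ?thesis .
  qed
  let ?g = "(8 * pi * t powr \<alpha>) powr - (real DIM('a) / 2) * exp (-2)"
  have hs: "ennreal ?g * ennreal m \<le> heat_semigroup (t powr \<alpha> * \<theta>) \<mu> x" if \<theta>: "1/2 \<le> \<theta>" "\<theta> \<le> 2" for \<theta>
  proof -
    have "ennreal ?g * ennreal m \<le> ennreal ?g * emeasure \<mu> (cball 0 R)"
      by (intro mult_left_mono m) auto
    also have "\<dots> = (\<integral>\<^sup>+ y. ennreal ?g * indicator (cball 0 R) y \<partial>\<mu>)"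
      by (rule nn_integral_cmult_indicator[symmetric]) (simp add: \<mu>)
    also have "\<dots> \<le> (\<integral>\<^sup>+ y. ennreal (heat_kernel (t powr \<alpha> * \<theta>) (x - y)) \<partial>\<mu>)"
    proof (intro nn_integral_mono)
      fix y :: 'a
      show "ennreal ?g * indicator (cball 0 R) y \<le> ennreal (heat_kernel (t powr \<alpha> * \<theta>) (x - y))"
      proof (cases "y \<in> cball 0 R")
        case True
        then have "norm (x - y) \<le> 2 * sqrt (t powr \<alpha>)"
          using norm_triangle_ineq4[of x y] tx(2) Rt unfolding sq by simp
        then show ?thesis
          using True heat_kernel_lower_bound[OF _ \<theta>, of "t powr \<alpha>" "x - y"] t by (simp add: ennreal_leI)
      qed simp
    qed
    finally show ?thesis unfolding heat_semigroup_def .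
  qed
  have "ennreal (?g * m / 2) = (ennreal ?g * ennreal m) * ennreal (1/2)"
    using m by (simp only: ennreal_mult[symmetric] mult_nonneg_nonneg powr_ge_zero exp_ge_zero) (simp add: ennreal_mult[symmetric])
  also have "\<dots> \<le> (ennreal ?g * ennreal m) * (\<integral>\<^sup>+ \<theta>\<in>{1/2..2}. ennreal (h \<theta>) \<partial>lborel)"
    by (intro mult_left_mono hc) auto
  also have "\<dots> = (\<integral>\<^sup>+ \<theta>. (ennreal ?g * ennreal m) * (ennreal (h \<theta>) * indicator {1/2..2} \<theta>) \<partial>lborel)"
  proof (rule nn_integral_cmult[symmetric])
    have "(\<lambda>\<theta>. ennreal (indicator {0<..} \<theta> * h \<theta>) * indicator {1/2..2} \<theta>) \<in> borel_measurable lborel"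
      using hm by measurable
    moreover have "(\<lambda>\<theta>. ennreal (indicator {0<..} \<theta> * h \<theta>) * indicator {1/2..2} \<theta>) = (\<lambda>\<theta>. ennreal (h \<theta>) * indicator {1/2..2} \<theta>)"
      by (auto simp: indicator_def)
    ultimately show "(\<lambda>\<theta>. ennreal (h \<theta>) * indicator {1/2..2} \<theta>) \<in> borel_measurable lborel" by simp
  qed
  also have "\<dots> \<le> subordination h \<alpha> t \<mu> x"
    unfolding subordination_def
  proof (intro nn_integral_mono)
    fix \<theta> :: real
    show "(ennreal ?g * ennreal m) * (ennreal (h \<theta>) * indicator {1/2..2} \<theta>) \<le>
      ennreal (h \<theta>) * heat_semigroup (t powr \<alpha> * \<theta>) \<mu> x * indicator {0<..} \<theta>"
    proof (cases "\<theta> \<in> {1/2..2}")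
      case True
      then show ?thesis using mult_left_mono[OF hs[of \<theta>], of "ennreal (h \<theta>)"] by (simp add: mult_ac)
    qed simp
  qed
  also have "\<dots> \<le> ennreal (v t x)" using E t by (simp add: t_def x_def)
  finally have "?g * m / 2 \<le> v t x" using v[of t x] by simp
  moreover have "?g = (8 * pi) powr - (real DIM('a) / 2) * exp (-2) * t powr - (\<alpha> * real DIM('a) / 2)"
    using t by (simp add: powr_mult powr_powr)
  ultimately have "(8 * pi) powr - (real DIM('a) / 2) * exp (-2) / 2 * m * t powr - (\<alpha> * real DIM('a) / 2) \<le> v t x"
    by (simp add: mult_ac)
  then show "(8 * pi) powr - (real DIM('a) / 2) * exp (-2) / 2 * m * fst z powr - (\<alpha> * real DIM('a) / 2) \<le> v (fst z) (snd z)"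
    by (simp add: t_def x_def)
qed

text \<open>Heat flow from the slice at time s to t costs (s/t)^b with b = \<alpha> N/2, and the
  nonlinearity supplies a^p s^(-b p). In the critical case the product is a^p t^(-b) s^(-\<alpha>),
  whose time integral is the gain. The 8 collects three halves: \<theta> \<ge> 1/2 in the weight,
  the mass of \<open>h\<close> on [1/2, 2], and \<alpha> \<ge> 1/2 in front of the Duhamel
  integral.\<close>

lemma parabolic_lower_bound_step:
  fixes v :: "real \<Rightarrow> 'a::euclidean_space \<Rightarrow> real"
  defines "p \<equiv> 1 + 2 / real DIM('a)"
  assumes \<alpha>: "1/2 \<le> \<alpha>" "\<alpha> < 1"
    and v: "\<And>t x. 0 \<le> v t x"
    and hm: "(\<lambda>\<theta>. indicator {0<..} \<theta> * h \<theta>) \<in> borel_measurable lborel"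
    and hpos: "\<And>\<theta>. 0 < \<theta> \<Longrightarrow> 0 \<le> h \<theta>"
    and hc: "ennreal (1/2) \<le> (\<integral>\<^sup>+ \<theta>\<in>{1/2..2}. ennreal (h \<theta>) \<partial>lborel)"
    and vm: "(\<lambda>(t, x). v t x) \<in> borel_measurable (borel \<Otimes>\<^sub>M borel)"
    and E: "AE z in lborel \<Otimes>\<^sub>M lborel. 0 < fst z \<longrightarrow>
      duhamel (\<lambda>\<theta>. \<theta> * h \<theta>) \<alpha> p (\<lambda>s y. ennreal (v s y)) (fst z) (snd z) \<le> ennreal (v (fst z) (snd z))"
    and L: "parabolic_lower_bound \<alpha> v a \<tau>" and a: "0 < a" and \<tau>: "0 < \<tau>" "\<tau> < \<sigma>"
  shows "parabolic_lower_bound \<alpha> v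
    (ball_constant TYPE('a) / 8 * a powr p * ((1 - (\<tau> / \<sigma>) powr (1 - \<alpha>)) / (1 - \<alpha>))) \<sigma>"
proof -
  define b where "b = \<alpha> * real DIM('a) / 2"
  let ?w = "\<lambda>\<theta>. \<theta> * h \<theta>" and ?V = "\<lambda>s y. ennreal (v s y)"
  let ?c = "ball_constant TYPE('a)"
  note cpos = ball_constant_pos[where 'a='a]
  have p: "1 < p" by (simp add: p_def)
  have Gm: "(\<lambda>y. ennreal (heat_kernel r (x - y)) * indicator (cball 0 \<rho>) y) \<in> borel_measurable lborel"
    for r \<rho> and x :: 'a
  proof -
    have [measurable]: "cball 0 \<rho> \<in> sets (borel :: 'a measure)" by simp
    show ?thesis by measurable
  qed
  have vm'[measurable]: "case_prod v \<in> borel_measurable (borel \<Otimes>\<^sub>M borel)" using vm by simp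
  have Vm: "(\<lambda>(t, x). ?V t x) \<in> borel_measurable (borel \<Otimes>\<^sub>M borel)" by measurable
  have h12: "(\<lambda>\<theta>. ennreal (h \<theta>) * indicator {1/2..2} \<theta>) \<in> borel_measurable lborel"
  proof -
    have "(\<lambda>\<theta>. ennreal (indicator {0<..} \<theta> * h \<theta>) * indicator {1/2..2} \<theta>) \<in> borel_measurable lborel"
      using hm by measurable
    moreover have "(\<lambda>\<theta>. ennreal (indicator {0<..} \<theta> * h \<theta>) * indicator {1/2..2} \<theta>) = (\<lambda>\<theta>. ennreal (h \<theta>) * indicator {1/2..2} \<theta>)"
      by (auto simp: indicator_def)
    ultimately show ?thesis by simp
  qed
  have L2: "AE s in lborel. AE y in lborel. \<tau> \<le> s \<and> norm y \<le> s powr (\<alpha> / 2) \<longrightarrow> a * s powr - b \<le> v s y"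
    using lborel_pair.AE_pair[OF L[unfolded parabolic_lower_bound_def]] by (simp add: b_def)
  have inner: "ennreal (?c / 4 * a powr p * t powr - b * s powr - \<alpha>) \<le> duhamel_inner ?w \<alpha> p ?V (t - s) s x"
    if s: "\<tau> < s" "s < t" and x: "norm x \<le> t powr (\<alpha> / 2)"
      and ae: "AE y in lborel. \<tau> \<le> s \<and> norm y \<le> s powr (\<alpha> / 2) \<longrightarrow> a * s powr - b \<le> v s y" for s t and x :: 'a
  proof -
    define q where "q = (a * s powr - b) powr p"
    define B where "B = ?c * (s / t) powr b * q"
    have q0: "0 \<le> q" by (simp add: q_def)
    have B0: "0 \<le> B" using cpos q0 by (simp add: B_def)
    have [measurable]: "v s \<in> borel_measurable borel"
      using measurable_compose[of "\<lambda>y. (s, y)" borel "borel \<Otimes>\<^sub>M borel" "case_prod v" borel] by simp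
    have yint: "ennreal B \<le> (\<integral>\<^sup>+ y. ennreal (heat_kernel ((t - s) powr \<alpha> * \<theta>) (x - y)) * epowr (?V s y) p \<partial>lborel)"
      if \<theta>: "1/2 \<le> \<theta>" "\<theta> \<le> 2" for \<theta>
    proof -
      have "ennreal B = ennreal (?c * (s / t) powr b) * ennreal q"
        using cpos q0 by (simp add: B_def ennreal_mult)
      also have "\<dots> \<le> (\<integral>\<^sup>+ y\<in>cball 0 (s powr (\<alpha> / 2)). ennreal (heat_kernel ((t - s) powr \<alpha> * \<theta>) (x - y)) \<partial>lborel) * ennreal q"
        unfolding b_def using \<alpha> \<tau> s x \<theta> by (intro mult_right_mono parabolic_ball_lower_bound) auto
      also have "\<dots> = (\<integral>\<^sup>+ y. ennreal (heat_kernel ((t - s) powr \<alpha> * \<theta>) (x - y)) * indicator (cball 0 (s powr (\<alpha> / 2))) y * ennreal q \<partial>lborel)"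
        by (rule nn_integral_multc[OF Gm, symmetric])
      also have "\<dots> \<le> (\<integral>\<^sup>+ y. ennreal (heat_kernel ((t - s) powr \<alpha> * \<theta>) (x - y)) * epowr (?V s y) p \<partial>lborel)"
      proof (rule nn_integral_mono_AE)
        show "AE y in lborel. ennreal (heat_kernel ((t - s) powr \<alpha> * \<theta>) (x - y)) * indicator (cball 0 (s powr (\<alpha> / 2))) y * ennreal q
          \<le> ennreal (heat_kernel ((t - s) powr \<alpha> * \<theta>) (x - y)) * epowr (?V s y) p"
          using ae
        proof eventually_elim
          case (elim y)
          show ?case
          proof (cases "norm y \<le> s powr (\<alpha> / 2)")
            case True
            then have "a * s powr - b \<le> v s y" using elim s by simp
            then have "q \<le> v s y powr p" unfolding q_def using a p by (intro powr_mono2) auto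
            then show ?thesis using True v by (simp add: mult_left_mono ennreal_leI)
          qed simp
        qed
      qed
      finally show ?thesis .
    qed
    have Beq: "B = ?c * a powr p * t powr - b * s powr - \<alpha>"
    proof -
      \<comment> \<open>The algebraic form of criticality: this is where p = 1 + 2/N is
        needed.\<close>
      have "b * p = b + \<alpha>" by (simp add: b_def p_def field_simps)
      then have "q = a powr p * s powr (- b - \<alpha>)"
        unfolding q_def using a by (simp add: powr_mult powr_powr)
      moreover have "(s / t) powr b = s powr b * t powr - b" using \<tau> s by (simp add: powr_divide powr_minus_divide)
      moreover have "s powr b * s powr (- b - \<alpha>) = s powr - \<alpha>" by (simp flip: powr_add)
      ultimately show ?thesis by (simp add: B_def mult_ac)
    qed
    have "ennreal (?c / 4 * a powr p * t powr - b * s powr - \<alpha>) = ennreal (1/2 * B * (1/2))"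
      unfolding Beq by (simp add: mult_ac)
    also have "\<dots> = ennreal (1/2 * B) * ennreal (1/2)" using B0 by (intro ennreal_mult) auto
    also have "\<dots> \<le> ennreal (1/2 * B) * (\<integral>\<^sup>+ \<theta>\<in>{1/2..2}. ennreal (h \<theta>) \<partial>lborel)"
      by (intro mult_left_mono hc) auto
    also have "\<dots> = (\<integral>\<^sup>+ \<theta>. ennreal (1/2 * B) * (ennreal (h \<theta>) * indicator {1/2..2} \<theta>) \<partial>lborel)"
      by (rule nn_integral_cmult[OF h12, symmetric])
    also have "\<dots> \<le> duhamel_inner ?w \<alpha> p ?V (t - s) s x"
      unfolding duhamel_inner_def
    proof (intro nn_integral_mono)
      fix \<theta> :: real
      show "ennreal (1/2 * B) * (ennreal (h \<theta>) * indicator {1/2..2} \<theta>) \<le>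
         ennreal (indicator {0<..} \<theta> * (\<theta> * h \<theta>)) *
         (\<integral>\<^sup>+ y. ennreal (heat_kernel ((t - s) powr \<alpha> * \<theta>) (x - y)) * epowr (?V s y) p \<partial>lborel)"
      proof (cases "\<theta> \<in> {1/2..2}")
        case True
        then have h0: "0 \<le> h \<theta>" by (intro hpos) simp
        have "ennreal (1/2 * B) * ennreal (h \<theta>) = ennreal (1/2 * h \<theta>) * ennreal B"
          using B0 h0 by (simp add: ennreal_mult[symmetric] mult_ac)
        also have "\<dots> \<le> ennreal (\<theta> * h \<theta>) * ennreal B"
          using True h0 by (intro mult_right_mono ennreal_leI) auto
        also have "\<dots> \<le> ennreal (\<theta> * h \<theta>) * (\<integral>\<^sup>+ y. ennreal (heat_kernel ((t - s) powr \<alpha> * \<theta>) (x - y)) * epowr (?V s y) p \<partial>lborel)"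
          using True by (intro mult_left_mono yint) auto
        finally show ?thesis using True by simp
      qed simp
    qed
    finally show ?thesis .
  qed
  let ?J = "(1 - (\<tau> / \<sigma>) powr (1 - \<alpha>)) / (1 - \<alpha>)"
  have J0: "0 \<le> ?J"
  proof -
    have "(\<tau> / \<sigma>) powr (1 - \<alpha>) \<le> 1" using \<tau> \<alpha> by (intro powr_le1) auto
    then show ?thesis using \<alpha> by simp
  qed
  have main: "ennreal (?c / 8 * a powr p * ?J * t powr - b) \<le> duhamel ?w \<alpha> p ?V t x"
    if t: "\<sigma> \<le> t" and x: "norm x \<le> t powr (\<alpha> / 2)" for t and x :: 'a
  proof -
    define C where "C = ?c / 4 * a powr p * t powr - b"
    have C0: "0 \<le> C" using cpos by (simp add: C_def)
    have "ennreal (?c / 8 * a powr p * ?J * t powr - b) = ennreal (1/2 * (C * ?J))"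
      by (simp add: C_def mult_ac)
    also have "\<dots> = ennreal (1/2) * ennreal (C * ?J)"
      by (rule ennreal_mult[OF _ mult_nonneg_nonneg[OF C0 J0]]) simp
    also have "ennreal (C * ?J) = ennreal C * ennreal ?J" by (rule ennreal_mult[OF C0 J0])
    also have "ennreal (1/2) * (ennreal C * ennreal ?J) \<le> ennreal \<alpha> * (ennreal C *
        (\<integral>\<^sup>+ s\<in>{\<tau><..<t}. ennreal ((t - s) powr (\<alpha> - 1) * s powr - \<alpha>) \<partial>lborel))"
    proof (intro mult_mono)
      \<comment> \<open>The gain increases with t, so t = \<sigma> is the worst case and one
        constant serves all later times.\<close>
      have "?J \<le> (1 - (\<tau> / t) powr (1 - \<alpha>)) / (1 - \<alpha>)"
      proof -
        have "\<tau> / t \<le> \<tau> / \<sigma>" using \<tau> t by (intro divide_left_mono) auto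
        then have "(\<tau> / t) powr (1 - \<alpha>) \<le> (\<tau> / \<sigma>) powr (1 - \<alpha>)" using \<alpha> \<tau> t by (intro powr_mono2) auto
        then show ?thesis using \<alpha> by (intro divide_right_mono) auto
      qed
      then have "ennreal ?J \<le> ennreal ((1 - (\<tau> / t) powr (1 - \<alpha>)) / (1 - \<alpha>))" by (rule ennreal_leI)
      also have "\<dots> \<le> (\<integral>\<^sup>+ s\<in>{\<tau><..<t}. ennreal ((t - s) powr (\<alpha> - 1) * s powr - \<alpha>) \<partial>lborel)"
        using \<alpha> \<tau> t by (intro nn_integral_powr_mult_powr_ge) auto
      finally show "ennreal ?J \<le> (\<integral>\<^sup>+ s\<in>{\<tau><..<t}. ennreal ((t - s) powr (\<alpha> - 1) * s powr - \<alpha>) \<partial>lborel)" .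
      show "ennreal (1/2) \<le> ennreal \<alpha>" using \<alpha> by (intro ennreal_leI)
    qed auto
    also have "ennreal C * (\<integral>\<^sup>+ s\<in>{\<tau><..<t}. ennreal ((t - s) powr (\<alpha> - 1) * s powr - \<alpha>) \<partial>lborel) =
       (\<integral>\<^sup>+ s. ennreal C * (ennreal ((t - s) powr (\<alpha> - 1) * s powr - \<alpha>) * indicator {\<tau><..<t} s) \<partial>lborel)"
      by (rule nn_integral_cmult[symmetric]) measurable
    also have "\<dots> \<le> (\<integral>\<^sup>+ s\<in>{0<..<t}. ennreal ((t - s) powr (\<alpha> - 1)) * duhamel_inner ?w \<alpha> p ?V (t - s) s x \<partial>lborel)"
    proof (rule nn_integral_mono_AE)
      show "AE s in lborel. ennreal C * (ennreal ((t - s) powr (\<alpha> - 1) * s powr - \<alpha>) * indicator {\<tau><..<t} s)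
        \<le> ennreal ((t - s) powr (\<alpha> - 1)) * duhamel_inner ?w \<alpha> p ?V (t - s) s x * indicator {0<..<t} s"
        using L2
      proof eventually_elim
        case (elim s)
        show ?case
        proof (cases "s \<in> {\<tau><..<t}")
          case True
          then have s: "\<tau> < s" "s < t" by auto
          have "ennreal C * ennreal ((t - s) powr (\<alpha> - 1) * s powr - \<alpha>) = ennreal ((t - s) powr (\<alpha> - 1)) * ennreal (C * s powr - \<alpha>)"
            using C0 by (simp add: ennreal_mult[symmetric] mult_ac)
          also have "\<dots> \<le> ennreal ((t - s) powr (\<alpha> - 1)) * duhamel_inner ?w \<alpha> p ?V (t - s) s x"
            using inner[OF s x elim] by (intro mult_left_mono) (auto simp: C_def)
          finally show ?thesis using True \<tau> by simp
        qed simp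
      qed
    qed
    finally show ?thesis
      unfolding duhamel_def subordination_density_eq_duhamel_inner[OF Vm] by (simp add: mult_left_mono)
  qed
  show ?thesis
    using E unfolding parabolic_lower_bound_def
  proof eventually_elim
    case (elim z)
    show ?case
    proof
      assume z: "\<sigma> \<le> fst z \<and> norm (snd z) \<le> fst z powr (\<alpha> / 2)"
      then have "ennreal (?c / 8 * a powr p * ?J * fst z powr - b) \<le> duhamel ?w \<alpha> p ?V (fst z) (snd z)"
        by (intro main) auto
      also have "\<dots> \<le> ennreal (v (fst z) (snd z))" using elim z \<tau> by simp
      finally show "?c / 8 * a powr p * ?J * fst z powr - (\<alpha> * real DIM('a) / 2) \<le> v (fst z) (snd z)"
        using v by (simp add: b_def)
    qed
  qed
qed

section \<open>Blow-up for large mass\<close>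

text \<open>Countably many exceptional null sets are combined. Outside them the real number v(t, x)
  would exceed every bound on the paraboloid beyond \<open>T\<close>, which has positive
  measure.\<close>

lemma parabolic_lower_bound_unbounded:
  fixes v :: "real \<Rightarrow> 'a::euclidean_space \<Rightarrow> real" and A :: "nat \<Rightarrow> real"
  assumes L: "\<And>k. parabolic_lower_bound \<alpha> v (A k) T" and T: "0 < T"
    and A: "\<And>C. \<exists>k. C < A k"
  shows False
proof -
  have "AE z in lborel \<Otimes>\<^sub>M lborel. \<forall>k. T \<le> fst z \<and> norm (snd z) \<le> fst z powr (\<alpha> / 2) \<longrightarrow>
     A k * fst z powr - (\<alpha> * real DIM('a) / 2) \<le> v (fst z) (snd z)"
    unfolding AE_all_countable by (intro allI) (rule L[unfolded parabolic_lower_bound_def])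
  then have "AE z in (lborel \<Otimes>\<^sub>M lborel :: (real \<times> 'a) measure). \<not> (T \<le> fst z \<and> norm (snd z) \<le> fst z powr (\<alpha> / 2))"
  proof eventually_elim
    case (elim z)
    show ?case
    proof
      assume z: "T \<le> fst z \<and> norm (snd z) \<le> fst z powr (\<alpha> / 2)"
      define q where "q = fst z powr - (\<alpha> * real DIM('a) / 2)"
      have q: "0 < q" using z T by (simp add: q_def)
      obtain k where "v (fst z) (snd z) / q < A k" using A by blast
      then have "v (fst z) (snd z) < A k * q" using q by (simp add: divide_less_eq)
      moreover have "A k * q \<le> v (fst z) (snd z)" using elim z unfolding q_def by blast
      ultimately show False by simp
    qed
  qed
  then have "AE t in lborel. AE x in (lborel :: 'a measure). \<not> (T \<le> t \<and> norm x \<le> t powr (\<alpha> / 2))"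
    using lborel_pair.AE_pair by fastforce
  then have "AE t in lborel. t \<notin> {T..T + 1}"
  proof eventually_elim
    case (elim t)
    show ?case
    proof
      assume t: "t \<in> {T..T + 1}"
      then have "AE x in (lborel :: 'a measure). x \<notin> cball 0 (t powr (\<alpha> / 2))"
        using elim by simp
      then have "cball 0 (t powr (\<alpha> / 2)) \<in> null_sets (lborel :: 'a measure)"
        by (subst AE_iff_null_sets) auto
      then have "emeasure lborel (cball (0 :: 'a) (t powr (\<alpha> / 2))) = 0" by auto
      moreover have "0 < unit_ball_vol (real DIM('a)) * (t powr (\<alpha> / 2)) ^ DIM('a)"
        using t T by simp
      ultimately show False
        using emeasure_cball[of "t powr (\<alpha> / 2)" "0 :: 'a"] by (simp add: ennreal_eq_0_iff)
    qed
  qed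
  then have "{T..T + 1} \<in> null_sets lborel" by (subst AE_iff_null_sets) auto
  then show False by auto
qed

text \<open>
  Along \<open>\<tau>\<^sub>k = t\<^sub>0 exp ((2 - 2\<^sup>1\<^sup>-\<^sup>k) / (1 - \<alpha>))\<close> the step lemma multiplies the constant by a factor
  bounded below by \<open>2\<^sup>N\<^sup>/\<^sup>2\<close>, so a large initial constant becomes arbitrarily large beyond the finite
  time \<open>t\<^sub>0 exp (2 / (1 - \<alpha>))\<close>.
\<close>

lemma parabolic_lower_bound_small:
  fixes v :: "real \<Rightarrow> 'a::euclidean_space \<Rightarrow> real"
  defines "N \<equiv> real DIM('a)"
  defines "p \<equiv> 1 + 2 / N"
  assumes \<alpha>: "1/2 \<le> \<alpha>" "\<alpha> < 1"
    and v: "\<And>t x. 0 \<le> v t x"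
    and hm: "(\<lambda>\<theta>. indicator {0<..} \<theta> * h \<theta>) \<in> borel_measurable lborel"
    and hpos: "\<And>\<theta>. 0 < \<theta> \<Longrightarrow> 0 \<le> h \<theta>"
    and hc: "ennreal (1/2) \<le> (\<integral>\<^sup>+ \<theta>\<in>{1/2..2}. ennreal (h \<theta>) \<partial>lborel)"
    and vm: "(\<lambda>(t, x). v t x) \<in> borel_measurable (borel \<Otimes>\<^sub>M borel)"
    and E: "AE z in lborel \<Otimes>\<^sub>M lborel. 0 < fst z \<longrightarrow>
      duhamel (\<lambda>\<theta>. \<theta> * h \<theta>) \<alpha> p (\<lambda>s y. ennreal (v s y)) (fst z) (snd z) \<le> ennreal (v (fst z) (snd z))"
    and L: "parabolic_lower_bound \<alpha> v a t\<^sub>0" and a: "0 < a" and t0: "0 < t\<^sub>0"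
  shows "ball_constant TYPE('a) / (16 * (1 - \<alpha>)) * a powr (2 / N) < 2 powr (N / 2)"
proof (rule ccontr)
  let ?c = "ball_constant TYPE('a)"
  assume "\<not> ?thesis"
  then have large: "2 powr (N / 2) \<le> ?c / (16 * (1 - \<alpha>)) * a powr (2 / N)" by simp
  have N: "0 < N" by (simp add: N_def)
  \<comment> \<open>Chosen so that the ratio of successive times to the power 1 - \<alpha> is exp(-
    2^(-k)): the gains may shrink like 2^(-k) while the times stay bounded.\<close>
  define \<tau> where "\<tau> k = t\<^sub>0 * exp ((2 - 2 * (1/2) ^ k) / (1 - \<alpha>))" for k :: nat
  \<comment> \<open>Each step multiplies \<open>A\<close> by 2^(N/2), hence A^(p-1) by 2, which
    offsets the halving of the gain.\<close>
  define A where "A k = a * 2 powr (real k * N / 2)" for k :: nat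
  have \<tau>pos: "0 < \<tau> k" for k using t0 by (simp add: \<tau>_def)
  have \<tau>Suc: "\<tau> k / \<tau> (Suc k) = exp (- ((1/2) ^ k / (1 - \<alpha>)))" for k
  proof -
    have "\<tau> k / \<tau> (Suc k) = exp ((2 - 2 * (1/2) ^ k) / (1 - \<alpha>) - (2 - 2 * (1/2) ^ Suc k) / (1 - \<alpha>))"
      using t0 by (simp add: \<tau>_def exp_diff)
    also have "(2 - 2 * (1/2) ^ k) / (1 - \<alpha>) - (2 - 2 * (1/2) ^ Suc k) / (1 - \<alpha>) = - ((1/2) ^ k / (1 - \<alpha>))"
      by (simp add: diff_divide_distrib[symmetric])
    finally show ?thesis .
  qed
  have \<tau>mono: "\<tau> k < \<tau> (Suc k)" for k
  proof -
    have "\<tau> k / \<tau> (Suc k) < 1" unfolding \<tau>Suc using \<alpha> by simp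
    then show ?thesis using \<tau>pos[of "Suc k"] by simp
  qed
  have LA: "parabolic_lower_bound \<alpha> v (A k) (\<tau> k)" for k
  proof (induction k)
    case 0
    then show ?case using L by (simp add: A_def \<tau>_def)
  next
    case (Suc k)
    have Ak: "0 < A k" using a by (simp add: A_def)
    let ?J = "(1 - (\<tau> k / \<tau> (Suc k)) powr (1 - \<alpha>)) / (1 - \<alpha>)"
    have step: "parabolic_lower_bound \<alpha> v (?c / 8 * A k powr p * ?J) (\<tau> (Suc k))"
      unfolding p_def N_def
      by (rule parabolic_lower_bound_step[OF \<alpha> v hm hpos hc vm E[unfolded p_def N_def] Suc Ak \<tau>pos \<tau>mono])
    have "A (Suc k) \<le> ?c / 8 * A k powr p * ?J"
    proof -
      define y :: real where "y = (1/2) ^ k"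
      have y: "0 < y" "y \<le> 1" by (auto simp: y_def power_le_one)
      have "(\<tau> k / \<tau> (Suc k)) powr (1 - \<alpha>) = exp (- y)"
        unfolding \<tau>Suc using \<alpha> by (simp add: powr_def y_def)
      \<comment> \<open>Valid on [0, 1]; the loss of 1/2 turns the 8 of the propagation step into
        the 16 of the statement.\<close>
      moreover have "exp (- y) \<le> 1 - y / 2"
      proof -
        have "1 \<le> (1 - y / 2) * (1 + y)" using y by (simp add: algebra_simps power2_eq_square mult_le_one)
        also have "\<dots> \<le> (1 - y / 2) * exp y" using y by (intro mult_left_mono) auto
        finally show ?thesis by (simp add: exp_minus field_simps)
      qed
      ultimately have J: "y / 2 / (1 - \<alpha>) \<le> ?J" using \<alpha> by (intro divide_right_mono) auto
      \<comment> \<open>The factor 2^k isolated here cancels against y = 2^(-k), which leaves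
        exactly the assumed inequality \<open>large\<close>.\<close>
      have pow: "A k powr p = a * a powr (2 / N) * (2 powr (real k * N / 2) * 2 ^ k)"
      proof -
        have "real k * N / 2 * p = real k * N / 2 + real k" using N by (simp add: p_def field_simps)
        then have "(2 powr (real k * N / 2)) powr p = 2 powr (real k * N / 2) * 2 ^ k"
          by (simp only: powr_powr powr_add) (simp add: powr_realpow)
        then show ?thesis unfolding A_def using a by (simp add: powr_mult) (simp add: p_def powr_add)
      qed
      have "A (Suc k) = a * 2 powr (real k * N / 2) * 2 powr (N / 2)"
        by (simp add: A_def powr_add[symmetric] add_divide_distrib algebra_simps)
      also have "\<dots> \<le> a * 2 powr (real k * N / 2) * (?c / (16 * (1 - \<alpha>)) * a powr (2 / N))"
        using a large by (intro mult_left_mono) auto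
      also have "\<dots> = ?c / 8 * A k powr p * (y / 2 / (1 - \<alpha>))"
      proof -
        have "2 ^ k * y = 1" by (simp add: y_def power_divide)
        then have "?c / 8 * (a * a powr (2 / N) * (2 powr (real k * N / 2) * 2 ^ k)) * (y / 2 / (1 - \<alpha>)) =
           ?c / 8 * (a * a powr (2 / N) * 2 powr (real k * N / 2)) * (1 / 2 / (1 - \<alpha>))"
          by (simp add: mult_ac)
        then show ?thesis unfolding pow by (simp add: mult_ac)
      qed
      also have "\<dots> \<le> ?c / 8 * A k powr p * ?J"
        using J ball_constant_pos[where 'a='a] by (intro mult_left_mono) auto
      finally show ?thesis .
    qed
    with step show ?case by (rule parabolic_lower_bound_mono) simp
  qed
  show False
  proof (rule parabolic_lower_bound_unbounded)
    show "0 < t\<^sub>0 * exp (2 / (1 - \<alpha>))" using t0 by simp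
    show "parabolic_lower_bound \<alpha> v (A k) (t\<^sub>0 * exp (2 / (1 - \<alpha>)))" for k
    proof (rule parabolic_lower_bound_mono[OF LA order_refl])
      show "\<tau> k \<le> t\<^sub>0 * exp (2 / (1 - \<alpha>))"
        unfolding \<tau>_def using t0 \<alpha> by (intro mult_left_mono) (auto intro: divide_right_mono)
    qed
    show "\<exists>k. C < A k" for C
    proof -
      have "1 < 2 powr (N / 2)" using N by simp
      then obtain k where "C / a < (2 powr (N / 2)) ^ k" using real_arch_pow by blast
      moreover have "(2 powr (N / 2)) ^ k = 2 powr (real k * N / 2)"
        by (simp add: powr_powr powr_realpow[symmetric] mult_ac)
      ultimately show ?thesis using a by (auto simp: A_def divide_less_eq mult.commute)
    qed
  qed
qed

section \<open>The critical threshold\<close>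

text \<open>All moment bounds are fixed before \<alpha>, so both smallness conditions of the
  existence result can be met by scaling with 1 - \<alpha> alone.\<close>

lemma Bplus_subset_G_set:
  fixes p :: real
  defines "p \<equiv> 1 + 2 / real DIM('a::euclidean_space)"
  obtains C where "0 < C"
    "\<And>\<alpha> h. mittag_leffler_density \<alpha> h \<Longrightarrow> 1/2 \<le> \<alpha> \<Longrightarrow> \<alpha> < 1 \<Longrightarrow> ml_real \<alpha> 1 \<le> 4 \<Longrightarrow>
       (Bplus (C * (1 - \<alpha>) powr (real DIM('a) / 2)) :: 'a measure set) \<subseteq> G_set h \<alpha> p"
proof -
  have p: "1 < p" by (simp add: p_def)
  then have \<delta>: "0 < 1 / p" "1 / p < 1" by auto
  obtain K where K: "0 < K"
    "\<And>\<alpha> h. mittag_leffler_density \<alpha> h \<Longrightarrow> 1/2 \<le> \<alpha> \<Longrightarrow> \<alpha> < 1 \<Longrightarrow>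
       (\<integral>\<^sup>+ \<theta>\<in>{0<..}. ennreal (h \<theta>) * ennreal (\<theta> powr - (1 / p)) \<partial>lborel) \<le> ennreal K"
    using mittag_leffler_density_negative_moment[OF \<delta>] by blast
  define T where "T = 2 * (1 + 2 * p / (p - 1))"
  have T: "0 < T" using p by (simp add: T_def add_pos_pos)
  \<comment> \<open>Makes the condition on the linear part an equality, see
    \<open>CM\<close>.\<close>
  define C where "C = (1 / (16 * T)) powr (real DIM('a) / 2) / (4 * K)"
  have C: "0 < C" using T K by (simp add: C_def)
  show thesis
  proof (rule that[OF C])
    fix \<alpha> h assume h: "mittag_leffler_density \<alpha> h" and \<alpha>: "1/2 \<le> \<alpha>" "\<alpha> < 1" and ml: "ml_real \<alpha> 1 \<le> 4"
    \<comment> \<open>The solution of M^(p-1) = (1 - \<alpha>) / (16 T). With 4 as bound for the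
      moment in S_\<alpha> the condition on the nonlinear part is an equality, and 16 is this 4
      times the 4 in that condition.\<close>
    define M where "M = ((1 - \<alpha>) / (16 * T)) powr (real DIM('a) / 2)"
    have M: "0 < M" using \<alpha> T by (simp add: M_def)
    have Mp: "M powr p = M * ((1 - \<alpha>) / (16 * T))"
    proof -
      have "M powr (2 / real DIM('a)) = (1 - \<alpha>) / (16 * T)"
        using \<alpha> T by (simp add: M_def powr_powr)
      then show ?thesis using M by (simp add: p_def powr_add)
    qed
    have CM: "4 * (C * (1 - \<alpha>) powr (real DIM('a) / 2) * K) = M"
      using \<alpha> T K by (simp add: C_def M_def powr_divide)
    show "(Bplus (C * (1 - \<alpha>) powr (real DIM('a) / 2)) :: 'a measure set) \<subseteq> G_set h \<alpha> p"
    proof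
      fix \<nu> :: "'a measure"
      assume \<nu>: "\<nu> \<in> Bplus (C * (1 - \<alpha>) powr (real DIM('a) / 2))"
      have "\<exists>u. is_solution h \<alpha> p \<infinity> \<nu> u"
      proof (rule global_solution_exists[where 'a='a and ?K1.0=K and ?K2.0=4 and M=M, OF h \<alpha>, folded p_def])
        show "0 < K" by (rule K)
        show "(\<integral>\<^sup>+ \<theta>\<in>{0<..}. ennreal (h \<theta>) * ennreal (\<theta> powr - (1 / p)) \<partial>lborel) \<le> ennreal K"
          by (rule K(2)[OF h \<alpha>])
        show "(0 :: real) < 4" by simp
        show "(\<integral>\<^sup>+ \<theta>\<in>{0<..}. ennreal (\<theta> * h \<theta>) * ennreal (\<theta> powr - (1 / p)) \<partial>lborel) \<le> ennreal 4"
          by (rule mittag_leffler_density_first_moment[OF h \<alpha>(1) ml \<delta>])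
        show "sets \<nu> = sets borel" "emeasure \<nu> UNIV \<le> ennreal (C * (1 - \<alpha>) powr (real DIM('a) / 2))"
          using \<nu> by (auto simp: Bplus_def finite_radon_measures_def radon_measure_def)
        \<comment> \<open>Positivity is asked of the bound on the mass, not of the mass, so the zero
          measure is covered.\<close>
        show "0 < C * (1 - \<alpha>) powr (real DIM('a) / 2)" using C \<alpha> by simp
        show "0 < M" by fact
        show "4 * (C * (1 - \<alpha>) powr (real DIM('a) / 2) * K) \<le> M" using CM by simp
        show "4 * (M powr p * 4 * (2 * (1 + 2 * p / (p - 1)) / (1 - \<alpha>))) \<le> M"
        proof -
          have "4 * (M * (e / (16 * T)) * 4 * (T / e)) = M" if "e \<noteq> 0" for e
            using T that by simp
          from this[of "1 - \<alpha>"] show ?thesis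
            unfolding Mp T_def[symmetric] using \<alpha> by simp
        qed
      qed
      then show "\<nu> \<in> G_set h \<alpha> p" using \<nu> by (auto simp: G_set_def Bplus_def)
    qed
  qed
qed

text \<open>The initial lower bound converts mass into a constant a = k m, and the smallness forced
  on that constant is solved for m. The radius carrying the mass affects only the starting time,
  over which the smallness result is uniform.\<close>

lemma G_set_subset_Bplus:
  fixes p :: real
  defines "p \<equiv> 1 + 2 / real DIM('a::euclidean_space)"
  obtains C where "0 < C"
    "\<And>\<alpha> h. mittag_leffler_density \<alpha> h \<Longrightarrow> 1/2 \<le> \<alpha> \<Longrightarrow> \<alpha> < 1 \<Longrightarrow>
       ennreal (1/2) \<le> (\<integral>\<^sup>+ \<theta>\<in>{1/2..2}. ennreal (h \<theta>) \<partial>lborel) \<Longrightarrow>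
       (G_set h \<alpha> p :: 'a measure set) \<subseteq> Bplus (C * (1 - \<alpha>) powr (real DIM('a) / 2))"
proof -
  let ?c = "ball_constant TYPE('a)"
  note cpos = ball_constant_pos[where 'a='a]
  \<comment> \<open>The 4 combines the factor 1/2 of the initial lower bound with the use of half
    the mass.\<close>
  define k where "k = (8 * pi) powr - (real DIM('a) / 2) * exp (-2) / 4"
  have k: "0 < k" by (simp add: k_def)
  \<comment> \<open>Comes from solving c / (16 (1 - \<alpha>)) * a^(2/N) < 2^(N/2) for a^(2/N),
    where c is the ball constant.\<close>
  define Q where "Q = 16 * 2 powr (real DIM('a) / 2) / ?c"
  have Q: "0 < Q" using cpos by (simp add: Q_def)
  show thesis
  proof (rule that)
    show "0 < Q powr (real DIM('a) / 2) / k" using Q k by simp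
    fix \<alpha> h assume h: "mittag_leffler_density \<alpha> h" and \<alpha>: "1/2 \<le> \<alpha>" "\<alpha> < 1"
      and hc: "ennreal (1/2) \<le> (\<integral>\<^sup>+ \<theta>\<in>{1/2..2}. ennreal (h \<theta>) \<partial>lborel)"
    have hpos: "0 \<le> h \<theta>" if "0 < \<theta>" for \<theta>
      using h that unfolding mittag_leffler_density_def by (auto intro: less_imp_le)
    note hm = mittag_leffler_density_measurable[OF h]
    show "(G_set h \<alpha> p :: 'a measure set) \<subseteq> Bplus (Q powr (real DIM('a) / 2) / k * (1 - \<alpha>) powr (real DIM('a) / 2))"
    proof
      fix \<nu> :: "'a measure" assume "\<nu> \<in> G_set h \<alpha> p"
      then obtain u where fr: "\<nu> \<in> finite_radon_measures" and u: "is_solution h \<alpha> p \<infinity> \<nu> u"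
        by (auto simp: G_set_def)
      have \<nu>: "sets \<nu> = sets borel" and fin: "emeasure \<nu> UNIV < \<infinity>"
        using fr by (auto simp: finite_radon_measures_def radon_measure_def)
      define m where "m = enn2real (emeasure \<nu> UNIV)"
      have m: "emeasure \<nu> UNIV = ennreal m" "0 \<le> m" using fin by (auto simp: m_def)
      have "m \<le> Q powr (real DIM('a) / 2) / k * (1 - \<alpha>) powr (real DIM('a) / 2)"
      proof (cases "m = 0")
        case True
        then show ?thesis using k by simp
      next
        case False
        then have m0: "0 < m" using m by simp
        obtain v where vm: "(\<lambda>(t, x). v t x) \<in> borel_measurable (borel \<Otimes>\<^sub>M borel)"
          and v: "\<And>t x. 0 \<le> v t x"
          and E: "AE z in lborel \<Otimes>\<^sub>M lborel. 0 < fst z \<longrightarrow> ennreal (v (fst z) (snd z)) =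
             subordination h \<alpha> (fst z) \<nu> (snd z) +
             duhamel (\<lambda>\<theta>. \<theta> * h \<theta>) \<alpha> p (\<lambda>s y. ennreal (v s y)) (fst z) (snd z)"
          by (rule is_solution_borel_version[OF u], rule that, assumption+)
        have E1: "AE z in lborel \<Otimes>\<^sub>M lborel. 0 < fst z \<longrightarrow>
            subordination h \<alpha> (fst z) \<nu> (snd z) \<le> ennreal (v (fst z) (snd z))"
          using E by eventually_elim simp
        have E2: "AE z in lborel \<Otimes>\<^sub>M lborel. 0 < fst z \<longrightarrow>
            duhamel (\<lambda>\<theta>. \<theta> * h \<theta>) \<alpha> p (\<lambda>s y. ennreal (v s y)) (fst z) (snd z) \<le> ennreal (v (fst z) (snd z))"
          using E by eventually_elim simp
        \<comment> \<open>Balls exhaust the space, so one of them carries half the finite mass; the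
          radius n + 1 ensures positivity.\<close>
        obtain R where R: "0 < R" "ennreal (m / 2) \<le> emeasure \<nu> (cball 0 R)"
        proof -
          have "(SUP n. emeasure \<nu> (cball 0 (real n))) = emeasure \<nu> (\<Union>n. cball 0 (real n))"
            by (intro SUP_emeasure_incseq) (auto simp: \<nu> incseq_def)
          also have "(\<Union>n. cball 0 (real n)) = (UNIV :: 'a set)"
            using real_arch_simple by auto
          finally have "ennreal (m / 2) < (SUP n. emeasure \<nu> (cball 0 (real n)))"
            using m0 m by (simp add: ennreal_less_iff)
          then obtain n where n: "ennreal (m / 2) < emeasure \<nu> (cball 0 (real n))"
            by (auto simp: less_SUP_iff)
          also have "\<dots> \<le> emeasure \<nu> (cball 0 (real n + 1))"
            by (intro emeasure_mono) (auto simp: \<nu>)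
          finally show ?thesis by (intro that[of "real n + 1"]) auto
        qed
        have L: "parabolic_lower_bound \<alpha> v
            ((8 * pi) powr - (real DIM('a) / 2) * exp (-2) / 2 * (m / 2)) (R powr (2 / \<alpha>))"
          using \<alpha> m0 by (intro parabolic_lower_bound_initial[OF _ v hm hc \<nu> R(1) _ R(2) E1]) auto
        have km: "(8 * pi) powr - (real DIM('a) / 2) * exp (-2) / 2 * (m / 2) = k * m"
          by (simp add: k_def)
        have kpos: "0 < k * m" using k m0 by simp
        have "?c / (16 * (1 - \<alpha>)) * (k * m) powr (2 / real DIM('a)) < 2 powr (real DIM('a) / 2)"
          using parabolic_lower_bound_small[OF \<alpha> v hm hpos hc vm E2[unfolded p_def] L[unfolded km] kpos] R by simp
        then have "(k * m) powr (2 / real DIM('a)) \<le> Q * (1 - \<alpha>)"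
          using \<alpha> cpos by (simp add: Q_def field_simps)
        then have "((k * m) powr (2 / real DIM('a))) powr (real DIM('a) / 2) \<le> (Q * (1 - \<alpha>)) powr (real DIM('a) / 2)"
          by (intro powr_mono2) auto
        then have "k * m \<le> Q powr (real DIM('a) / 2) * (1 - \<alpha>) powr (real DIM('a) / 2)"
          using k m0 Q \<alpha> by (simp add: powr_powr powr_mult)
        then show ?thesis using k by (simp add: field_simps)
      qed
      then show "\<nu> \<in> Bplus (Q powr (real DIM('a) / 2) / k * (1 - \<alpha>) powr (real DIM('a) / 2))"
        using fr m by (simp add: Bplus_def ennreal_leI)
    qed
  qed
qed

theorem theorem1p4:
  fixes N p :: real
  defines "N \<equiv> real DIM('a::euclidean_space)"
  defines "p \<equiv> 1 + 2 / N"
  shows "\<exists>C1 C2. 0 < C1 \<and> C1 \<le> C2 \<and>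
    (\<forall>\<^sub>F \<alpha> in at_left 1. \<forall>h. mittag_leffler_density \<alpha> h \<longrightarrow>
       (Bplus (C1 * (1 - \<alpha>) powr (N / 2)) :: 'a measure set) \<subseteq> G_set h \<alpha> p \<and>
       (G_set h \<alpha> p :: 'a measure set) \<subseteq> Bplus (C2 * (1 - \<alpha>) powr (N / 2)))"
proof -
  obtain C1 where C1: "0 < C1"
    "\<And>\<alpha> h. mittag_leffler_density \<alpha> h \<Longrightarrow> 1/2 \<le> \<alpha> \<Longrightarrow> \<alpha> < 1 \<Longrightarrow> ml_real \<alpha> 1 \<le> 4 \<Longrightarrow>
       (Bplus (C1 * (1 - \<alpha>) powr (N / 2)) :: 'a measure set) \<subseteq> G_set h \<alpha> p"
    using Bplus_subset_G_set[where 'a='a] unfolding N_def p_def by blast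
  obtain C2 where C2: "0 < C2"
    "\<And>\<alpha> h. mittag_leffler_density \<alpha> h \<Longrightarrow> 1/2 \<le> \<alpha> \<Longrightarrow> \<alpha> < 1 \<Longrightarrow>
       ennreal (1/2) \<le> (\<integral>\<^sup>+ \<theta>\<in>{1/2..2}. ennreal (h \<theta>) \<partial>lborel) \<Longrightarrow>
       (G_set h \<alpha> p :: 'a measure set) \<subseteq> Bplus (C2 * (1 - \<alpha>) powr (N / 2))"
    using G_set_subset_Bplus[where 'a='a] unfolding N_def p_def by blast
  \<comment> \<open>The larger of the two constants is used for the outer ball, which gives the
    required order of the constants.\<close>
  have mono: "Bplus (C2 * s) \<subseteq> (Bplus (max C1 C2 * s) :: 'a measure set)" if "0 \<le> s" for s
  proof -
    have "ennreal (C2 * s) \<le> ennreal (max C1 C2 * s)"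
      using that by (intro ennreal_leI mult_right_mono) auto
    then show ?thesis by (auto simp: Bplus_def)
  qed
  have "\<forall>\<^sub>F \<alpha> in at_left (1::real). 1/2 \<le> \<alpha> \<and> \<alpha> < 1"
    by (rule eventually_at_leftI[of "1/2"]) auto
  then have "\<forall>\<^sub>F \<alpha> in at_left 1. \<forall>h. mittag_leffler_density \<alpha> h \<longrightarrow>
       (Bplus (C1 * (1 - \<alpha>) powr (N / 2)) :: 'a measure set) \<subseteq> G_set h \<alpha> p \<and>
       (G_set h \<alpha> p :: 'a measure set) \<subseteq> Bplus (max C1 C2 * (1 - \<alpha>) powr (N / 2))"
    using eventually_ml_real_1 mittag_leffler_density_concentration
  proof eventually_elim
    case (elim \<alpha>)
    show ?case
    proof (intro allI impI conjI)
      fix h assume h: "mittag_leffler_density \<alpha> h"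
      show "(Bplus (C1 * (1 - \<alpha>) powr (N / 2)) :: 'a measure set) \<subseteq> G_set h \<alpha> p"
        using C1(2)[OF h] elim by blast
      have "(G_set h \<alpha> p :: 'a measure set) \<subseteq> Bplus (C2 * (1 - \<alpha>) powr (N / 2))"
        using C2(2)[OF h] elim h by blast
      also have "\<dots> \<subseteq> Bplus (max C1 C2 * (1 - \<alpha>) powr (N / 2))" by (rule mono) simp
      finally show "(G_set h \<alpha> p :: 'a measure set) \<subseteq> Bplus (max C1 C2 * (1 - \<alpha>) powr (N / 2))" .
    qed
  qed
  then show ?thesis using C1(1) by (intro exI[of _ C1] exI[of _ "max C1 C2"]) auto
qed

end
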